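(* Let $\psi_0$ be a two-sided Lévy process with paths of bounded variation satisfying Hypothesis A, Hypothesis B and Assumption B(I). Then almost surely the set $\{y\in\mathbb{R}: a(x)=y \text{ for some } x\in\mathbb{R}\}$ is closed, and hence equals $\mathcal{A}$.
   Context: A two-sided Lévy process $\psi_0=(\psi_0(x))_{x\in\mathbb{R}}$ has càdlàg paths, $\psi_0(0)=0$, and stationary independent increments indexed by $\mathbb{R}$; standing convention: bounded variation $\psi_0$ has zero drift coefficient. Hypothesis A: a.s. $\lim_{|x|\to\infty}x^{-2}\psi_0(x)=0$. Hypothesis B: a.s. $\limsup_{h\downarrow0}h^{-2}\psi_0(h)=+\infty$ and $\liminf_{h\downarrow0}h^{-2}\psi_0(h)=-\infty$. Assumption B(I): for every $b>0,s>0$, with $T'=\inf\{x\ge0:\psi_0(x)-bx-\tfrac12x^2\ge s\}$, on $\{T'<\infty\}$ one has a.s. $\psi_0(T')-bT'-\tfrac12T'^2>s$. For $x\in\mathbb{R}$, $a(x)$ is the largest maximizer of $y\mapsto\psi_0(y)\vee\psi_0(y-)-\tfrac12(y-x)^2$; $\mathcal{A}:=\overline{\{a(x):x\in\mathbb{R}\}}$. *)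

theory Defs
  imports "HOL-Probability.Probability"
begin

definition left_lim :: "(real \<Rightarrow> real) \<Rightarrow> real \<Rightarrow> real" where
  "left_lim f y = Lim (at_left y) f"

definition cadlag :: "(real \<Rightarrow> real) \<Rightarrow> bool" where
  "cadlag f \<longleftrightarrow> (\<forall>x. (f \<longlongrightarrow> f x) (at_right x) \<and> (\<exists>l. (f \<longlongrightarrow> l) (at_left x)))"

definition locally_bv :: "(real \<Rightarrow> real) \<Rightarrow> bool" where
  "locally_bv f \<longleftrightarrow> (\<forall>a b. \<exists>B. \<forall>(n::nat) (t::nat \<Rightarrow> real).
      (a \<le> t 0 \<and> t n \<le> b \<and> (\<forall>i<n. t i \<le> t (Suc i))) \<longrightarrow>
      (\<Sum>i<n. \<bar>f (t (Suc i)) - f (t i)\<bar>) \<le> B)"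

definition zero_drift :: "(real \<Rightarrow> real) \<Rightarrow> bool" where
  "zero_drift f \<longleftrightarrow>
     (\<forall>x\<ge>0. ((\<lambda>s. f s - left_lim f s) has_sum f x) {0<..x}) \<and>
     (\<forall>x<0. ((\<lambda>s. f s - left_lim f s) has_sum (- f x)) {x<..0})"

definition two_sided_levy :: "'a measure \<Rightarrow> (real \<Rightarrow> 'a \<Rightarrow> real) \<Rightarrow> bool" where
  "two_sided_levy M X \<longleftrightarrow>
     prob_space M \<and>
     (\<forall>t. X t \<in> borel_measurable M) \<and>
     (AE \<omega> in M. X 0 \<omega> = 0) \<and>
     (AE \<omega> in M. cadlag (\<lambda>t. X t \<omega>)) \<and>
     (\<forall>(n::nat) (t::nat \<Rightarrow> real). (\<forall>i<n. t i < t (Suc i)) \<longrightarrow>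
        prob_space.indep_vars M (\<lambda>_. borel) (\<lambda>i \<omega>. X (t (Suc i)) \<omega> - X (t i) \<omega>) {..<n}) \<and>
     (\<forall>t h. distr M borel (\<lambda>\<omega>. X (t + h) \<omega> - X t \<omega>) = distr M borel (X h))"

definition envelope_obj :: "(real \<Rightarrow> real) \<Rightarrow> real \<Rightarrow> real \<Rightarrow> real" where
  "envelope_obj f x y = max (f y) (left_lim f y) - (y - x)^2 / 2"

definition amax :: "(real \<Rightarrow> real) \<Rightarrow> real \<Rightarrow> real" where
  "amax f x = (GREATEST y. \<forall>z. envelope_obj f x z \<le> envelope_obj f x y)"

definition hypA :: "'a measure \<Rightarrow> (real \<Rightarrow> 'a \<Rightarrow> real) \<Rightarrow> bool" where
  "hypA M X \<longleftrightarrow> (AE \<omega> in M. ((\<lambda>x. X x \<omega> / x^2) \<longlongrightarrow> 0) at_infinity)"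

definition hypB :: "'a measure \<Rightarrow> (real \<Rightarrow> 'a \<Rightarrow> real) \<Rightarrow> bool" where
  "hypB M X \<longleftrightarrow> (AE \<omega> in M.
      Limsup (at_right 0) (\<lambda>h. ereal (X h \<omega> / h^2)) = \<infinity> \<and>
      Liminf (at_right 0) (\<lambda>h. ereal (X h \<omega> / h^2)) = - \<infinity>)"

definition assumptionBI :: "'a measure \<Rightarrow> (real \<Rightarrow> 'a \<Rightarrow> real) \<Rightarrow> bool" where
  "assumptionBI M X \<longleftrightarrow> (\<forall>b>0. \<forall>s>0. AE \<omega> in M.
     (let S = {x. x \<ge> 0 \<and> X x \<omega> - b * x - x^2 / 2 \<ge> s}; T = Inf S in
       S \<noteq> {} \<longrightarrow> X T \<omega> - b * T - T^2 / 2 > s))"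

end

theory Submission
  imports Defs
begin

text \<open>
  A limit point \<open>y\<close> of the range that is not attained maximizes the objective at some \<open>x\<close>, satisfies
  \<open>f y \<le> f (y-)\<close>, lies strictly below the largest maximizer \<open>z\<close> at \<open>x\<close>, and is approached from the
  left by values \<open>a x'\<close> with \<open>x' < x\<close>. The sign of \<open>y - x\<close> decides how it is excluded.

  Zero drift makes the increments of the path \<open>o(h)\<close> at a fixed time. Hence, for \<open>\<beta> > 0\<close>, the path
  tilted by \<open>- \<beta> t\<close> has only discretely many record times, each reached by a jump and followed by
  a right slope of at most \<open>\<beta>\<close>. Read forwards in time this forces an upward jump at \<open>y\<close> if \<open>y > x\<close>;
  read backwards it makes the path too flat to the left of \<open>y\<close> for the approach if \<open>y < x\<close>.
  If \<open>y = x\<close>, then \<open>z\<close> is a record time seen from some dyadic \<open>q\<close> between \<open>y\<close> and \<open>z\<close>, and, going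
  left from \<open>q\<close>, the path first reaches \<open>f z - (z - w)\<^sup>2 / 2\<close> at \<open>w = y\<close>. The path to the left of
  that first passage is independent of what was used to find it, so by Hypothesis B it cannot stay
  below \<open>f (y-) + h\<^sup>2 / 2\<close>.

  All these statements about random times are obtained without the strong Markov property, by union
  bounds on dyadic grids, in which the expected number of record times is bounded because records not
  overtaken for a while exclude each other.
\<close>

section \<open>Families of independent, identically distributed increments\<close>

text \<open>Stationarity and independence speak about fixed times, whereas \<open>y\<close> and
  \<open>z\<close> are random. The bridge is a count. If a rise of the tilted walk within
  \<open>2 ^ (m - J0)\<close> steps of a fixed index has probability at most 1/2, then a stretch of
  that many steps contains on average at most two records, however large \<open>m\<close> is. A bad
  event that is independent of the record and has probability p at a fixed index then occurs at some
  record with probability at most 2 p. It remains to make p small uniformly in the level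
  \<open>m\<close>, by choosing a second scale (\<open>J\<close> or \<open>r\<close>) while
  \<open>m\<close> stays free. Maximality at \<open>x\<close> puts the path below a parabola that
  starts from \<open>f (y-)\<close> at \<open>y\<close> with slope \<open>y - x\<close>. This leaves
  linear room on one side of \<open>y\<close> if \<open>y\<close> and \<open>x\<close> differ, and
  none if they agree. In that case linear room exists at \<open>z\<close>, and the parabola
  \<open>f z - (z - w)\<^sup>2 / 2\<close> leads from \<open>z\<close> back to \<open>y\<close>: it
  exceeds the bounding parabola by \<open>(z - w) * (w - y)\<close> between the two points and meets
  it at \<open>y\<close>.\<close>

definition iid_family :: "'a measure \<Rightarrow> (int \<Rightarrow> 'a \<Rightarrow> real) \<Rightarrow> real measure \<Rightarrow> bool" where
  "iid_family M \<xi> \<nu> \<longleftrightarrow> prob_space M \<and> prob_space.indep_vars M (\<lambda>_. borel) \<xi> UNIV \<and>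
     (\<forall>j. distr M borel (\<xi> j) = \<nu>)"

abbreviation seq_space :: "(int \<Rightarrow> real) measure" where
  "seq_space \<equiv> PiM UNIV (\<lambda>_. borel)"

text \<open>Plays the role of measurability with respect to the coordinates in \<open>A\<close>, but
  as bare invariance; measurability is asked separately on the whole sequence space, so no
  sub-sigma-algebras have to be carried along.\<close>

definition depends_on :: "'i set \<Rightarrow> (('i \<Rightarrow> real) \<Rightarrow> bool) \<Rightarrow> bool" where
  "depends_on A P \<longleftrightarrow> (\<forall>x y. (\<forall>j\<in>A. x j = y j) \<longrightarrow> P x = P y)"

text \<open>Independence tests finite subfamilies only, and along an injection a finite subfamily of
  the new family is one of the old.\<close>

lemma (in prob_space) indep_vars_reindex:
  assumes ind: "indep_vars N X I" and inj: "inj_on \<pi> J" and im: "\<pi> ` J \<subseteq> I"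
  shows "indep_vars (\<lambda>j. N (\<pi> j)) (\<lambda>j. X (\<pi> j)) J"
proof -
  let ?F = "\<lambda>i. { X i -` A \<inter> space M | A. A \<in> sets (N i)}"
  have rv: "\<And>i. i \<in> I \<Longrightarrow> random_variable (N i) (X i)" and F: "indep_sets ?F I"
    using ind by (auto simp: indep_vars_def2)
  have "indep_sets (\<lambda>j. ?F (\<pi> j)) J"
    unfolding indep_sets_def
  proof (intro conjI ballI allI impI)
    fix j assume "j \<in> J"
    then show "?F (\<pi> j) \<subseteq> events" using F im by (auto simp: indep_sets_def)
  next
    fix K A assume K: "K \<subseteq> J" "K \<noteq> {}" "finite K" and A: "A \<in> Pi K (\<lambda>j. ?F (\<pi> j))"
    have injK: "inj_on \<pi> K" using inj K(1) by (rule inj_on_subset)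
    let ?A = "\<lambda>i. A (the_inv_into K \<pi> i)"
    have inv: "\<And>j. j \<in> K \<Longrightarrow> ?A (\<pi> j) = A j" using injK by (simp add: the_inv_into_f_f)
    have "prob (\<Inter>i\<in>\<pi> ` K. ?A i) = (\<Prod>i\<in>\<pi> ` K. prob (?A i))"
    proof (rule indep_setsD[OF F])
      show "\<pi> ` K \<subseteq> I" "\<pi> ` K \<noteq> {}" "finite (\<pi> ` K)" using K im by auto
      show "\<forall>i\<in>\<pi> ` K. ?A i \<in> ?F i"
      proof
        fix i assume "i \<in> \<pi> ` K"
        then obtain k where k: "k \<in> K" "i = \<pi> k" by blast
        then have "A k \<in> ?F (\<pi> k)" using A by blast
        then show "?A i \<in> ?F i" using inv k by simp
      qed
    qed
    moreover have "(\<Inter>i\<in>\<pi> ` K. ?A i) = (\<Inter>j\<in>K. A j)" using inv by auto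
    moreover have "(\<Prod>i\<in>\<pi> ` K. prob (?A i)) = (\<Prod>j\<in>K. prob (A j))"
      by (simp add: prod.reindex[OF injK] inv)
    ultimately show "prob (\<Inter>j\<in>K. A j) = (\<Prod>j\<in>K. prob (A j))" by simp
  qed
  then show ?thesis using rv im by (auto simp: indep_vars_def2)
qed

lemma iid_familyD:
  assumes "iid_family M \<xi> \<nu>"
  shows "prob_space M" "prob_space.indep_vars M (\<lambda>_. borel) \<xi> UNIV"
    "\<And>j. \<xi> j \<in> borel_measurable M" "\<And>j. distr M borel (\<xi> j) = \<nu>"
  using assms by (auto simp: iid_family_def prob_space.indep_vars_def)

text \<open>Since the index set is all of the integers, both shifts and the reflection
  \<open>- 1 - j\<close> are covered; each preserves the law of the sequence.\<close>

lemma iid_family_reindex: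
  assumes "iid_family M \<xi> \<nu>" "inj \<pi>"
  shows "iid_family M (\<lambda>j. \<xi> (\<pi> j)) \<nu>"
  using prob_space.indep_vars_reindex[OF iid_familyD(1,2)[OF assms(1)] assms(2)] assms(1)
  by (auto simp: iid_family_def)

lemma iid_family_distr:
  assumes "iid_family M \<xi> \<nu>"
  shows "distr M seq_space (\<lambda>\<omega> j. \<xi> j \<omega>) = PiM UNIV (\<lambda>_. \<nu>)"
  using prob_space.indep_vars_iff_distr_eq_PiM[OF iid_familyD(1)[OF assms] UNIV_not_empty
      iid_familyD(3)[OF assms], of "\<lambda>j. j"] iid_familyD(2)[OF assms]
  by (simp add: restrict_UNIV iid_familyD(4)[OF assms])

lemma iid_family_measurable_pred:
  assumes "iid_family M \<xi> \<nu>" "Measurable.pred seq_space P"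
  shows "Measurable.pred M (\<lambda>\<omega>. P (\<lambda>j. \<xi> j \<omega>))"
proof -
  have "(\<lambda>\<omega> j. \<xi> j \<omega>) \<in> measurable M seq_space"
    using iid_familyD(3)[OF assms(1)] measurable_restrict[of UNIV \<xi> M "\<lambda>_. borel"]
    by (simp add: restrict_UNIV)
  from measurable_compose[OF this assms(2)] show ?thesis .
qed

text \<open>Both sequences have the product law of \<open>\<nu>\<close>, however differently they
  are read off the path. Stationarity and time reversal are later used through this lemma.\<close>

lemma iid_family_prob_cong:
  assumes "iid_family M \<xi> \<nu>" "iid_family M \<zeta> \<nu>" "Measurable.pred seq_space P"
  shows "measure M {\<omega>\<in>space M. P (\<lambda>j. \<xi> j \<omega>)} = measure M {\<omega>\<in>space M. P (\<lambda>j. \<zeta> j \<omega>)}"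
proof -
  have "measure M {\<omega>\<in>space M. P (\<lambda>j. \<eta> j \<omega>)} = measure (PiM UNIV (\<lambda>_. \<nu>)) {x. P x}"
    if "iid_family M \<eta> \<nu>" for \<eta>
  proof -
    have m: "(\<lambda>\<omega> j. \<eta> j \<omega>) \<in> measurable M seq_space"
      using iid_familyD(3)[OF that] measurable_restrict[of UNIV \<eta> M "\<lambda>_. borel"]
      by (simp add: restrict_UNIV)
    have "{x. P x} \<in> sets seq_space" using assms(3) by (simp add: pred_def space_PiM)
    then have "measure (distr M seq_space (\<lambda>\<omega> j. \<eta> j \<omega>)) {x. P x} =
        measure M ((\<lambda>\<omega> j. \<eta> j \<omega>) -` {x. P x} \<inter> space M)"
      by (rule measure_distr[OF m])
    moreover have "(\<lambda>\<omega> j. \<eta> j \<omega>) -` {x. P x} \<inter> space M = {\<omega>\<in>space M. P (\<lambda>j. \<eta> j \<omega>)}" by auto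
    ultimately show ?thesis by (simp only: iid_family_distr[OF that])
  qed
  from this[OF assms(1)] this[OF assms(2)] show ?thesis by simp
qed

text \<open>Restrictions of the family to disjoint index sets are independent, and a predicate
  depending on \<open>A\<close> only can be evaluated from the restriction to \<open>A\<close>,
  whatever fills the other coordinates.\<close>

lemma iid_family_indep:
  assumes iid: "iid_family M \<xi> \<nu>"
    and P: "Measurable.pred seq_space P" "depends_on A P"
    and Q: "Measurable.pred seq_space Q" "depends_on B Q" and disj: "A \<inter> B = {}"
  shows "measure M {\<omega>\<in>space M. P (\<lambda>j. \<xi> j \<omega>) \<and> Q (\<lambda>j. \<xi> j \<omega>)} =
    measure M {\<omega>\<in>space M. P (\<lambda>j. \<xi> j \<omega>)} * measure M {\<omega>\<in>space M. Q (\<lambda>j. \<xi> j \<omega>)}"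
proof -
  interpret prob_space M using iid by (rule iid_familyD)
  have ind: "indep_var (PiM A (\<lambda>_. borel)) (\<lambda>\<omega>. restrict (\<lambda>i. \<xi> i \<omega>) A)
      (PiM B (\<lambda>_. borel)) (\<lambda>\<omega>. restrict (\<lambda>i. \<xi> i \<omega>) B)"
    by (rule indep_var_restrict[OF iid_familyD(2)[OF iid] disj]) auto
  \<comment> \<open>Padding with zeros turns a partial sequence into a full one, so that
    \<open>P\<close> and \<open>Q\<close> become predicates on the factor spaces.\<close>
  let ?ext = "\<lambda>S x (j::int). if j \<in> S then x j else (0::real)"
  have ext: "?ext S \<in> measurable (PiM S (\<lambda>_. borel)) seq_space" for S
  proof -
    have "(\<lambda>x. ?ext S x j) \<in> borel_measurable (PiM S (\<lambda>_. borel))" for j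
      by (cases "j \<in> S") (simp_all add: measurable_component_singleton)
    then have "(\<lambda>x. \<lambda>j\<in>UNIV. ?ext S x j) \<in> measurable (PiM S (\<lambda>_. borel)) seq_space"
      by (rule measurable_restrict)
    then show ?thesis unfolding restrict_UNIV .
  qed
  have dep: "R (?ext S (restrict x S)) = R x" if "depends_on S R" for R S and x :: "int \<Rightarrow> real"
    using that by (auto simp: depends_on_def)
  have sets: "{x\<in>space (PiM S (\<lambda>_. borel)). R (?ext S x)} \<in> sets (PiM S (\<lambda>_. borel))"
    if "Measurable.pred seq_space R" for S R
    using measurable_compose[OF ext that, of S] by (simp add: pred_def)
  have eq: "(\<lambda>\<omega>. restrict (\<lambda>i. \<xi> i \<omega>) S) -` {x\<in>space (PiM S (\<lambda>_. borel)). R (?ext S x)} \<inter> space M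
      = {\<omega>\<in>space M. R (\<lambda>j. \<xi> j \<omega>)}" if "depends_on S R" for R S
    using dep[OF that] by (auto simp: space_PiM)
  have "prob ((\<lambda>\<omega>. (restrict (\<lambda>i. \<xi> i \<omega>) A, restrict (\<lambda>i. \<xi> i \<omega>) B)) -`
      ({x\<in>space (PiM A (\<lambda>_. borel)). P (?ext A x)} \<times> {x\<in>space (PiM B (\<lambda>_. borel)). Q (?ext B x)}) \<inter> space M)
     = prob {\<omega>\<in>space M. P (\<lambda>j. \<xi> j \<omega>)} * prob {\<omega>\<in>space M. Q (\<lambda>j. \<xi> j \<omega>)}"
    by (subst indep_varD[OF ind sets[OF P(1)] sets[OF Q(1)]])
       (simp only: eq[OF P(2)] eq[OF Q(2)])
  moreover have "(\<lambda>\<omega>. (restrict (\<lambda>i. \<xi> i \<omega>) A, restrict (\<lambda>i. \<xi> i \<omega>) B)) -`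
      ({x\<in>space (PiM A (\<lambda>_. borel)). P (?ext A x)} \<times> {x\<in>space (PiM B (\<lambda>_. borel)). Q (?ext B x)}) \<inter> space M
     = {\<omega>\<in>space M. P (\<lambda>j. \<xi> j \<omega>)} \<inter> {\<omega>\<in>space M. Q (\<lambda>j. \<xi> j \<omega>)}"
    using eq[OF P(2)] eq[OF Q(2)] by blast
  moreover have "\<dots> = {\<omega>\<in>space M. P (\<lambda>j. \<xi> j \<omega>) \<and> Q (\<lambda>j. \<xi> j \<omega>)}" by auto
  ultimately show ?thesis by simp
qed

section \<open>Records of random walks\<close>

abbreviation walk :: "(int \<Rightarrow> real) \<Rightarrow> int \<Rightarrow> int \<Rightarrow> real" where
  "walk x a b \<equiv> sum x {a..<b}"

text \<open>A strict record at \<open>i\<close> of the walk with drift \<open>d\<close> subtracted,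
  counted from index 0. Phrased by increments back from \<open>i\<close>, it involves no step after
  \<open>i\<close>.\<close>

definition ladder :: "real \<Rightarrow> (int \<Rightarrow> real) \<Rightarrow> int \<Rightarrow> bool" where
  "ladder d x i \<longleftrightarrow> (\<forall>j\<in>{0..<i}. walk x j i > d * of_int (i - j))"

definition rises :: "real \<Rightarrow> int \<Rightarrow> (int \<Rightarrow> real) \<Rightarrow> int \<Rightarrow> bool" where
  "rises d K x i \<longleftrightarrow> (\<exists>k\<in>{1..K}. walk x i (i + k) > d * of_int k)"

lemma walk_shift: "walk (\<lambda>j. x (j + m)) a b = walk x (a + m) (b + m)"
  by (rule sum.reindex_bij_witness[of _ "\<lambda>j. j - m" "\<lambda>j. j + m"]) auto

lemma walk_telescope: "a \<le> b \<Longrightarrow> walk (\<lambda>j. f (j + 1) - f j) a b = f b - f a"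
proof (induction b rule: int_ge_induct)
  case (step b)
  have "{a..<b + 1} = insert b {a..<b}" using step by auto
  then show ?case using step by simp
qed simp

lemma measurable_walk [measurable]: "(\<lambda>x. walk x a b) \<in> borel_measurable seq_space"
  by measurable

lemma measurable_ladder [measurable]: "Measurable.pred seq_space (\<lambda>x. ladder d x i)"
  unfolding ladder_def by measurable

lemma measurable_rises [measurable]: "Measurable.pred seq_space (\<lambda>x. rises d K x i)"
  unfolding rises_def by measurable

lemma depends_on_ladder: "depends_on {0..<i} (\<lambda>x. ladder d x i)"
proof -
  have "walk x j i = walk y j i" if "\<forall>l\<in>{0..<i}. x l = y l" "0 \<le> j" for x y j
    using that by (intro sum.cong) auto
  then show ?thesis unfolding depends_on_def ladder_def by (metis atLeastLessThan_iff)
qed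

lemma depends_on_rises: "depends_on {i..} (\<lambda>x. rises d K x i)"
proof -
  have "walk x i l = walk y i l" if "\<forall>l\<in>{i..}. x l = y l" for x y l
    using that by (intro sum.cong) auto
  then show ?thesis unfolding depends_on_def rises_def by metis
qed

lemma iid_family_shift:
  assumes "iid_family M \<xi> \<nu>"
  shows "iid_family M (\<lambda>j. \<xi> (j + m)) \<nu>"
  by (rule iid_family_reindex[OF assms]) (simp add: inj_on_def)

lemma iid_family_prob_shift:
  assumes "iid_family M \<xi> \<nu>" "Measurable.pred seq_space P"
  shows "measure M {\<omega>\<in>space M. P (\<lambda>j. \<xi> (j + m) \<omega>)} = measure M {\<omega>\<in>space M. P (\<lambda>j. \<xi> j \<omega>)}"
  by (rule iid_family_prob_cong[OF iid_family_shift[OF assms(1)] assms])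

lemma depends_on_not: "depends_on A P \<Longrightarrow> depends_on A (\<lambda>x. \<not> P x)"
  unfolding depends_on_def by metis

lemma rises_shift: "rises d K (\<lambda>j. x (j + m)) i = rises d K x (i + m)"
  unfolding rises_def walk_shift by (simp add: ac_simps)

text \<open>Ladder times that are not overtaken within the next \<open>K\<close> steps exclude each other.\<close>

lemma sum_prob_ladder_le:
  assumes iid: "iid_family M \<xi> \<nu>" and "m \<le> K"
  shows "(\<Sum>i\<in>{0..m}. measure M {\<omega>\<in>space M. ladder d (\<lambda>j. \<xi> j \<omega>) i}) *
    measure M {\<omega>\<in>space M. \<not> rises d K (\<lambda>j. \<xi> j \<omega>) 0} \<le> 1"
proof -
  interpret prob_space M using iid by (rule iid_familyD)
  let ?E = "\<lambda>i. {\<omega>\<in>space M. ladder d (\<lambda>j. \<xi> j \<omega>) i \<and> \<not> rises d K (\<lambda>j. \<xi> j \<omega>) i}"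
  have meas: "?E i \<in> events" for i
    using iid_family_measurable_pred[OF iid, of "\<lambda>x. ladder d x i \<and> \<not> rises d K x i"]
    by (simp add: pred_def)
  have prob: "prob (?E i) = prob {\<omega>\<in>space M. ladder d (\<lambda>j. \<xi> j \<omega>) i} *
      prob {\<omega>\<in>space M. \<not> rises d K (\<lambda>j. \<xi> j \<omega>) 0}" for i
  proof -
    have "prob (?E i) = prob {\<omega>\<in>space M. ladder d (\<lambda>j. \<xi> j \<omega>) i} *
        prob {\<omega>\<in>space M. \<not> rises d K (\<lambda>j. \<xi> j \<omega>) i}"
      by (rule iid_family_indep[OF iid _ depends_on_ladder _ depends_on_not[OF depends_on_rises]]) auto
    moreover have "prob {\<omega>\<in>space M. \<not> rises d K (\<lambda>j. \<xi> (j + i) \<omega>) 0}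
        = prob {\<omega>\<in>space M. \<not> rises d K (\<lambda>j. \<xi> j \<omega>) 0}"
      by (rule iid_family_prob_shift[OF iid, of "\<lambda>x. \<not> rises d K x 0"]) measurable
    ultimately show ?thesis by (simp add: rises_shift[of d K "\<lambda>j. \<xi> j _"])
  qed
  have disj: "disjoint_family_on ?E {0..m}"
    unfolding disjoint_family_on_def
  proof (intro ballI impI)
    have *: False if "ladder d x i'" "\<not> rises d K x i" "i < i'" "0 \<le> i" "i' \<le> m" for x i i'
    proof -
      have "walk x i i' > d * of_int (i' - i)" using that unfolding ladder_def by auto
      \<comment> \<open>The horizon \<open>K\<close> has to cover the whole stretch; this is where
        \<open>m \<le> K\<close> enters.\<close>
      moreover have "i' - i \<in> {1..K}" using that assms(2) by auto
      ultimately show False using that(2) unfolding rises_def by (auto dest!: bspec[of _ _ "i' - i"])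
    qed
    fix i i' assume "i \<in> {0..m}" "i' \<in> {0..m}" "i \<noteq> i'"
    then show "?E i \<inter> ?E i' = {}" using *[of _ i i'] *[of _ i' i] by (cases "i < i'") auto
  qed
  have "(\<Sum>i\<in>{0..m}. prob (?E i)) = prob (\<Union>i\<in>{0..m}. ?E i)"
    by (rule finite_measure_finite_Union[symmetric]) (use meas disj in auto)
  then show ?thesis by (simp add: prob sum_distrib_right)
qed

text \<open>Being a record concerns the steps before \<open>i\<close>, rising those from
  \<open>i\<close> on, so each summand of the union bound factors. The horizon \<open>K\<close> only
  serves to bound the sum of the record probabilities; the horizon \<open>K'\<close> of the unwanted
  event is free.\<close>

lemma prob_ladder_rises_le:
  assumes iid: "iid_family M \<xi> \<nu>" and "m \<le> K"
  shows "measure M {\<omega>\<in>space M. \<exists>i\<in>{0..m}. ladder d (\<lambda>j. \<xi> j \<omega>) i \<and> rises d K' (\<lambda>j. \<xi> j \<omega>) i} *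
    measure M {\<omega>\<in>space M. \<not> rises d K (\<lambda>j. \<xi> j \<omega>) 0}
    \<le> measure M {\<omega>\<in>space M. rises d K' (\<lambda>j. \<xi> j \<omega>) 0}"
proof -
  interpret prob_space M using iid by (rule iid_familyD)
  let ?E = "\<lambda>i. {\<omega>\<in>space M. ladder d (\<lambda>j. \<xi> j \<omega>) i \<and> rises d K' (\<lambda>j. \<xi> j \<omega>) i}"
  let ?p = "prob {\<omega>\<in>space M. rises d K' (\<lambda>j. \<xi> j \<omega>) 0}"
  let ?c = "prob {\<omega>\<in>space M. \<not> rises d K (\<lambda>j. \<xi> j \<omega>) 0}"
  have meas: "?E i \<in> events" for i
    using iid_family_measurable_pred[OF iid, of "\<lambda>x. ladder d x i \<and> rises d K' x i"]
    by (simp add: pred_def)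
  have prob: "prob (?E i) = prob {\<omega>\<in>space M. ladder d (\<lambda>j. \<xi> j \<omega>) i} * ?p" for i
  proof -
    have "prob (?E i) = prob {\<omega>\<in>space M. ladder d (\<lambda>j. \<xi> j \<omega>) i} *
        prob {\<omega>\<in>space M. rises d K' (\<lambda>j. \<xi> j \<omega>) i}"
      by (rule iid_family_indep[OF iid _ depends_on_ladder _ depends_on_rises]) auto
    moreover have "prob {\<omega>\<in>space M. rises d K' (\<lambda>j. \<xi> (j + i) \<omega>) 0} = ?p"
      by (rule iid_family_prob_shift[OF iid, of "\<lambda>x. rises d K' x 0"]) measurable
    ultimately show ?thesis by (simp add: rises_shift[of d K' "\<lambda>j. \<xi> j _"])
  qed
  have U: "{\<omega>\<in>space M. \<exists>i\<in>{0..m}. ladder d (\<lambda>j. \<xi> j \<omega>) i \<and> rises d K' (\<lambda>j. \<xi> j \<omega>) i} = (\<Union>i\<in>{0..m}. ?E i)"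
    (is "?U = _") by auto
  have "prob ?U \<le> (\<Sum>i\<in>{0..m}. prob (?E i))"
    unfolding U by (rule finite_measure_subadditive_finite) (use meas in auto)
  also have "\<dots> = (\<Sum>i\<in>{0..m}. prob {\<omega>\<in>space M. ladder d (\<lambda>j. \<xi> j \<omega>) i}) * ?p"
    by (simp add: prob sum_distrib_right)
  finally have "prob ?U * ?c
      \<le> (\<Sum>i\<in>{0..m}. prob {\<omega>\<in>space M. ladder d (\<lambda>j. \<xi> j \<omega>) i}) * ?p * ?c"
    by (rule mult_right_mono) simp
  also have "\<dots> = ((\<Sum>i\<in>{0..m}. prob {\<omega>\<in>space M. ladder d (\<lambda>j. \<xi> j \<omega>) i}) * ?c) * ?p" by simp
  also have "\<dots> \<le> 1 * ?p" by (rule mult_right_mono[OF sum_prob_ladder_le[OF assms]]) simp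
  finally show ?thesis by simp
qed

text \<open>Here \<open>i\<close> is a time to the right of the origin and \<open>k\<close> counts steps to the left of it.\<close>

definition crosses :: "(int \<Rightarrow> int \<Rightarrow> real) \<Rightarrow> (int \<Rightarrow> real) \<Rightarrow> int \<Rightarrow> int \<Rightarrow> bool" where
  "crosses c x i k \<longleftrightarrow> - walk x (- k) 0 > walk x 0 i - c i k"

definition first_crossing :: "(int \<Rightarrow> int \<Rightarrow> real) \<Rightarrow> (int \<Rightarrow> real) \<Rightarrow> int \<Rightarrow> int \<Rightarrow> bool" where
  "first_crossing c x i k \<longleftrightarrow> crosses c x i k \<and> (\<forall>l\<in>{0..<k}. \<not> crosses c x i l)"

text \<open>\<open>H\<close> lists lags. In use these are the finitely many lags of a fixed coarse
  grid, so that the probability of the event does not change when the grid is refined.\<close>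

definition stays_below :: "(int \<Rightarrow> real) \<Rightarrow> int set \<Rightarrow> (int \<Rightarrow> real) \<Rightarrow> int \<Rightarrow> bool" where
  "stays_below \<phi> H x k \<longleftrightarrow> (\<forall>u\<in>H. - walk x (- k - u) (- k) \<le> \<phi> u)"

lemma measurable_crosses [measurable]: "Measurable.pred seq_space (\<lambda>x. crosses c x i k)"
  unfolding crosses_def by measurable

lemma measurable_first_crossing [measurable]: "Measurable.pred seq_space (\<lambda>x. first_crossing c x i k)"
  unfolding first_crossing_def by measurable

lemma measurable_stays_below [measurable]: "Measurable.pred seq_space (\<lambda>x. stays_below \<phi> H x k)"
  unfolding stays_below_def by measurable

lemma depends_on_ladder_crossing:
  assumes "0 \<le> i" "0 \<le> k"
  shows "depends_on {- k..<i} (\<lambda>x. ladder d x i \<and> first_crossing c x i k)"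
  unfolding depends_on_def
proof (intro allI impI)
  fix x y :: "int \<Rightarrow> real" assume xy: "\<forall>j\<in>{- k..<i}. x j = y j"
  have w: "walk x a b = walk y a b" if "- k \<le> a" "b \<le> i" for a b
    using xy that by (intro sum.cong) auto
  have "crosses c x i l = crosses c y i l" if "l \<le> k" for l
    using w[of "- l" 0] w[of 0 i] that assms by (auto simp: crosses_def)
  moreover have "ladder d x i = ladder d y i"
    using w[of _ i] assms by (auto simp: ladder_def)
  ultimately show "(ladder d x i \<and> first_crossing c x i k) = (ladder d y i \<and> first_crossing c y i k)"
    by (auto simp: first_crossing_def)
qed

lemma depends_on_stays_below: "depends_on {..<- k} (\<lambda>x. stays_below \<phi> H x k)"
proof -
  have "walk x l (- k) = walk y l (- k)" if "\<forall>j\<in>{..<- k}. x j = y j" for x y l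
    using that by (intro sum.cong) auto
  then show ?thesis unfolding depends_on_def stays_below_def by metis
qed

text \<open>A record at \<open>i\<close> with first crossing at \<open>k\<close> is decided by the
  steps from \<open>- k\<close> to \<open>i\<close>, the last event by those before
  \<open>- k\<close>. For fixed \<open>i\<close> the first crossings exclude each other, so summing
  over \<open>k\<close> costs nothing and the bound on the number of records applies again.\<close>

lemma prob_ladder_crossing_le:
  assumes iid: "iid_family M \<xi> \<nu>" and "m \<le> K"
  shows "measure M {\<omega>\<in>space M. \<exists>i\<in>{0..m}. \<exists>k\<in>{0..L}. ladder d (\<lambda>j. \<xi> j \<omega>) i \<and>
      first_crossing c (\<lambda>j. \<xi> j \<omega>) i k \<and> stays_below \<phi> H (\<lambda>j. \<xi> j \<omega>) k} *
    measure M {\<omega>\<in>space M. \<not> rises d K (\<lambda>j. \<xi> j \<omega>) 0}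
    \<le> measure M {\<omega>\<in>space M. stays_below \<phi> H (\<lambda>j. \<xi> j \<omega>) 0}"
proof -
  interpret prob_space M using iid by (rule iid_familyD)
  let ?lad = "\<lambda>i. {\<omega>\<in>space M. ladder d (\<lambda>j. \<xi> j \<omega>) i}"
  let ?D = "\<lambda>i k. {\<omega>\<in>space M. ladder d (\<lambda>j. \<xi> j \<omega>) i \<and> first_crossing c (\<lambda>j. \<xi> j \<omega>) i k}"
  let ?E = "\<lambda>i k. {\<omega>\<in>space M. (ladder d (\<lambda>j. \<xi> j \<omega>) i \<and> first_crossing c (\<lambda>j. \<xi> j \<omega>) i k) \<and>
    stays_below \<phi> H (\<lambda>j. \<xi> j \<omega>) k}"
  let ?p = "prob {\<omega>\<in>space M. stays_below \<phi> H (\<lambda>j. \<xi> j \<omega>) 0}"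
  let ?c = "prob {\<omega>\<in>space M. \<not> rises d K (\<lambda>j. \<xi> j \<omega>) 0}"
  have measE: "?E i k \<in> events" for i k
    using iid_family_measurable_pred[OF iid,
        of "\<lambda>x. (ladder d x i \<and> first_crossing c x i k) \<and> stays_below \<phi> H x k"]
    by (simp add: pred_def)
  have measD: "?D i k \<in> events" for i k
    using iid_family_measurable_pred[OF iid, of "\<lambda>x. ladder d x i \<and> first_crossing c x i k"]
    by (simp add: pred_def)
  have measL: "?lad i \<in> events" for i
    using iid_family_measurable_pred[OF iid, of "\<lambda>x. ladder d x i"]
    by (simp add: pred_def)
  have prob: "prob (?E i k) = prob (?D i k) * ?p" if "0 \<le> i" "0 \<le> k" for i k
  proof -
    have "prob (?E i k) = prob (?D i k) * prob {\<omega>\<in>space M. stays_below \<phi> H (\<lambda>j. \<xi> j \<omega>) k}"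
      by (rule iid_family_indep[OF iid _ depends_on_ladder_crossing[OF that] _ depends_on_stays_below])
        auto
    moreover have "prob {\<omega>\<in>space M. stays_below \<phi> H (\<lambda>j. \<xi> (j + - k) \<omega>) 0} = ?p"
      by (rule iid_family_prob_shift[OF iid, of "\<lambda>x. stays_below \<phi> H x 0"]) measurable
    moreover have "stays_below \<phi> H (\<lambda>j. x (j + - k)) 0 = stays_below \<phi> H x k" for x
    proof -
      have "walk (\<lambda>j. x (j + - k)) (- 0 - u) (- 0) = walk x (- k - u) (- k)" for u
        unfolding walk_shift by (rule arg_cong2[where f="walk x"]) simp_all
      then show ?thesis unfolding stays_below_def by simp
    qed
    from this[of "\<lambda>j. \<xi> j _"]
    have "stays_below \<phi> H (\<lambda>j. \<xi> (j + - k) \<omega>) 0 = stays_below \<phi> H (\<lambda>j. \<xi> j \<omega>) k" for \<omega> .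
    ultimately show ?thesis by simp
  qed
  have le: "(\<Sum>k\<in>{0..L}. prob (?D i k)) \<le> prob (?lad i)" for i
  proof -
    have "?D i k \<inter> ?D i k' = {}" if "0 \<le> k" "0 \<le> k'" "k < k'" for k k'
      using that unfolding first_crossing_def by auto
    then have "disjoint_family_on (?D i) {0..L}"
      unfolding disjoint_family_on_def by (metis (no_types, lifting) atLeastAtMost_iff inf_commute linorder_neqE)
    then have "(\<Sum>k\<in>{0..L}. prob (?D i k)) = prob (\<Union>k\<in>{0..L}. ?D i k)"
      using measD by (intro finite_measure_finite_Union[symmetric]) auto
    also have "\<dots> \<le> prob (?lad i)"
      using measL by (intro finite_measure_mono) auto
    finally show ?thesis .
  qed
  have U: "{\<omega>\<in>space M. \<exists>i\<in>{0..m}. \<exists>k\<in>{0..L}. ladder d (\<lambda>j. \<xi> j \<omega>) i \<and>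
      first_crossing c (\<lambda>j. \<xi> j \<omega>) i k \<and> stays_below \<phi> H (\<lambda>j. \<xi> j \<omega>) k}
      = (\<Union>i\<in>{0..m}. \<Union>k\<in>{0..L}. ?E i k)" (is "?U = _")
    by auto
  have "prob ?U \<le> (\<Sum>i\<in>{0..m}. prob (\<Union>k\<in>{0..L}. ?E i k))"
    unfolding U by (rule finite_measure_subadditive_finite) (use measE in auto)
  also have "\<dots> \<le> (\<Sum>i\<in>{0..m}. \<Sum>k\<in>{0..L}. prob (?E i k))"
  proof (rule sum_mono)
    fix i show "prob (\<Union>k\<in>{0..L}. ?E i k) \<le> (\<Sum>k\<in>{0..L}. prob (?E i k))"
      by (rule finite_measure_subadditive_finite) (simp, use measE in blast)
  qed
  also have "\<dots> = (\<Sum>i\<in>{0..m}. \<Sum>k\<in>{0..L}. prob (?D i k)) * ?p"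
    unfolding sum_distrib_right by (intro sum.cong refl prob) auto
  also have "\<dots> \<le> (\<Sum>i\<in>{0..m}. prob (?lad i)) * ?p"
    by (rule mult_right_mono, rule sum_mono, rule le) simp
  finally have "prob ?U * ?c \<le> (\<Sum>i\<in>{0..m}. prob (?lad i)) * ?p * ?c"
    by (rule mult_right_mono) simp
  also have "\<dots> = ((\<Sum>i\<in>{0..m}. prob (?lad i)) * ?c) * ?p" by simp
  also have "\<dots> \<le> 1 * ?p" by (rule mult_right_mono[OF sum_prob_ladder_le[OF assms]]) simp
  finally show ?thesis by simp
qed

section \<open>Increments of the path along grids\<close>

text \<open>A negative step \<open>h\<close> reads the path backwards in time.\<close>

definition grid :: "(real \<Rightarrow> real) \<Rightarrow> real \<Rightarrow> real \<Rightarrow> int \<Rightarrow> real" where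
  "grid f q h j = f (q + of_int (j + 1) * h) - f (q + of_int j * h)"

lemma walk_grid:
  assumes "a \<le> b"
  shows "walk (grid f q h) a b = f (q + of_int b * h) - f (q + of_int a * h)"
  using walk_telescope[OF assms, of "\<lambda>j. f (q + of_int j * h)"] by (simp add: grid_def)

text \<open>The process has independent increments along finite increasing lists of times; every
  finite set of integers lies in a block of consecutive ones, and a negative step is a positive one
  read in reverse with signs changed.\<close>

lemma iid_family_grid:
  assumes levy: "two_sided_levy M X" and "h \<noteq> 0"
  shows "iid_family M (\<lambda>j \<omega>. grid (\<lambda>t. X t \<omega>) q h j) (distr M borel (X h))"
proof -
  interpret prob_space M using levy by (simp add: two_sided_levy_def)
  have meas [measurable]: "X t \<in> borel_measurable M" for t using levy by (simp add: two_sided_levy_def)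
  have indep: "indep_vars (\<lambda>_. borel) (\<lambda>i \<omega>. X (t (Suc i)) \<omega> - X (t i) \<omega>) {..<n}"
    if "\<And>i. i < n \<Longrightarrow> t i < t (Suc i)" for n and t :: "nat \<Rightarrow> real"
    using levy that by (simp add: two_sided_levy_def)
  have stat: "distr M borel (\<lambda>\<omega>. X (t + h) \<omega> - X t \<omega>) = distr M borel (X h)" for t h
    using levy by (simp add: two_sided_levy_def)
  have pos: "indep_vars (\<lambda>_. borel) (\<lambda>j \<omega>. grid (\<lambda>t. X t \<omega>) q h j) UNIV" if "0 < h" for h
  proof -
    have "indep_vars (\<lambda>_. borel) (\<lambda>j \<omega>. grid (\<lambda>t. X t \<omega>) q h j) J" if "finite J" for J
    proof -
      obtain a b where J: "J \<subseteq> {a..<b}"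
      proof (cases "J = {}")
        case False
        then have "J \<subseteq> {Min J..<Max J + 1}" using \<open>finite J\<close> by (auto simp: zle_add1_eq_le)
        then show ?thesis by (rule that)
      qed (use that in auto)
      define t where "t = (\<lambda>i::nat. q + (of_int a + real i) * h)"
      have ind: "indep_vars (\<lambda>_. borel) (\<lambda>i \<omega>. X (t (Suc i)) \<omega> - X (t i) \<omega>) {..<nat (b - a)}"
        by (rule indep) (use \<open>0 < h\<close> in \<open>simp add: t_def\<close>)
      have "indep_vars (\<lambda>_. borel)
          (\<lambda>j \<omega>. X (t (Suc (nat (j - a)))) \<omega> - X (t (nat (j - a))) \<omega>) J"
      proof (rule indep_vars_reindex[OF ind])
        show "inj_on (\<lambda>j. nat (j - a)) J"
          using J by (intro inj_onI) (simp add: subset_iff eq_nat_nat_iff)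
        show "(\<lambda>j. nat (j - a)) ` J \<subseteq> {..<nat (b - a)}" using J by auto
      qed
      moreover have "X (t (Suc (nat (j - a)))) \<omega> - X (t (nat (j - a))) \<omega> = grid (\<lambda>t. X t \<omega>) q h j"
        if "j \<in> J" for j \<omega>
        using that J by (auto simp: t_def grid_def algebra_simps)
      ultimately show ?thesis by (subst indep_vars_cong[OF refl _ refl]) auto
    qed
    then show ?thesis
      unfolding indep_vars_def2 by (subst indep_sets_finite_index_sets) (auto simp: indep_vars_def2 grid_def)
  qed
  have ind: "indep_vars (\<lambda>_. borel) (\<lambda>j \<omega>. grid (\<lambda>t. X t \<omega>) q h j) UNIV"
  proof (cases "0 < h")
    case False
    then have "indep_vars (\<lambda>_. borel) (\<lambda>j \<omega>. grid (\<lambda>t. X t \<omega>) q (- h) j) UNIV"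
      using pos[of "- h"] assms(2) by simp
    \<comment> \<open>Reflecting the indices about -1/2 exchanges the two ends of every increment,
      hence the sign in the next line.\<close>
    then have "indep_vars (\<lambda>_. borel) (\<lambda>j \<omega>. grid (\<lambda>t. X t \<omega>) q (- h) (- 1 - j)) UNIV"
      by (rule indep_vars_reindex) (auto simp: inj_on_def)
    then have "indep_vars (\<lambda>_. borel) (\<lambda>j \<omega>. - grid (\<lambda>t. X t \<omega>) q (- h) (- 1 - j)) UNIV"
      by (rule indep_vars_compose2[where Y="\<lambda>_ x. - x"]) simp
    moreover have "- grid f q (- h) (- 1 - j) = grid f q h j" for f j
      by (simp add: grid_def algebra_simps)
    ultimately show ?thesis by simp
  qed (rule pos)
  have "distr M borel (\<lambda>\<omega>. grid (\<lambda>t. X t \<omega>) q h j) = distr M borel (X h)" for j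
    using stat[of "q + of_int j * h" h] by (simp add: grid_def algebra_simps)
  then show ?thesis using ind prob_space_axioms by (simp add: iid_family_def)
qed

text \<open>A discrete form of the Hardy--Littlewood maximal inequality, by greedily skipping the
  window witnessing each steep point.\<close>

lemma card_steep_le:
  fixes v :: "int \<Rightarrow> real"
  assumes mono: "\<And>i j. \<lbrakk>a \<le> i; i \<le> j; j \<le> n + w\<rbrakk> \<Longrightarrow> v i \<le> v j"
    and c: "0 < c" and "a \<le> n" "0 \<le> w"
  shows "c * card {i\<in>{a..<n}. \<exists>k\<in>{1..w}. v (i + k) - v i > c * of_int k} \<le> v (n + w) - v a"
  using assms(1,3)
proof (induction "nat (n - a)" arbitrary: a rule: less_induct)
  case less
  let ?B = "\<lambda>a. {i\<in>{a..<n}. \<exists>k\<in>{1..w}. v (i + k) - v i > c * of_int k}"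
  have fin: "finite (?B a)" for a by (rule finite_subset[of _ "{a..<n}"]) auto
  consider "a = n" | "a < n" "a \<notin> ?B a" | "a < n" "a \<in> ?B a" using less.prems by fastforce
  then show ?case
  proof cases
    case 1
    then show ?thesis using less.prems(1)[of a "n + w"] \<open>0 \<le> w\<close> by auto
  next
    case 2
    then have "?B a = ?B (a + 1)" by (auto simp: order_le_less)
    moreover have "c * card (?B (a + 1)) \<le> v (n + w) - v (a + 1)"
      using 2 less.prems by (intro less.hyps) auto
    moreover have "v a \<le> v (a + 1)" using 2 \<open>0 \<le> w\<close> by (intro less.prems) auto
    ultimately show ?thesis by simp
  next
    case 3
    then obtain k where k: "k \<in> {1..w}" "v (a + k) - v a > c * of_int k" by auto
    show ?thesis
    proof (cases "a + k \<le> n")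
      case True
      have IH: "c * card (?B (a + k)) \<le> v (n + w) - v (a + k)"
        using 3 k True by (intro less.hyps less.prems) auto
      \<comment> \<open>All points inside the window of \<open>a\<close> are counted as steep; the
        increment over the window pays \<open>c\<close> for each of them.\<close>
      have "card (?B a) \<le> card ({a..<a + k} \<union> ?B (a + k))"
        by (rule card_mono) (use fin[of "a + k"] in auto)
      moreover have "card ({a..<a + k} \<union> ?B (a + k)) \<le> nat k + card (?B (a + k))"
        using card_Un_le[of "{a..<a + k}" "?B (a + k)"] by simp
      ultimately have "card (?B a) \<le> nat k + card (?B (a + k))" by (rule order_trans)
      then have "real (card (?B a)) \<le> real (nat k + card (?B (a + k)))" by (rule of_nat_mono)
      then have "real (card (?B a)) \<le> of_int k + card (?B (a + k))" using k by simp
      then have "c * card (?B a) \<le> c * of_int k + c * card (?B (a + k))"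
        using c by (simp flip: distrib_left)
      with IH show ?thesis using k by linarith
    next
      \<comment> \<open>The last window may stick out beyond \<open>n\<close>; this is why the bound
        ends at \<open>n + w\<close>.\<close>
      case False
      have "card (?B a) \<le> card {a..<a + k}" using False by (intro card_mono) auto
      then have "card (?B a) \<le> nat k" by simp
      then have "real (card (?B a)) \<le> real (nat k)" by (rule of_nat_mono)
      also have "real (nat k) = of_int k" using k by simp
      finally have "real (card (?B a)) \<le> of_int k" .
      then have "c * card (?B a) \<le> c * of_int k" using c k by simp
      moreover have "v (a + k) \<le> v (n + w)" using k 3 by (intro less.prems) auto
      ultimately show ?thesis using k by linarith
    qed
  qed
qed

text \<open>Unordered summability of the jumps is absolute. Finitely many times \<open>K\<close>
  carry all but \<open>e\<close> of the total jump size in \<open>{0<..2}\<close>, and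
  \<open>V\<close> accumulates the sizes of the remaining jumps; without drift, the path moves
  between points of \<open>K\<close> by these jumps alone. The interval has length 2 so that windows
  starting in one half of it fit.\<close>

lemma zero_drift_control:
  assumes f: "zero_drift f" and "0 < e"
  obtains K V where "finite K" "\<And>s t. \<lbrakk>0 \<le> s; s \<le> t; t \<le> 2\<rbrakk> \<Longrightarrow> V s \<le> V t" "V 2 - V 0 \<le> (e::real)"
    "\<And>s t. \<lbrakk>0 \<le> s; s \<le> t; t \<le> 2; {s..t} \<inter> K = {}\<rbrakk> \<Longrightarrow> \<bar>f t - f s\<bar> \<le> V t - V s"
proof -
  define \<Delta> where "\<Delta> s = f s - left_lim f s" for s
  have sumf: "(\<Delta> has_sum f x) {0<..x}" if "0 \<le> x" for x
    using f that unfolding zero_drift_def \<Delta>_def[abs_def] by blast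
  have "\<Delta> summable_on {0<..2}" using sumf[of 2] by (auto simp: summable_on_def)
  then have abs: "(\<lambda>s. \<bar>\<Delta> s\<bar>) summable_on {0<..2}"
    by (subst (asm) summable_on_iff_abs_summable_on_real) simp
  then have abs': "(\<lambda>s. \<bar>\<Delta> s\<bar>) summable_on A" if "A \<subseteq> {0<..2}" for A
    using summable_on_subset_banach that by blast
  have sum': "\<Delta> summable_on A" if "A \<subseteq> {0<..2}" for A
    using abs'[OF that] by (subst summable_on_iff_abs_summable_on_real) simp
  define S where "S = infsum (\<lambda>s. \<bar>\<Delta> s\<bar>) {0<..2}"
  have "((\<lambda>s. \<bar>\<Delta> s\<bar>) has_sum S) {0<..2}" using abs by (simp add: S_def has_sum_infsum)
  then have "eventually (\<lambda>K. dist (\<Sum>s\<in>K. \<bar>\<Delta> s\<bar>) S < e) (finite_subsets_at_top {0<..2})"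
    unfolding has_sum_def using \<open>0 < e\<close> by (rule tendstoD)
  then obtain K where K: "finite K" "K \<subseteq> {0<..2}" "dist (\<Sum>s\<in>K. \<bar>\<Delta> s\<bar>) S < e"
    unfolding eventually_finite_subsets_at_top by blast
  define V where "V t = infsum (\<lambda>s. \<bar>\<Delta> s\<bar>) ({0<..t} - K)" for t
  have step: "V t - V s = infsum (\<lambda>s. \<bar>\<Delta> s\<bar>) ({s<..t} - K)" if "0 \<le> s" "s \<le> t" "t \<le> 2" for s t
  proof -
    have "{0<..t} - K = ({0<..s} - K) \<union> ({s<..t} - K)" using that by auto
    then have "V t = V s + infsum (\<lambda>s. \<bar>\<Delta> s\<bar>) ({s<..t} - K)"
      unfolding V_def using that by (simp only:) (rule infsum_Un_disjoint; auto intro!: abs')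
    then show ?thesis by simp
  qed
  have 1: "V s \<le> V t" if "0 \<le> s" "s \<le> t" "t \<le> 2" for s t
  proof -
    have "0 \<le> infsum (\<lambda>s. \<bar>\<Delta> s\<bar>) ({s<..t} - K)" by (rule infsum_nonneg) simp
    then show ?thesis using step[OF that] by linarith
  qed
  have "V 2 - V 0 = S - infsum (\<lambda>s. \<bar>\<Delta> s\<bar>) K"
    unfolding step[of 0 2, simplified] S_def
    by (rule infsum_Diff[OF abs abs'[OF K(2)] K(2)])
  then have 2: "V 2 - V 0 \<le> e" using K by (simp add: infsum_finite dist_real_def abs_less_iff)
  have 3: "\<bar>f t - f s\<bar> \<le> V t - V s" if "0 \<le> s" "s \<le> t" "t \<le> 2" "{s..t} \<inter> K = {}" for s t
  proof -
    have f_eq: "f x = infsum \<Delta> {0<..x}" if "0 \<le> x" for x using sumf[OF that] by (simp add: infsumI)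
    have "{0<..t} = {0<..s} \<union> {s<..t}" using that by auto
    then have "f t = f s + infsum \<Delta> {s<..t}"
      using that f_eq[of t] f_eq[of s]
      by (simp only:) (subst infsum_Un_disjoint; auto intro!: sum')
    then have "\<bar>f t - f s\<bar> = norm (infsum \<Delta> {s<..t})" by simp
    also have "\<dots> \<le> infsum (\<lambda>s. norm (\<Delta> s)) {s<..t}"
      by (rule norm_infsum_bound) (use that in \<open>auto intro!: abs'\<close>)
    also have "{s<..t} = {s<..t} - K" using that(4) by (force simp: disjoint_iff)
    also have "infsum (\<lambda>s. norm (\<Delta> s)) ({s<..t} - K) = V t - V s" using step[of s t] that by simp
    finally show ?thesis .
  qed
  show thesis using that[OF K(1) 1 2 3] .
qed

text \<open>Two-sided, unlike \<open>rises\<close>, so that one estimate also yields continuity at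
  fixed times.\<close>

definition oscillates :: "real \<Rightarrow> int \<Rightarrow> (int \<Rightarrow> real) \<Rightarrow> int \<Rightarrow> bool" where
  "oscillates d K x i \<longleftrightarrow> (\<exists>k\<in>{1..K}. \<bar>walk x i (i + k)\<bar> > d * of_int k)"

lemma measurable_oscillates [measurable]: "Measurable.pred seq_space (\<lambda>x. oscillates d K x i)"
  unfolding oscillates_def by measurable

text \<open>Each of the exceptional times in \<open>K\<close> lies in at most \<open>w + 1\<close>
  windows. A steep window avoiding them is steep for \<open>V\<close> as well, and the maximal
  inequality bounds the number of those by the total increase of \<open>V\<close>.\<close>

lemma card_oscillates_le:
  fixes f V :: "real \<Rightarrow> real" and w N :: int
  assumes K: "finite K" and mono: "\<And>s t. \<lbrakk>0 \<le> s; s \<le> t; t \<le> 2\<rbrakk> \<Longrightarrow> V s \<le> V t"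
    and ctrl: "\<And>s t. \<lbrakk>0 \<le> s; s \<le> t; t \<le> 2; {s..t} \<inter> K = {}\<rbrakk> \<Longrightarrow> \<bar>f t - f s\<bar> \<le> V t - V s"
    and \<sigma>: "(\<sigma> = 1 \<and> q = 0) \<or> (\<sigma> = - 1 \<and> q = (2::real))" and \<beta>: "0 < \<beta>" and w: "0 \<le> w" "w \<le> N" "0 < N"
  shows "card {i\<in>{0..<N}. oscillates (\<beta> / of_int N) w (grid f q (\<sigma> / of_int N)) i}
    \<le> real (card K) * (of_int w + 1) + of_int N * (V 2 - V 0) / \<beta>"
proof -
  \<comment> \<open>For \<open>\<sigma> = - 1\<close> the grid runs down from 2; multiplying by
    \<open>\<sigma>\<close> makes both the times and \<open>V\<close> increase along it in either
    case.\<close>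
  define t where "t i = q + of_int i * (\<sigma> / of_int N)" for i
  define v where "v i = \<sigma> * V (t i)" for i
  have N: "0 < real_of_int N" using w by simp
  have tI: "0 \<le> t i \<and> t i \<le> 2" if "0 \<le> i" "i \<le> N + w" for i
  proof -
    have "real_of_int i / of_int N \<le> of_int (2 * N) / of_int N"
      using that w N by (intro divide_right_mono) linarith+
    then have "real_of_int i / of_int N \<le> 2" using N by simp
    moreover have "0 \<le> real_of_int i / of_int N" using that N by simp
    ultimately show ?thesis using \<sigma> by (auto simp: t_def)
  qed
  have tmono: "\<sigma> * t i \<le> \<sigma> * t j" if "i \<le> j" for i j
    using \<sigma> that N by (auto simp: t_def divide_right_mono)
  have vmono: "v i \<le> v j" if "0 \<le> i" "i \<le> j" "j \<le> N + w" for i j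
    using mono[of "t i" "t j"] mono[of "t j" "t i"] \<sigma> tI[of i] tI[of j] tmono[of i j] that
    by (auto simp: v_def)
  let ?osc = "\<lambda>i. oscillates (\<beta> / of_int N) w (grid f q (\<sigma> / of_int N)) i"
  \<comment> \<open>The starting indices whose window of full length \<open>w\<close> contains the
    time \<open>p\<close>.\<close>
  let ?A = "\<lambda>p. {i. of_int i \<le> \<sigma> * (p - q) * of_int N \<and> \<sigma> * (p - q) * of_int N \<le> of_int (i + w)}"
  let ?B = "{i\<in>{0..<N}. \<exists>k\<in>{1..w}. v (i + k) - v i > \<beta> / of_int N * of_int k}"
  have finB: "finite ?B" by (rule finite_subset[of _ "{0..<N}"]) auto
  have A_sub: "?A p \<subseteq> {\<lfloor>\<sigma> * (p - q) * of_int N\<rfloor> - w..\<lfloor>\<sigma> * (p - q) * of_int N\<rfloor>}" for p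
    by (auto simp: le_floor_iff) linarith
  then have finA: "finite (?A p)" for p by (rule finite_subset) simp
  have cardA: "card (?A p) \<le> nat (w + 1)" for p
    using card_mono[OF _ A_sub] by simp
  have "{i\<in>{0..<N}. ?osc i} \<subseteq> (\<Union>p\<in>K. ?A p) \<union> ?B"
  proof
    fix i assume "i \<in> {i\<in>{0..<N}. ?osc i}"
    then obtain k where i: "0 \<le> i" "i < N" and k: "k \<in> {1..w}"
      and osc: "\<bar>f (t (i + k)) - f (t i)\<bar> > \<beta> / of_int N * of_int k"
      by (auto simp: oscillates_def walk_grid t_def)
    have ts: "0 \<le> t i" "t i \<le> 2" "0 \<le> t (i + k)" "t (i + k) \<le> 2" "\<sigma> * t i \<le> \<sigma> * t (i + k)"
      using tI[of i] tI[of "i + k"] tmono[of i "i + k"] i k by auto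
    show "i \<in> (\<Union>p\<in>K. ?A p) \<union> ?B"
    proof (cases "\<exists>p\<in>K. \<sigma> * t i \<le> \<sigma> * p \<and> \<sigma> * p \<le> \<sigma> * t (i + k)")
      case True
      then obtain p where p: "p \<in> K" "\<sigma> * t i \<le> \<sigma> * p" "\<sigma> * p \<le> \<sigma> * t (i + k)" by blast
      have s2: "\<sigma> * (of_int j * (\<sigma> / of_int N)) = of_int j / of_int N" for j using \<sigma> by auto
      have "of_int i / of_int N \<le> \<sigma> * (p - q)" "\<sigma> * (p - q) \<le> of_int (i + k) / of_int N"
        using p(2,3) s2[of i] s2[of "i + k"] unfolding t_def distrib_left right_diff_distrib by linarith+
      then have "of_int i \<le> \<sigma> * (p - q) * of_int N" "\<sigma> * (p - q) * of_int N \<le> of_int (i + k)"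
        using N by (simp_all add: pos_divide_le_eq pos_le_divide_eq)
      then have "i \<in> ?A p" using k by auto
      then show ?thesis using p(1) by blast
    next
      case False
      then have "\<bar>f (t (i + k)) - f (t i)\<bar> \<le> v (i + k) - v i"
        using ctrl[of "t i" "t (i + k)"] ctrl[of "t (i + k)" "t i"] ts \<sigma>
        by (fastforce simp: v_def disjoint_iff abs_minus_commute)
      then have "v (i + k) - v i > \<beta> / of_int N * of_int k" using osc by linarith
      then show ?thesis using i k by auto
    qed
  qed
  then have "card {i\<in>{0..<N}. ?osc i} \<le> card ((\<Union>p\<in>K. ?A p) \<union> ?B)"
    using finA K finB by (intro card_mono finite_UnI finite_UN_I)
  also have "\<dots> \<le> card (\<Union>p\<in>K. ?A p) + card ?B" by (rule card_Un_le)
  also have "card (\<Union>p\<in>K. ?A p) \<le> (\<Sum>p\<in>K. card (?A p))" by (rule card_UN_le[OF K])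
  also have "\<dots> \<le> (\<Sum>p\<in>K. nat (w + 1))" by (intro sum_mono cardA)
  finally have "card {i\<in>{0..<N}. ?osc i} \<le> card K * nat (w + 1) + card ?B" by simp
  then have "real (card {i\<in>{0..<N}. ?osc i}) \<le> real (card K * nat (w + 1) + card ?B)"
    by (rule of_nat_mono)
  also have "\<dots> = real (card K) * (of_int w + 1) + card ?B" using w by (simp add: of_nat_nat)
  finally have "real (card {i\<in>{0..<N}. ?osc i}) \<le> real (card K) * (of_int w + 1) + card ?B" .
  moreover have "\<beta> / of_int N * card ?B \<le> v (N + w) - v 0"
    using \<beta> N w by (intro card_steep_le vmono) auto
  moreover have "v (N + w) - v 0 \<le> V 2 - V 0"
    using \<sigma> tI[of "N + w"] tI[of 0] mono[of "t (N + w)" 2] mono[of 0 "t (N + w)"] w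
    by (auto simp: v_def t_def)
  ultimately have *: "real (card {i\<in>{0..<N}. ?osc i}) \<le> real (card K) * (of_int w + 1) + card ?B"
    and "\<beta> / of_int N * card ?B \<le> V 2 - V 0" by linarith+
  from this(2) have "card ?B \<le> of_int N * (V 2 - V 0) / \<beta>" using \<beta> N by (simp add: field_simps)
  with * show ?thesis by linarith
qed

text \<open>By stationarity the probability is the expectation of the fraction of grid points with a steep
  window, and this fraction is small for every path of zero drift.\<close>

lemma prob_oscillates_small:
  fixes M :: "'a measure" and X :: "real \<Rightarrow> 'a \<Rightarrow> real"
  assumes levy: "two_sided_levy M X" and drift: "AE \<omega> in M. zero_drift (\<lambda>t. X t \<omega>)"
    and "0 < \<beta>" "0 < \<epsilon>" and \<sigma>: "\<sigma> \<in> {1, - 1}"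
  shows "\<exists>J. \<forall>m\<ge>J. \<forall>q. measure M {\<omega>\<in>space M.
    oscillates (\<beta> / 2 ^ m) (2 ^ (m - J)) (\<lambda>j. grid (\<lambda>t. X t \<omega>) q (\<sigma> / 2 ^ m) j) 0} \<le> \<epsilon>"
proof (rule ccontr)
  interpret prob_space M using levy by (simp add: two_sided_levy_def)
  let ?osc = "\<lambda>m J q i \<omega>. oscillates (\<beta> / 2 ^ m) (2 ^ (m - J)) (\<lambda>j. grid (\<lambda>t. X t \<omega>) q (\<sigma> / 2 ^ m) j) i"
  let ?E = "\<lambda>m J q i. {\<omega>\<in>space M. ?osc m J q i \<omega>}"
  assume "\<not> ?thesis"
  \<comment> \<open>A failure for every \<open>J\<close> comes with its own level \<open>m J\<close>
    and base point \<open>q J\<close>. Stationarity removes the base point, and dominated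
    convergence along \<open>J\<close> alone gives the contradiction.\<close>
  then have "\<forall>J. \<exists>m q. J \<le> m \<and> prob (?E m J q 0) > \<epsilon>" by (auto simp: not_le)
  then obtain m q where "\<forall>J. J \<le> m J \<and> prob (?E (m J) J (q J) 0) > \<epsilon>"
    by (elim choice[elim_format] exE)
  then have m: "\<And>J. J \<le> m J" and q: "\<And>J. prob (?E (m J) J (q J) 0) > \<epsilon>" by simp_all
  \<comment> \<open>Starting from 2 when reading backwards keeps all windows inside
    \<open>{0..2}\<close>.\<close>
  define q0 where "q0 = (if \<sigma> = 1 then 0 else 2::real)"
  have iid: "iid_family M (\<lambda>j \<omega>. grid (\<lambda>t. X t \<omega>) q (\<sigma> / 2 ^ m) j) (distr M borel (X (\<sigma> / 2 ^ m)))"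
    for q and m :: nat
    by (rule iid_family_grid[OF levy]) (use \<sigma> in auto)
  have meas [measurable]: "?E m J q i \<in> events" for m J q i
    using iid_family_measurable_pred[OF iid, of "\<lambda>x. oscillates (\<beta> / 2 ^ m) (2 ^ (m - J)) x i"]
    by (simp add: pred_def)
  have prob_eq: "prob (?E m J q0 i) = prob (?E m J q 0)" for m J q i
  proof -
    have "oscillates d K (\<lambda>j. x (j + i)) 0 = oscillates d K x i" for d K x
      unfolding oscillates_def walk_shift by (simp add: ac_simps)
    from this[of _ _ "\<lambda>j. grid (\<lambda>t. X t _) q0 (\<sigma> / 2 ^ m) j"]
    have "?E m J q0 i = {\<omega>\<in>space M. oscillates (\<beta> / 2 ^ m) (2 ^ (m - J))
        (\<lambda>j. grid (\<lambda>t. X t \<omega>) q0 (\<sigma> / 2 ^ m) (j + i)) 0}" by blast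
    also have "prob \<dots> = prob (?E m J q 0)"
      by (rule iid_family_prob_cong[OF iid_family_shift[OF iid] iid]) measurable
    finally show ?thesis .
  qed
  define Q :: "nat \<Rightarrow> 'a \<Rightarrow> real" where "Q J \<omega> = (\<Sum>i\<in>{0..<2 ^ m J}. indicator (?E (m J) J q0 i) \<omega>) / 2 ^ m J" for J \<omega>
  have Q_int: "integral\<^sup>L M (Q J) = prob (?E (m J) J (q J) 0)" for J
  proof -
    have "integral\<^sup>L M (Q J) = (\<Sum>i\<in>{0..<2 ^ m J}. prob (?E (m J) J q0 i)) / 2 ^ m J"
      unfolding Q_def by (simp add: emeasure_eq_measure)
    also have "\<dots> = prob (?E (m J) J (q J) 0)"
      by (simp add: prob_eq[of _ _ _ "q J"])
    finally show ?thesis .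
  qed
  have Q_card: "Q J \<omega> = card {i\<in>{0..<2 ^ m J}. ?osc (m J) J q0 i \<omega>} / 2 ^ m J" if "\<omega> \<in> space M" for J \<omega>
  proof -
    have "(\<Sum>i\<in>{0..<2 ^ m J}. indicator (?E (m J) J q0 i) \<omega>) =
        (\<Sum>i\<in>{0..<2 ^ m J}. if ?osc (m J) J q0 i \<omega> then 1 else (0::real))"
      using that by (intro sum.cong) (auto simp: indicator_def)
    also have "\<dots> = (\<Sum>i\<in>{i\<in>{0..<2 ^ m J}. ?osc (m J) J q0 i \<omega>}. 1)"
      by (rule sum.inter_filter[symmetric]) simp
    finally show ?thesis unfolding Q_def by simp
  qed
  have "(\<lambda>J. integral\<^sup>L M (Q J)) \<longlonglongrightarrow> integral\<^sup>L M (\<lambda>_. 0)"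
  proof (rule integral_dominated_convergence[where w="\<lambda>_. 1"])
    show "Q J \<in> borel_measurable M" for J unfolding Q_def by measurable
    show "AE \<omega> in M. norm (Q J \<omega>) \<le> 1" for J
    proof (rule AE_I2)
      fix \<omega> assume \<omega>: "\<omega> \<in> space M"
      have "card {i\<in>{0..<2 ^ m J}. ?osc (m J) J q0 i \<omega>} \<le> card {0..<(2::int) ^ m J}"
        by (rule card_mono) auto
      then have "real (card {i\<in>{0..<2 ^ m J}. ?osc (m J) J q0 i \<omega>}) \<le> real (card {0..<(2::int) ^ m J})"
        by (rule of_nat_mono)
      also have "\<dots> = 2 ^ m J" by simp
      finally show "norm (Q J \<omega>) \<le> 1" unfolding Q_card[OF \<omega>] by simp
    qed
    show "AE \<omega> in M. (\<lambda>J. Q J \<omega>) \<longlonglongrightarrow> 0"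
      using drift AE_space
    proof eventually_elim
      case (elim \<omega>)
      show ?case
      proof (rule LIMSEQ_I)
        fix e :: real assume e: "0 < e"
        \<comment> \<open>With this tolerance the windows that are steep for \<open>V\<close> take
          up a fraction of at most \<open>e / 2\<close>; the fraction of windows meeting
          \<open>K\<close> vanishes as \<open>J\<close> grows.\<close>
        obtain K V where KV: "finite K" "\<And>s t. \<lbrakk>0 \<le> s; s \<le> t; t \<le> 2\<rbrakk> \<Longrightarrow> V s \<le> V t" "V 2 - V 0 \<le> e * \<beta> / 2"
          "\<And>s t. \<lbrakk>0 \<le> s; s \<le> t; t \<le> 2; {s..t} \<inter> K = {}\<rbrakk> \<Longrightarrow> \<bar>X t \<omega> - X s \<omega>\<bar> \<le> V t - V s"
          using zero_drift_control[OF elim(1), of "e * \<beta> / 2"] e \<open>0 < \<beta>\<close> by auto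
        have bound: "Q J \<omega> \<le> real (card K) * (2 * (1 / 2) ^ J) + e / 2" for J
        proof -
          have *: "(\<sigma> = 1 \<and> q0 = 0) \<or> (\<sigma> = - 1 \<and> q0 = 2)" using \<sigma> by (auto simp: q0_def)
          have p: "(2::real) ^ m J = 2 ^ J * 2 ^ (m J - J)" using m[of J] by (simp flip: power_add)
          have "real (card {i\<in>{0..<2 ^ m J}. oscillates (\<beta> / of_int (2 ^ m J)) (2 ^ (m J - J))
              (grid (\<lambda>t. X t \<omega>) q0 (\<sigma> / of_int (2 ^ m J))) i})
              \<le> real (card K) * (of_int (2 ^ (m J - J)) + 1) + of_int (2 ^ m J) * (V 2 - V 0) / \<beta>"
          proof (rule card_oscillates_le[where V=V])
            show "\<bar>X t \<omega> - X s \<omega>\<bar> \<le> V t - V s" if "0 \<le> s" "s \<le> t" "t \<le> 2" "{s..t} \<inter> K = {}" for s t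
              using that by (rule KV(4))
            show "(2::int) ^ (m J - J) \<le> 2 ^ m J" by (rule power_increasing) auto
          qed (use KV(1,2) * \<open>0 < \<beta>\<close> in auto)
          then have "Q J \<omega> \<le> (real (card K) * (2 ^ (m J - J) + 1) + 2 ^ m J * (V 2 - V 0) / \<beta>) / 2 ^ m J"
            unfolding Q_card[OF elim(2)] by (intro divide_right_mono) (simp_all only: of_int_power of_int_numeral zero_le_power zero_le_numeral)
          also have "\<dots> = real (card K) * ((2 ^ (m J - J) + 1) / 2 ^ m J) + (V 2 - V 0) / \<beta>"
            using \<open>0 < \<beta>\<close> by (simp add: field_simps)
          also have "\<dots> \<le> real (card K) * (2 * (1 / 2) ^ J) + e / 2"
          proof (intro add_mono mult_left_mono)
            have "(2 ^ (m J - J) + 1) / 2 ^ m J \<le> 2 * 2 ^ (m J - J) / (2 ^ m J :: real)"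
              by (intro divide_right_mono) auto
            also have "\<dots> = 2 * (1 / 2) ^ J" unfolding p by (simp add: power_divide)
            finally show "(2 ^ (m J - J) + 1) / 2 ^ m J \<le> (2 * (1 / 2) ^ J :: real)" .
            show "(V 2 - V 0) / \<beta> \<le> e / 2" using KV(3) \<open>0 < \<beta>\<close> by (simp add: field_simps)
          qed simp
          finally show ?thesis .
        qed
        have "(\<lambda>J. real (card K) * (2 * (1 / 2) ^ J) + e / 2) \<longlonglongrightarrow> real (card K) * (2 * 0) + e / 2"
          by (intro tendsto_intros LIMSEQ_power_zero[of "1 / 2 :: real"]) simp
        then have "eventually (\<lambda>J. real (card K) * (2 * (1 / 2) ^ J) + e / 2 < e) sequentially"
          by (rule order_tendstoD) (use e in simp)
        then obtain J0 where "\<And>J. J0 \<le> J \<Longrightarrow> real (card K) * (2 * (1 / 2) ^ J) + e / 2 < e"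
          by (auto simp: eventually_sequentially)
        then have "Q J \<omega> < e" if "J0 \<le> J" for J using bound[of J] that by fastforce
        moreover have "0 \<le> Q J \<omega>" for J by (simp add: Q_card[OF elim(2)])
        ultimately have "\<forall>J\<ge>J0. norm (Q J \<omega> - 0) < e" by simp
        then show "\<exists>J0. \<forall>J\<ge>J0. norm (Q J \<omega> - 0) < e" by blast
      qed
    qed
  qed auto
  then have "(\<lambda>J. integral\<^sup>L M (Q J)) \<longlonglongrightarrow> 0" by simp
  then have "eventually (\<lambda>J. integral\<^sup>L M (Q J) < \<epsilon>) sequentially"
    by (rule order_tendstoD) (rule \<open>0 < \<epsilon>\<close>)
  then obtain J where "integral\<^sup>L M (Q J) < \<epsilon>" by (auto simp: eventually_sequentially)
  then show False using q[of J] unfolding Q_int by linarith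
qed

section \<open>Dyadic points, and from single levels to almost sure statements\<close>

lemma ex_dyadic:
  fixes a b :: real
  assumes "a < b"
  obtains r :: nat and u :: int where "a < of_int u / 2 ^ r" "of_int u / 2 ^ r < b"
proof -
  obtain r where r: "(1 / 2) ^ r < b - a"
    using assms real_arch_pow_inv[of "b - a" "1 / 2"] by auto
  then have "1 < (b - a) * 2 ^ r" by (simp add: power_divide field_simps)
  then have "a * 2 ^ r < of_int (\<lfloor>a * 2 ^ r\<rfloor> + 1)" "of_int (\<lfloor>a * 2 ^ r\<rfloor> + 1) < b * 2 ^ r"
    by (simp_all add: left_diff_distrib) linarith+
  then show thesis by (intro that[of "\<lfloor>a * 2 ^ r\<rfloor> + 1" r]) (simp_all add: field_simps)
qed

text \<open>Fatou's inequality for events: a tail intersection lies inside each of its events, so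
  its probability is at most \<open>\<epsilon>\<close>, and these intersections increase to the
  event of eventual occurrence. No summability over \<open>m\<close> is needed, in contrast to a
  Borel-Cantelli argument.\<close>

lemma (in prob_space) AE_not_eventually:
  fixes E :: "nat \<Rightarrow> nat \<Rightarrow> 'a \<Rightarrow> bool"
  assumes [measurable]: "\<And>J m. Measurable.pred M (E J m)"
    and small: "\<And>\<epsilon>. 0 < \<epsilon> \<Longrightarrow> \<exists>J m0. \<forall>m\<ge>m0. prob {\<omega>\<in>space M. E J m \<omega>} \<le> \<epsilon>"
  shows "AE \<omega> in M. \<exists>J. \<not> (\<forall>\<^sub>F m in sequentially. E J m \<omega>)"
proof -
  let ?B = "{\<omega>\<in>space M. \<forall>J. \<forall>\<^sub>F m in sequentially. E J m \<omega>}"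
  have [measurable]: "?B \<in> events" unfolding eventually_sequentially by measurable
  have "prob ?B \<le> \<epsilon>" if "0 < \<epsilon>" for \<epsilon>
  proof -
    from small[OF that] obtain J m0 where J: "\<And>m. m0 \<le> m \<Longrightarrow> prob {\<omega>\<in>space M. E J m \<omega>} \<le> \<epsilon>"
      by blast
    let ?A = "\<lambda>n. {\<omega>\<in>space M. \<forall>m\<ge>n. E J m \<omega>}"
    have "prob (?A n) \<le> \<epsilon>" for n
    proof -
      have "prob (?A n) \<le> prob {\<omega>\<in>space M. E J (max n m0) \<omega>}"
        by (intro finite_measure_mono) auto
      also have "\<dots> \<le> \<epsilon>" by (rule J) simp
      finally show ?thesis .
    qed
    moreover have "(\<lambda>n. prob (?A n)) \<longlonglongrightarrow> prob (\<Union>n. ?A n)"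
      by (rule finite_Lim_measure_incseq) (auto simp: incseq_def)
    ultimately have "prob (\<Union>n. ?A n) \<le> \<epsilon>" by (intro LIMSEQ_le_const2) auto
    moreover have "prob ?B \<le> prob (\<Union>n. ?A n)"
      by (rule finite_measure_mono) (auto simp: eventually_sequentially)
    ultimately show ?thesis by linarith
  qed
  then have "prob ?B = 0" by (meson dense_ge measure_nonneg order_antisym)
  then have "AE \<omega> in M. \<omega> \<notin> ?B" by (simp add: prob_eq_0)
  then show ?thesis by (rule AE_mp) (auto intro!: AE_I2)
qed

lemma prob_not_rises_ge:
  assumes "iid_family M \<xi> \<nu>"
    and "measure M {\<omega>\<in>space M. oscillates d K (\<lambda>j. \<xi> j \<omega>) 0} \<le> p"
  shows "measure M {\<omega>\<in>space M. \<not> rises d K (\<lambda>j. \<xi> j \<omega>) 0} \<ge> 1 - p"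
    and "measure M {\<omega>\<in>space M. rises d K (\<lambda>j. \<xi> j \<omega>) 0} \<le> p"
proof -
  interpret prob_space M using assms(1) by (rule iid_familyD)
  have [measurable]: "{\<omega>\<in>space M. oscillates d K (\<lambda>j. \<xi> j \<omega>) 0} \<in> events"
    "{\<omega>\<in>space M. rises d K (\<lambda>j. \<xi> j \<omega>) 0} \<in> events"
    using iid_family_measurable_pred[OF assms(1), of "\<lambda>x. oscillates d K x 0"]
      iid_family_measurable_pred[OF assms(1), of "\<lambda>x. rises d K x 0"]
    by (simp_all add: pred_def)
  have "prob {\<omega>\<in>space M. rises d K (\<lambda>j. \<xi> j \<omega>) 0}
      \<le> prob {\<omega>\<in>space M. oscillates d K (\<lambda>j. \<xi> j \<omega>) 0}"
  proof (rule finite_measure_mono)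
    show "{\<omega>\<in>space M. rises d K (\<lambda>j. \<xi> j \<omega>) 0} \<subseteq> {\<omega>\<in>space M. oscillates d K (\<lambda>j. \<xi> j \<omega>) 0}"
      by (auto simp: rises_def oscillates_def intro: order_less_le_trans[OF _ abs_ge_self])
  qed measurable
  then show *: "prob {\<omega>\<in>space M. rises d K (\<lambda>j. \<xi> j \<omega>) 0} \<le> p" using assms(2) by linarith
  have "prob {\<omega>\<in>space M. \<not> rises d K (\<lambda>j. \<xi> j \<omega>) 0} = 1 - prob {\<omega>\<in>space M. rises d K (\<lambda>j. \<xi> j \<omega>) 0}"
    by (rule prob_neg) measurable
  then show "prob {\<omega>\<in>space M. \<not> rises d K (\<lambda>j. \<xi> j \<omega>) 0} \<ge> 1 - p" using * by linarith
qed

text \<open>The union bounds only control a single level \<open>m\<close> at a time, hence the passage to infinitely many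
  levels by negated eventuality.\<close>

definition tame_at :: "(real \<Rightarrow> real) \<Rightarrow> real \<Rightarrow> nat \<Rightarrow> real \<Rightarrow> real \<Rightarrow> bool" where
  "tame_at f \<sigma> J0 \<beta> q \<longleftrightarrow> (\<exists>J. \<not> (\<forall>\<^sub>F m in sequentially. \<exists>i\<in>{0..2 ^ (m - J0)}.
     ladder (\<beta> / 2 ^ m) (grid f q (\<sigma> / 2 ^ m)) i \<and>
     rises (\<beta> / 2 ^ m) (2 ^ (m - J)) (grid f q (\<sigma> / 2 ^ m)) i))"

text \<open>The allowance is the full square of the lag although maximality will yield half of it:
  the rest absorbs rounding. The lags have length \<open>u / 2 ^ r\<close> at every level
  \<open>m \<ge> r\<close>. The cost is half the squared distance between record and crossing, and
  \<open>L\<close> bounds the distance from \<open>q\<close> to the crossing, which keeps the union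
  bound finite.\<close>

definition no_touch_at :: "(real \<Rightarrow> real) \<Rightarrow> nat \<Rightarrow> real \<Rightarrow> int \<Rightarrow> real \<Rightarrow> bool" where
  "no_touch_at f J0 \<beta> L q \<longleftrightarrow> (\<exists>r. \<not> (\<forall>\<^sub>F m in sequentially. \<exists>i\<in>{0..2 ^ (m - J0)}. \<exists>k\<in>{0..L * 2 ^ m}.
     ladder (\<beta> / 2 ^ m) (grid f q (1 / 2 ^ m)) i \<and>
     first_crossing (\<lambda>i k. (of_int (i + k) / 2 ^ m)\<^sup>2 / 2) (grid f q (1 / 2 ^ m)) i k \<and>
     stays_below (\<lambda>u. (of_int u / 2 ^ m)\<^sup>2) ((\<lambda>u. u * 2 ^ (m - r)) ` {1..2 ^ r}) (grid f q (1 / 2 ^ m)) k))"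

locale zero_drift_levy =
  fixes M :: "'a measure" and X :: "real \<Rightarrow> 'a \<Rightarrow> real"
  assumes levy: "two_sided_levy M X" and drift: "AE \<omega> in M. zero_drift (\<lambda>t. X t \<omega>)"
begin

sublocale prob_space M using levy by (simp add: two_sided_levy_def)

lemma iid_grid:
  "\<sigma> \<in> {1, - 1} \<Longrightarrow> iid_family M (\<lambda>j \<omega>. grid (\<lambda>t. X t \<omega>) q (\<sigma> / 2 ^ m) j) (distr M borel (X (\<sigma> / 2 ^ m)))"
  by (rule iid_family_grid[OF levy]) auto

text \<open>Zero drift makes rising within \<open>2 ^ (m - J)\<close> steps have probability at most
  \<open>\<epsilon> / 2\<close> once \<open>J\<close> is large, and the union over all records at
  most doubles this. The bound 1/2 behind the doubling is kept as a conclusion, since the argument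
  about first crossings counts records in the same way.\<close>

lemma AE_grid_tame:
  assumes "0 < \<beta>" and \<sigma>: "\<sigma> \<in> {1, - 1}"
  shows "\<exists>J0. (\<forall>m\<ge>J0. \<forall>q. prob {\<omega>\<in>space M. \<not> rises (\<beta> / 2 ^ m) (2 ^ (m - J0))
      (\<lambda>j. grid (\<lambda>t. X t \<omega>) q (\<sigma> / 2 ^ m) j) 0} \<ge> 1 / 2) \<and>
    (\<forall>q. AE \<omega> in M. tame_at (\<lambda>t. X t \<omega>) \<sigma> J0 \<beta> q)"
proof -
  let ?g = "\<lambda>q m \<omega> j. grid (\<lambda>t. X t \<omega>) q (\<sigma> / 2 ^ m) j"
  note osc = prob_oscillates_small[OF levy drift \<open>0 < \<beta>\<close> _ \<sigma>]
  obtain J0 where "\<forall>m\<ge>J0. \<forall>q. prob {\<omega>\<in>space M. oscillates (\<beta> / 2 ^ m) (2 ^ (m - J0)) (?g q m \<omega>) 0} \<le> 1 / 2"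
    using osc[of "1 / 2"] by auto
  then have J0: "prob {\<omega>\<in>space M. \<not> rises (\<beta> / 2 ^ m) (2 ^ (m - J0)) (?g q m \<omega>) 0} \<ge> 1 / 2"
    if "J0 \<le> m" for q m
    using prob_not_rises_ge(1)[OF iid_grid[OF \<sigma>], of "\<beta> / 2 ^ m" "2 ^ (m - J0)" q m "1 / 2"] that by auto
  have "AE \<omega> in M. \<exists>J. \<not> (\<forall>\<^sub>F m in sequentially. \<exists>i\<in>{0..2 ^ (m - J0)}.
     ladder (\<beta> / 2 ^ m) (?g q m \<omega>) i \<and> rises (\<beta> / 2 ^ m) (2 ^ (m - J)) (?g q m \<omega>) i)" for q
  proof (rule AE_not_eventually)
    show "Measurable.pred M (\<lambda>\<omega>. \<exists>i\<in>{0..2 ^ (m - J0)}.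
        ladder (\<beta> / 2 ^ m) (?g q m \<omega>) i \<and> rises (\<beta> / 2 ^ m) (2 ^ (m - J)) (?g q m \<omega>) i)" for J m
      by (rule iid_family_measurable_pred[OF iid_grid[OF \<sigma>]]) measurable
    fix \<epsilon> :: real assume "0 < \<epsilon>"
    then obtain J where "\<forall>m\<ge>J. \<forall>q. prob {\<omega>\<in>space M. oscillates (\<beta> / 2 ^ m) (2 ^ (m - J)) (?g q m \<omega>) 0} \<le> \<epsilon> / 2"
      using osc[of "\<epsilon> / 2"] by auto
    then have J: "prob {\<omega>\<in>space M. rises (\<beta> / 2 ^ m) (2 ^ (m - J)) (?g q m \<omega>) 0} \<le> \<epsilon> / 2"
      if "J \<le> m" for q m
      using prob_not_rises_ge(2)[OF iid_grid[OF \<sigma>], of "\<beta> / 2 ^ m" "2 ^ (m - J)" q m "\<epsilon> / 2"] that by auto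
    have "prob {\<omega>\<in>space M. \<exists>i\<in>{0..2 ^ (m - J0)}. ladder (\<beta> / 2 ^ m) (?g q m \<omega>) i \<and>
        rises (\<beta> / 2 ^ m) (2 ^ (m - J)) (?g q m \<omega>) i} \<le> \<epsilon>" (is "?p \<le> \<epsilon>") if "max J0 J \<le> m" for m
    proof -
      have "?p * (1 / 2) \<le> ?p * prob {\<omega>\<in>space M. \<not> rises (\<beta> / 2 ^ m) (2 ^ (m - J0)) (?g q m \<omega>) 0}"
        using J0[of m q] that by (intro mult_left_mono) auto
      also have "\<dots> \<le> prob {\<omega>\<in>space M. rises (\<beta> / 2 ^ m) (2 ^ (m - J)) (?g q m \<omega>) 0}"
        by (rule prob_ladder_rises_le[OF iid_grid[OF \<sigma>]]) simp
      also have "\<dots> \<le> \<epsilon> / 2" using J that by simp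
      finally show ?thesis by simp
    qed
    then show "\<exists>J m0. \<forall>m\<ge>m0. prob {\<omega>\<in>space M. \<exists>i\<in>{0..2 ^ (m - J0)}. ladder (\<beta> / 2 ^ m) (?g q m \<omega>) i \<and>
        rises (\<beta> / 2 ^ m) (2 ^ (m - J)) (?g q m \<omega>) i} \<le> \<epsilon>" by blast
  qed
  then show ?thesis unfolding tame_at_def using J0 by blast
qed

text \<open>The lower half of Hypothesis B gives a time in \<open>(0, 1)\<close> with a value below
  minus its square, and right continuity moves it to a dyadic time. Refining the grid only adds
  conditions, so continuity from above finishes.\<close>

lemma prob_stays_above_parabola:
  assumes "hypB M X"
  shows "(\<lambda>r. prob {\<omega>\<in>space M. \<forall>u\<in>{1..(2::int) ^ r}. X (of_int u / 2 ^ r) \<omega> - X 0 \<omega> \<ge> - (of_int u / 2 ^ r)\<^sup>2})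
    \<longlonglongrightarrow> 0"
proof -
  have [measurable]: "X t \<in> borel_measurable M" for t using levy by (simp add: two_sided_levy_def)
  let ?P = "\<lambda>r \<omega>. \<forall>u\<in>{1..(2::int) ^ r}. X (of_int u / 2 ^ r) \<omega> - X 0 \<omega> \<ge> - (of_int u / 2 ^ r)\<^sup>2"
  let ?A = "\<lambda>r. {\<omega>\<in>space M. ?P r \<omega>}"
  have mono: "?P r \<omega>" if "?P r' \<omega>" "r \<le> r'" for r r' \<omega>
  proof
    fix u :: int assume u: "u \<in> {1..2 ^ r}"
    have p: "(2::'b::semiring_1) ^ r' = 2 ^ r * 2 ^ (r' - r)" using that(2) by (simp flip: power_add)
    have "1 \<le> u * 2 ^ (r' - r)" using u by (simp add: int_one_le_iff_zero_less)
    moreover have "u * 2 ^ (r' - r) \<le> 2 ^ r'" unfolding p using u by simp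
    ultimately have "u * 2 ^ (r' - r) \<in> {1..2 ^ r'}" by simp
    from bspec[OF that(1) this]
    show "X (of_int u / 2 ^ r) \<omega> - X 0 \<omega> \<ge> - (of_int u / 2 ^ r)\<^sup>2" unfolding p by simp
  qed
  have "AE \<omega> in M. \<exists>r. \<not> ?P r \<omega>"
  proof -
    have "AE \<omega> in M. X 0 \<omega> = 0" "AE \<omega> in M. cadlag (\<lambda>t. X t \<omega>)" using levy by (auto simp: two_sided_levy_def)
    then show ?thesis using assms[unfolded hypB_def]
    proof eventually_elim
      case (elim \<omega>)
      have "\<exists>h. 0 < h \<and> h < 1 \<and> X h \<omega> / h\<^sup>2 < - 2"
      proof (rule ccontr)
        assume *: "\<not> ?thesis"
        have "eventually (\<lambda>h. h \<in> {0<..<1::real}) (at_right 0)" by (rule eventually_at_right_real) simp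
        then have "eventually (\<lambda>h. ereal (- 2) \<le> ereal (X h \<omega> / h\<^sup>2)) (at_right 0)"
          by eventually_elim (use * in \<open>force simp: not_less\<close>)
        then have "ereal (- 2) \<le> Liminf (at_right 0) (\<lambda>h. ereal (X h \<omega> / h\<^sup>2))"
          by (rule Liminf_bounded)
        then show False using elim(3) by simp
      qed
      then obtain h where h: "0 < h" "h < 1" "X h \<omega> / h\<^sup>2 < - 2" by blast
      then have "X h \<omega> < - (2 * h\<^sup>2)" by (simp add: field_simps)
      moreover have "0 < h\<^sup>2" using h by simp
      ultimately have "X h \<omega> + h\<^sup>2 < 0" by linarith
      moreover have "((\<lambda>t. X t \<omega> + t\<^sup>2) \<longlongrightarrow> X h \<omega> + h\<^sup>2) (at_right h)"
        using elim(2) by (intro tendsto_intros) (auto simp: cadlag_def)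
      ultimately have "eventually (\<lambda>t. X t \<omega> + t\<^sup>2 < 0) (at_right h)" by (intro order_tendstoD(2))
      then obtain b where b: "h < b" "\<And>t. \<lbrakk>h < t; t < b\<rbrakk> \<Longrightarrow> X t \<omega> + t\<^sup>2 < 0"
        by (auto simp: eventually_at_right_field)
      obtain r u where u: "h < of_int u / 2 ^ r" "of_int u / 2 ^ r < min b 1"
        by (rule ex_dyadic[of h "min b 1"]) (use b(1) h in auto)
      have "0 < real_of_int u / 2 ^ r" using u h by linarith
      then have "0 < u" by (simp add: zero_less_divide_iff)
      moreover have "real_of_int u < of_int (2 ^ r)" using u by simp
      then have "u < 2 ^ r" by (simp only: of_int_less_iff)
      ultimately have "u \<in> {1..2 ^ r}" by simp
      moreover have "X (of_int u / 2 ^ r) \<omega> + (of_int u / 2 ^ r)\<^sup>2 < 0" using b(2) u by simp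
      ultimately show ?case using elim(1) by (force simp: not_le)
    qed
  qed
  then have "AE \<omega> in M. \<omega> \<notin> (\<Inter>r. ?A r)" by eventually_elim auto
  then have "prob (\<Inter>r. ?A r) = 0" by (subst prob_eq_0) auto
  moreover have "(\<lambda>r. prob (?A r)) \<longlonglongrightarrow> prob (\<Inter>r. ?A r)"
    by (rule finite_Lim_measure_decseq) (use mono in \<open>auto simp: decseq_def\<close>)
  ultimately show ?thesis by simp
qed

text \<open>The event beyond the first crossing becomes rare by Hypothesis B as \<open>r\<close>
  grows; zero drift enters through the count of records, in the form of \<open>c\<close>.\<close>

lemma AE_no_touch:
  assumes hypB: "hypB M X"
    and c: "\<And>m q. J0 \<le> m \<Longrightarrow> prob {\<omega>\<in>space M. \<not> rises (\<beta> / 2 ^ m) (2 ^ (m - J0))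
      (\<lambda>j. grid (\<lambda>t. X t \<omega>) q (1 / 2 ^ m) j) 0} \<ge> 1 / 2"
  shows "AE \<omega> in M. no_touch_at (\<lambda>t. X t \<omega>) J0 \<beta> L q"
  unfolding no_touch_at_def
proof (rule AE_not_eventually)
  let ?g = "\<lambda>q m \<omega> j. grid (\<lambda>t. X t \<omega>) q (1 / 2 ^ m) j"
  let ?c = "\<lambda>m i k. (of_int (i + k) / 2 ^ m)\<^sup>2 / 2 :: real"
  let ?\<phi> = "\<lambda>m u. (of_int u / 2 ^ m)\<^sup>2 :: real"
  let ?H = "\<lambda>m r. (\<lambda>u. u * 2 ^ (m - r)) ` {1..2 ^ r} :: int set"
  let ?P = "\<lambda>r m x. \<exists>i\<in>{0..2 ^ (m - J0)}. \<exists>k\<in>{0..L * 2 ^ m}. ladder (\<beta> / 2 ^ m) x i \<and>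
    first_crossing (?c m) x i k \<and> stays_below (?\<phi> m) (?H m r) x k"
  have iid: "iid_family M (\<lambda>j \<omega>. ?g q m \<omega> j) (distr M borel (X (1 / 2 ^ m)))" for q m
    by (rule iid_grid) simp
  show "Measurable.pred M (\<lambda>\<omega>. ?P r m (?g q m \<omega>))" for r m
    by (rule iid_family_measurable_pred[OF iid]) measurable
  have stays: "prob {\<omega>\<in>space M. stays_below (?\<phi> m) (?H m r) (?g q m \<omega>) 0} =
      prob {\<omega>\<in>space M. \<forall>u\<in>{1..(2::int) ^ r}. X (of_int u / 2 ^ r) \<omega> - X 0 \<omega> \<ge> - (of_int u / 2 ^ r)\<^sup>2}"
    if "r \<le> m" for r m
  proof -
    have p: "(2::real) ^ m = 2 ^ r * 2 ^ (m - r)" using that by (simp flip: power_add)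
    \<comment> \<open>Increments read in reflected order from base point 0 have the same law. This
      turns the path to the left of \<open>q\<close> into the path to the right of 0 with the sign
      changed.\<close>
    have "prob {\<omega>\<in>space M. stays_below (?\<phi> m) (?H m r) (?g q m \<omega>) 0}
        = prob {\<omega>\<in>space M. stays_below (?\<phi> m) (?H m r) (\<lambda>j. ?g 0 m \<omega> (- 1 - j)) 0}"
    proof (rule iid_family_prob_cong[OF iid])
      show "iid_family M (\<lambda>j \<omega>. ?g 0 m \<omega> (- 1 - j)) (distr M borel (X (1 / 2 ^ m)))"
        by (rule iid_family_reindex[OF iid]) (simp add: inj_on_def)
    qed measurable
    moreover have "stays_below (?\<phi> m) (?H m r) (\<lambda>j. ?g 0 m \<omega> (- 1 - j)) 0 \<longleftrightarrow>
        (\<forall>u\<in>{1..(2::int) ^ r}. X (of_int u / 2 ^ r) \<omega> - X 0 \<omega> \<ge> - (of_int u / 2 ^ r)\<^sup>2)" for \<omega>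
    proof -
      have w: "walk (\<lambda>j. ?g 0 m \<omega> (- 1 - j)) (- 0 - u * 2 ^ (m - r)) (- 0)
          = X (of_int u / 2 ^ r) \<omega> - X 0 \<omega>" if "u \<in> {1..2 ^ r}" for u :: int
      proof -
        have "walk (\<lambda>j. ?g 0 m \<omega> (- 1 - j)) (- 0 - u * 2 ^ (m - r)) (- 0) = walk (?g 0 m \<omega>) 0 (u * 2 ^ (m - r))"
          by (rule sum.reindex_bij_witness[of _ "\<lambda>j. - 1 - j" "\<lambda>j. - 1 - j"]) auto
        also have "\<dots> = X (of_int u / 2 ^ r) \<omega> - X 0 \<omega>"
          using that by (subst walk_grid) (auto simp: p)
        finally show ?thesis .
      qed
      have \<phi>: "?\<phi> m (u * 2 ^ (m - r)) = (of_int u / 2 ^ r)\<^sup>2" for u by (simp add: p)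
      have "stays_below (?\<phi> m) (?H m r) (\<lambda>j. ?g 0 m \<omega> (- 1 - j)) 0 \<longleftrightarrow>
          (\<forall>u\<in>{1..(2::int) ^ r}. - walk (\<lambda>j. ?g 0 m \<omega> (- 1 - j)) (- 0 - u * 2 ^ (m - r)) (- 0)
            \<le> ?\<phi> m (u * 2 ^ (m - r)))"
        unfolding stays_below_def by blast
      also have "\<dots> \<longleftrightarrow> (\<forall>u\<in>{1..(2::int) ^ r}. X (of_int u / 2 ^ r) \<omega> - X 0 \<omega> \<ge> - (of_int u / 2 ^ r)\<^sup>2)"
        by (rule ball_cong[OF refl], subst w, assumption, subst \<phi>) auto
      finally show ?thesis .
    qed
    ultimately show ?thesis by simp
  qed
  fix \<epsilon> :: real assume "0 < \<epsilon>"
  then have "eventually (\<lambda>r. prob {\<omega>\<in>space M. \<forall>u\<in>{1..(2::int) ^ r}.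
      X (of_int u / 2 ^ r) \<omega> - X 0 \<omega> \<ge> - (of_int u / 2 ^ r)\<^sup>2} < \<epsilon> / 2) sequentially"
    by (intro order_tendstoD(2)[OF prob_stays_above_parabola[OF hypB]]) simp
  then obtain r where r: "prob {\<omega>\<in>space M. \<forall>u\<in>{1..(2::int) ^ r}.
      X (of_int u / 2 ^ r) \<omega> - X 0 \<omega> \<ge> - (of_int u / 2 ^ r)\<^sup>2} < \<epsilon> / 2"
    by (auto simp: eventually_sequentially)
  have "prob {\<omega>\<in>space M. ?P r m (?g q m \<omega>)} \<le> \<epsilon>" (is "?p \<le> \<epsilon>") if "max J0 r \<le> m" for m
  proof -
    have "?p * (1 / 2) \<le> ?p * prob {\<omega>\<in>space M. \<not> rises (\<beta> / 2 ^ m) (2 ^ (m - J0)) (?g q m \<omega>) 0}"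
      using c[of m q] that by (intro mult_left_mono) auto
    also have "\<dots> \<le> prob {\<omega>\<in>space M. stays_below (?\<phi> m) (?H m r) (?g q m \<omega>) 0}"
      by (rule prob_ladder_crossing_le[OF iid]) simp
    also have "\<dots> \<le> \<epsilon> / 2" using r stays[of r m] that by simp
    finally show ?thesis by simp
  qed
  then show "\<exists>r m0. \<forall>m\<ge>m0. prob {\<omega>\<in>space M. ?P r m (?g q m \<omega>)} \<le> \<epsilon>" by blast
qed

end

section \<open>Consequences for single paths\<close>

abbreviation usc_env :: "(real \<Rightarrow> real) \<Rightarrow> real \<Rightarrow> real" where
  "usc_env f y \<equiv> max (f y) (left_lim f y)"

lemma cadlag_right: "cadlag f \<Longrightarrow> (f \<longlongrightarrow> f x) (at_right x)"
  by (simp add: cadlag_def)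

lemma cadlag_left: "cadlag f \<Longrightarrow> (f \<longlongrightarrow> left_lim f x) (at_left x)"
  unfolding cadlag_def left_lim_def by (metis tendsto_Lim trivial_limit_at_left_real)

lemma cadlag_less_nhds:
  assumes f: "cadlag f" and c: "usc_env f y < c"
  shows "\<forall>\<^sub>F w in nhds y. f w < c"
proof -
  have "\<forall>\<^sub>F w in at_left y. f w < c" "\<forall>\<^sub>F w in at_right y. f w < c"
    using order_tendstoD(2)[OF cadlag_left[OF f]] order_tendstoD(2)[OF cadlag_right[OF f]] c by auto
  then have "\<forall>\<^sub>F w in at y. f w < c" by (simp add: eventually_at_split)
  then show ?thesis using c by (simp add: eventually_nhds_conv_at)
qed

lemma cadlag_right_seq:
  assumes f: "cadlag f" and t: "t \<longlonglongrightarrow> x" "\<And>n. x \<le> t n"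
  shows "(\<lambda>n. f (t n)) \<longlonglongrightarrow> f x"
proof -
  have "continuous (at x within {x..}) f"
    using cadlag_right[OF f] by (simp add: continuous_within at_within_Ici_at_right)
  then show ?thesis by (rule continuous_within_tendsto_compose') (use t in auto)
qed

text \<open>Rounding up: the values along these points converge to the value at \<open>y\<close>
  itself, also if the path jumps there.\<close>

definition ceil_grid :: "real \<Rightarrow> real \<Rightarrow> nat \<Rightarrow> real" where
  "ceil_grid q y m = q + of_int \<lceil>(y - q) * 2 ^ m\<rceil> / 2 ^ m"

lemma ceil_grid_bounds: "y \<le> ceil_grid q y m" "ceil_grid q y m < y + (1 / 2) ^ m"
proof -
  have "(y - q) * 2 ^ m \<le> of_int \<lceil>(y - q) * 2 ^ m\<rceil>" "of_int \<lceil>(y - q) * 2 ^ m\<rceil> < (y - q) * 2 ^ m + 1"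
    by linarith+
  moreover have "((y - q) * 2 ^ m + 1) / 2 ^ m = y - q + (1 / 2) ^ m"
    by (simp add: add_divide_distrib power_divide)
  ultimately have "y - q \<le> of_int \<lceil>(y - q) * 2 ^ m\<rceil> / 2 ^ m"
    "of_int \<lceil>(y - q) * 2 ^ m\<rceil> / 2 ^ m < y - q + (1 / 2) ^ m"
    using divide_strict_right_mono[of "of_int \<lceil>(y - q) * 2 ^ m\<rceil>" "(y - q) * 2 ^ m + 1" "2 ^ m"]
    by (simp_all add: pos_le_divide_eq)
  then show "y \<le> ceil_grid q y m" "ceil_grid q y m < y + (1 / 2) ^ m"
    unfolding ceil_grid_def by linarith+
qed

lemma ceil_grid_tendsto: "(\<lambda>m. ceil_grid q y m) \<longlonglongrightarrow> y"
proof (rule tendsto_sandwich[of "\<lambda>_. y" _ _ "\<lambda>m. y + (1 / 2) ^ m"])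
  show "(\<lambda>m. y + (1 / 2) ^ m) \<longlonglongrightarrow> y"
    using tendsto_add[OF tendsto_const LIMSEQ_power_zero[of "1 / 2 :: real"], of y] by simp
qed (auto intro!: always_eventually ceil_grid_bounds less_imp_le[OF ceil_grid_bounds(2)])

lemma grid_ladder_iff:
  "ladder (\<beta> / 2 ^ m) (grid F q (1 / 2 ^ m)) i \<longleftrightarrow>
    (\<forall>j\<in>{0..<i}. F (q + of_int j / 2 ^ m) - \<beta> * (q + of_int j / 2 ^ m)
      < F (q + of_int i / 2 ^ m) - \<beta> * (q + of_int i / 2 ^ m))"
proof -
  have "walk (grid F q (1 / 2 ^ m)) j i > \<beta> / 2 ^ m * of_int (i - j) \<longleftrightarrow>
      F (q + of_int j / 2 ^ m) - \<beta> * (q + of_int j / 2 ^ m)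
      < F (q + of_int i / 2 ^ m) - \<beta> * (q + of_int i / 2 ^ m)" if "j \<in> {0..<i}" for j
  proof -
    have "\<beta> / 2 ^ m * of_int (i - j) = \<beta> * (q + of_int i / 2 ^ m) - \<beta> * (q + of_int j / 2 ^ m)"
      by (simp add: field_simps)
    moreover have "walk (grid F q (1 / 2 ^ m)) j i = F (q + of_int i / 2 ^ m) - F (q + of_int j / 2 ^ m)"
      using that by (simp add: walk_grid)
    ultimately show ?thesis by (intro iffI) linarith+
  qed
  then show ?thesis unfolding ladder_def by blast
qed

lemma grid_rises_iff:
  "rises (\<beta> / 2 ^ m) K (grid F q (1 / 2 ^ m)) i \<longleftrightarrow>
    (\<exists>k\<in>{1..K}. F (q + of_int i / 2 ^ m) - \<beta> * (q + of_int i / 2 ^ m)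
      < F (q + of_int (i + k) / 2 ^ m) - \<beta> * (q + of_int (i + k) / 2 ^ m))"
proof -
  have "walk (grid F q (1 / 2 ^ m)) i (i + k) > \<beta> / 2 ^ m * of_int k \<longleftrightarrow>
      F (q + of_int i / 2 ^ m) - \<beta> * (q + of_int i / 2 ^ m)
      < F (q + of_int (i + k) / 2 ^ m) - \<beta> * (q + of_int (i + k) / 2 ^ m)" if "k \<in> {1..K}" for k
  proof -
    have "\<beta> / 2 ^ m * of_int k = \<beta> * (q + of_int (i + k) / 2 ^ m) - \<beta> * (q + of_int i / 2 ^ m)"
      by (simp add: field_simps)
    moreover have "walk (grid F q (1 / 2 ^ m)) i (i + k) = F (q + of_int (i + k) / 2 ^ m) - F (q + of_int i / 2 ^ m)"
      using that by (simp add: walk_grid)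
    ultimately show ?thesis by (intro iffI) linarith+
  qed
  then show ?thesis unfolding rises_def by blast
qed

lemma first_argmax:
  fixes G :: "int \<Rightarrow> real"
  assumes "0 \<le> k"
  shows "\<exists>i\<in>{0..k}. (\<forall>j\<in>{0..<i}. G j < G i) \<and> (\<forall>j\<in>{0..k}. G j \<le> G i)"
  using assms
proof (induction k rule: int_ge_induct)
  case (step k)
  then obtain i where i: "i \<in> {0..k}" "\<forall>j\<in>{0..<i}. G j < G i" "\<forall>j\<in>{0..k}. G j \<le> G i" by blast
  have split: "{0..k + 1} = insert (k + 1) {0..k}" using step by auto
  show ?case
  proof (cases "G (k + 1) \<le> G i")
    case True
    then show ?thesis using i unfolding split by (intro bexI[of _ i]) auto
  next
    case False
    then have "\<forall>j\<in>{0..k}. G j < G (k + 1)" using i(3) by (meson le_less_trans not_le)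
    then show ?thesis unfolding split by (intro bexI[of _ "k + 1"]) auto
  qed
qed auto

lemma ex_grid_point:
  assumes "a < (b::real)"
  obtains r :: nat and k :: int where "a < q + of_int k / 2 ^ r" "q + of_int k / 2 ^ r < b"
proof -
  obtain r u where "a - q < of_int u / 2 ^ r" "of_int u / 2 ^ r < b - q"
    by (rule ex_dyadic[of "a - q" "b - q"]) (use assms in auto)
  then show thesis by (intro that[of u r]) auto
qed

lemma grid_point_refine:
  assumes "r \<le> m"
  shows "of_int k / 2 ^ r = (of_int (k * 2 ^ (m - r)) / 2 ^ m :: real)"
proof -
  have "(2::real) ^ m = 2 ^ r * 2 ^ (m - r)" using assms by (simp flip: power_add)
  then show ?thesis by simp
qed

text \<open>Two gaps combine to a uniform one: close to \<open>y\<close> half the jump, further left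
  the excess \<open>b - \<beta>\<close> of the slopes. A uniform gap survives replacing
  \<open>y\<close> by the grid point above it, and all earlier grid points lie strictly left of
  \<open>y\<close>.\<close>

lemma eventually_ladder_at_jump:
  assumes F: "cadlag F" and "q < y" and jump: "left_lim F y < F y" and "\<beta> < b"
    and below: "\<And>t. \<lbrakk>q \<le> t; t < y\<rbrakk> \<Longrightarrow> F t \<le> F y - b * (y - t)"
  shows "\<forall>\<^sub>F m in sequentially. ladder (\<beta> / 2 ^ m) (grid F q (1 / 2 ^ m)) \<lceil>(y - q) * 2 ^ m\<rceil>"
proof -
  define G where "G t = F t - \<beta> * t" for t
  have "((\<lambda>t. F t - \<beta> * t) \<longlongrightarrow> left_lim F y - \<beta> * y) (at_left y)"
    by (intro tendsto_intros cadlag_left[OF F])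
  moreover have "left_lim F y - \<beta> * y < (left_lim F y + F y) / 2 - \<beta> * y" using jump by simp
  ultimately have "\<forall>\<^sub>F t in at_left y. F t - \<beta> * t < (left_lim F y + F y) / 2 - \<beta> * y"
    by (rule order_tendstoD(2))
  then obtain a where a: "a < y" "\<And>t. \<lbrakk>a < t; t < y\<rbrakk> \<Longrightarrow> G t < (left_lim F y + F y) / 2 - \<beta> * y"
    by (auto simp: eventually_at_left_field G_def)
  define \<gamma> where "\<gamma> = min ((F y - left_lim F y) / 2) ((b - \<beta>) * (y - a))"
  have \<gamma>: "0 < \<gamma>" using jump \<open>\<beta> < b\<close> a(1) by (simp add: \<gamma>_def)
  have gap: "G t \<le> G y - \<gamma>" if "q \<le> t" "t < y" for t
  proof (cases "a < t")
    case True
    have "\<gamma> \<le> (F y - left_lim F y) / 2" unfolding \<gamma>_def by (rule min.cobounded1)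
    then show ?thesis using a(2)[OF True that(2)] unfolding G_def by (simp add: field_simps)
  next
    case False
    have "G t \<le> G y - (b - \<beta>) * (y - t)" using below[OF that] by (simp add: G_def algebra_simps)
    moreover have "(b - \<beta>) * (y - a) \<le> (b - \<beta>) * (y - t)"
      using False \<open>\<beta> < b\<close> by (intro mult_left_mono) auto
    ultimately show ?thesis by (simp add: \<gamma>_def)
  qed
  have "(\<lambda>m. F (ceil_grid q y m) - \<beta> * ceil_grid q y m) \<longlonglongrightarrow> F y - \<beta> * y"
    by (intro tendsto_intros cadlag_right_seq[OF F] ceil_grid_tendsto ceil_grid_bounds)
  then have "\<forall>\<^sub>F m in sequentially. G y - \<gamma> < G (ceil_grid q y m)"
    unfolding G_def by (rule order_tendstoD(1)) (use \<gamma> in simp)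
  then show ?thesis
  proof eventually_elim
    case (elim m)
    have "G (q + of_int j / 2 ^ m) < G (ceil_grid q y m)" if "j \<in> {0..<\<lceil>(y - q) * 2 ^ m\<rceil>}" for j
    proof -
      have "of_int j < (y - q) * 2 ^ m" using that by (simp add: less_ceiling_iff)
      then have "q + of_int j / 2 ^ m < y" by (simp add: field_simps)
      then show ?thesis using gap[of "q + of_int j / 2 ^ m"] that elim by simp
    qed
    then show ?case by (simp add: grid_ladder_iff G_def ceil_grid_def)
  qed
qed

lemma eventually_ceil_grid_index:
  fixes q y :: real
  assumes "q < y" "y < q + 1 / 2 ^ J0"
  shows "\<forall>\<^sub>F m in sequentially. \<lceil>(y - q) * 2 ^ m\<rceil> \<in> {0..2 ^ (m - J0)}"
proof -
  have "\<forall>\<^sub>F m in sequentially. ceil_grid q y m < q + 1 / 2 ^ J0"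
    by (rule order_tendstoD(2)[OF ceil_grid_tendsto assms(2)])
  then show ?thesis using eventually_ge_at_top[of J0]
  proof eventually_elim
    case (elim m)
    have "of_int \<lceil>(y - q) * 2 ^ m\<rceil> / 2 ^ m < of_int (2 ^ (m - J0)) / (2 ^ m :: real)"
      using elim(1) grid_point_refine[OF elim(2), of 1] by (simp add: ceil_grid_def)
    then have "real_of_int \<lceil>(y - q) * 2 ^ m\<rceil> < of_int (2 ^ (m - J0))"
      by (simp add: divide_less_cancel)
    then have "\<lceil>(y - q) * 2 ^ m\<rceil> < 2 ^ (m - J0)" by (simp only: of_int_less_iff)
    moreover have "0 \<le> (y - q) * 2 ^ m" using assms(1) by simp
    then have "0 \<le> \<lceil>(y - q) * 2 ^ m\<rceil>" by linarith
    ultimately show ?case by simp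
  qed
qed

text \<open>Without an upward jump the supremum of the tilted path before \<open>y\<close> is
  approached but not reached, so records accumulate at \<open>y\<close> from the left and each is
  soon overtaken. At all fine levels this produces a record that rises within time
  \<open>1 / 2 ^ J\<close>, which \<open>tame_at\<close> forbids for infinitely many levels.\<close>

lemma tame_at_jump:
  assumes F: "cadlag F" and tame: "tame_at F 1 J0 \<beta> q" and q: "q < y" "y < q + 1 / 2 ^ J0" and "\<beta> < b"
    and below: "\<And>t. \<lbrakk>q \<le> t; t < y\<rbrakk> \<Longrightarrow> F t \<le> usc_env F y - b * (y - t)"
  shows "left_lim F y < F y"
proof (rule ccontr)
  assume "\<not> ?thesis"
  then have env: "usc_env F y = left_lim F y" by simp
  define G where "G t = F t - \<beta> * t" for t
  define \<mu> where "\<mu> = left_lim F y - \<beta> * y"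
  have G_le: "G t \<le> \<mu> - (b - \<beta>) * (y - v)" if "q \<le> t" "t \<le> v" "v < y" for t v
  proof -
    have "G t \<le> \<mu> - (b - \<beta>) * (y - t)" using below[of t] that unfolding env by (simp add: G_def \<mu>_def algebra_simps)
    moreover have "(b - \<beta>) * (y - v) \<le> (b - \<beta>) * (y - t)" using that \<open>\<beta> < b\<close> by (intro mult_left_mono) auto
    ultimately show ?thesis by linarith
  qed
  have lim: "(G \<longlongrightarrow> \<mu>) (at_left y)"
    unfolding G_def \<mu>_def by (intro tendsto_intros cadlag_left[OF F])
  have exceed: "\<exists>r k. v < q + of_int k / 2 ^ r \<and> q + of_int k / 2 ^ r < y \<and>
      (\<forall>t\<in>{q..v}. G t < G (q + of_int (k::int) / 2 ^ r))" if v: "q \<le> v" "v < y" for v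
  proof -
    have "\<mu> - (b - \<beta>) * (y - v) < \<mu>" using that \<open>\<beta> < b\<close> by simp
    then have "\<forall>\<^sub>F t in at_left y. \<mu> - (b - \<beta>) * (y - v) < G t" by (rule order_tendstoD(1)[OF lim])
    then obtain a where a: "a < y" "\<And>t. \<lbrakk>a < t; t < y\<rbrakk> \<Longrightarrow> \<mu> - (b - \<beta>) * (y - v) < G t"
      by (auto simp: eventually_at_left_field)
    obtain r k where k: "max a v < q + of_int k / 2 ^ r" "q + of_int k / 2 ^ r < y"
      by (rule ex_grid_point[of "max a v" y q]) (use a v in auto)
    have "\<mu> - (b - \<beta>) * (y - v) < G (q + of_int k / 2 ^ r)" using a(2) k by simp
    then have "\<forall>t\<in>{q..v}. G t < G (q + of_int k / 2 ^ r)" using G_le[of _ v] that by fastforce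
    then show ?thesis using k by (intro exI[of _ r] exI[of _ k]) auto
  qed
  obtain J where J: "\<exists>\<^sub>F m in sequentially. \<not> (\<exists>i\<in>{0..2 ^ (m - J0)}. ladder (\<beta> / 2 ^ m) (grid F q (1 / 2 ^ m)) i \<and>
     rises (\<beta> / 2 ^ m) (2 ^ (m - J)) (grid F q (1 / 2 ^ m)) i)"
    using tame by (auto simp: tame_at_def not_eventually)
  \<comment> \<open>Between \<open>v1\<close> and \<open>y\<close> at most time
    \<open>1 / 2 ^ J\<close> passes, the horizon allowed for the rise.\<close>
  define v1 where "v1 = max q (y - 1 / 2 ^ J)"
  have v1: "q \<le> v1" "v1 < y" using q by (auto simp: v1_def)
  obtain r2 k2 where k2: "v1 < q + of_int k2 / 2 ^ r2" "q + of_int k2 / 2 ^ r2 < y"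
      "\<forall>t\<in>{q..v1}. G t < G (q + of_int k2 / 2 ^ r2)"
    using exceed[OF v1] by blast
  \<comment> \<open>A second exceedance, of everything up to the first one: it will overtake the
    record found below.\<close>
  have "q \<le> q + of_int k2 / 2 ^ r2" using k2(1) v1(1) by linarith
  from exceed[OF this k2(2)]
  obtain r3 k3 where k3: "q + of_int k2 / 2 ^ r2 < q + of_int k3 / 2 ^ r3" "q + of_int k3 / 2 ^ r3 < y"
      "\<forall>t\<in>{q..q + of_int k2 / 2 ^ r2}. G t < G (q + of_int k3 / 2 ^ r3)"
    by blast
  obtain m where m: "max (max r2 r3) (max J0 J) \<le> m"
    "\<not> (\<exists>i\<in>{0..2 ^ (m - J0)}. ladder (\<beta> / 2 ^ m) (grid F q (1 / 2 ^ m)) i \<and>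
     rises (\<beta> / 2 ^ m) (2 ^ (m - J)) (grid F q (1 / 2 ^ m)) i)"
    using J unfolding frequently_sequentially by blast
  define p where "p j = q + of_int j / 2 ^ m" for j :: int
  have p_less: "p i < p j \<longleftrightarrow> i < j" for i j by (simp add: p_def divide_less_cancel)
  have p_le: "p i \<le> p j \<longleftrightarrow> i \<le> j" for i j by (simp add: p_def divide_le_cancel)
  define a2 a3 where "a2 = k2 * 2 ^ (m - r2)" and "a3 = k3 * 2 ^ (m - r3)"
  have a2: "q + of_int k2 / 2 ^ r2 = p a2" and a3: "q + of_int k3 / 2 ^ r3 = p a3"
    using m(1) by (simp_all add: p_def a2_def a3_def grid_point_refine[of r2 m] grid_point_refine[of r3 m])
  note k2 = k2[unfolded a2] and k3 = k3[unfolded a2 a3]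
  have p0: "p 0 = q" by (simp add: p_def)
  have "p 0 < p a2" using k2(1) v1(1) unfolding p0 by linarith
  then have "0 \<le> a2" unfolding p_less by simp
  \<comment> \<open>The first maximal grid point up to \<open>a2\<close> is a record by
    construction, and it lies beyond \<open>v1\<close> because the path at \<open>a2\<close> is
    higher than anywhere up to \<open>v1\<close>.\<close>
  from first_argmax[OF this, of "\<lambda>j. G (p j)"] obtain i where i: "i \<in> {0..a2}"
    "\<forall>j\<in>{0..<i}. G (p j) < G (p i)" "\<forall>j\<in>{0..a2}. G (p j) \<le> G (p i)" by blast
  have iq: "q \<le> p i" "p i \<le> p a2" using i(1) p_le[of 0 i] p_le[of i a2] by (auto simp: p0)
  have "ladder (\<beta> / 2 ^ m) (grid F q (1 / 2 ^ m)) i"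
    using i(2) by (simp add: grid_ladder_iff G_def p_def)
  moreover have "v1 < p i"
  proof (rule ccontr)
    assume "\<not> ?thesis"
    then have "G (p i) < G (p a2)" using k2(3) iq by auto
    then show False using i(3) \<open>0 \<le> a2\<close> by force
  qed
  have idx: "a3 - i \<in> {1..2 ^ (m - J)}"
  proof -
    have "i < a3" using p_less[of i a3] iq k3(1) by linarith
    moreover have "p a3 - p i < 1 / 2 ^ J" using k3(2) \<open>v1 < p i\<close> by (simp add: v1_def)
    then have "of_int (a3 - i) / 2 ^ m < of_int (2 ^ (m - J)) / (2 ^ m :: real)"
      using grid_point_refine[of J m 1] m(1) by (simp add: p_def diff_divide_distrib)
    then have "real_of_int (a3 - i) < of_int (2 ^ (m - J))" by (simp add: divide_less_cancel)
    then have "a3 - i < 2 ^ (m - J)" by (simp only: of_int_less_iff)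
    ultimately show ?thesis by simp
  qed
  have "rises (\<beta> / 2 ^ m) (2 ^ (m - J)) (grid F q (1 / 2 ^ m)) i"
    unfolding grid_rises_iff
    by (rule bexI[OF _ idx]) (use k3(3) iq in \<open>auto simp: G_def p_def\<close>)
  moreover have "i \<in> {0..2 ^ (m - J0)}"
  proof -
    have "p i < q + 1 / 2 ^ J0" using iq k2(2) q(2) by linarith
    then have "of_int i / 2 ^ m < of_int (2 ^ (m - J0)) / (2 ^ m :: real)"
      using grid_point_refine[of J0 m 1] m(1) by (simp add: p_def)
    then have "real_of_int i < of_int (2 ^ (m - J0))" by (simp add: divide_less_cancel)
    then have "i < 2 ^ (m - J0)" by (simp only: of_int_less_iff)
    then show ?thesis using i(1) by simp
  qed
  ultimately show False using m(2) by blast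
qed

text \<open>Rounded up, \<open>y\<close> is a record at every fine level. A point
  \<open>y + h\<close> with \<open>h < 1 / 2 ^ J\<close> that violates the slope would make this
  record rise at every fine level, against \<open>tame_at\<close>.\<close>

lemma tame_at_right_slope:
  assumes F: "cadlag F" and tame: "tame_at F 1 J0 \<beta> q" and q: "q < y" "y < q + 1 / 2 ^ J0" and "\<beta> < b"
    and jump: "left_lim F y < F y" and below: "\<And>t. \<lbrakk>q \<le> t; t < y\<rbrakk> \<Longrightarrow> F t \<le> F y - b * (y - t)"
  shows "\<exists>\<eta>>0. \<forall>h. 0 < h \<and> h < \<eta> \<longrightarrow> F (y + h) - F y \<le> \<beta> * h"
proof -
  obtain J where J: "\<exists>\<^sub>F m in sequentially. \<not> (\<exists>i\<in>{0..2 ^ (m - J0)}. ladder (\<beta> / 2 ^ m) (grid F q (1 / 2 ^ m)) i \<and>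
     rises (\<beta> / 2 ^ m) (2 ^ (m - J)) (grid F q (1 / 2 ^ m)) i)"
    using tame by (auto simp: tame_at_def not_eventually)
  have "F (y + h) - F y \<le> \<beta> * h" if h: "0 < h" "h < 1 / 2 ^ J" for h
  proof (rule ccontr)
    assume "\<not> ?thesis"
    then have pos: "0 < (F (y + h) - \<beta> * (y + h)) - (F y - \<beta> * y)" by (simp add: algebra_simps)
    let ?c = "ceil_grid q"
    have "(\<lambda>m. (F (?c (y + h) m) - \<beta> * ?c (y + h) m) - (F (?c y m) - \<beta> * ?c y m))
        \<longlonglongrightarrow> (F (y + h) - \<beta> * (y + h)) - (F y - \<beta> * y)"
      by (intro tendsto_intros cadlag_right_seq[OF F] ceil_grid_tendsto ceil_grid_bounds)
    then have e1: "\<forall>\<^sub>F m in sequentially. 0 < (F (?c (y + h) m) - \<beta> * ?c (y + h) m) - (F (?c y m) - \<beta> * ?c y m)"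
      by (rule order_tendstoD(1)) (rule pos)
    have "(\<lambda>m. ?c (y + h) m - ?c y m) \<longlonglongrightarrow> (y + h) - y" by (intro tendsto_intros ceil_grid_tendsto)
    then have l: "(\<lambda>m. ?c (y + h) m - ?c y m) \<longlonglongrightarrow> h" by simp
    note e2 = order_tendstoD(1)[OF l h(1)] and e3 = order_tendstoD(2)[OF l h(2)]
    have lad: "\<forall>\<^sub>F m in sequentially. ladder (\<beta> / 2 ^ m) (grid F q (1 / 2 ^ m)) \<lceil>(y - q) * 2 ^ m\<rceil>"
      by (rule eventually_ladder_at_jump[OF F q(1) jump \<open>\<beta> < b\<close>]) (rule below)
    have "\<forall>\<^sub>F m in sequentially. \<exists>i\<in>{0..2 ^ (m - J0)}. ladder (\<beta> / 2 ^ m) (grid F q (1 / 2 ^ m)) i \<and>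
       rises (\<beta> / 2 ^ m) (2 ^ (m - J)) (grid F q (1 / 2 ^ m)) i"
      using lad eventually_ceil_grid_index[OF q]
        e1 e2 e3 eventually_ge_at_top[of J]
    proof eventually_elim
      case (elim m)
      define i k where "i = \<lceil>(y - q) * 2 ^ m\<rceil>" and "k = \<lceil>(y + h - q) * 2 ^ m\<rceil> - i"
      have diff: "?c (y + h) m - ?c y m = of_int k / 2 ^ m"
        by (simp add: ceil_grid_def i_def k_def diff_divide_distrib)
      have "1 \<le> k" using elim(4) unfolding diff by (simp add: zero_less_divide_iff)
      moreover have "of_int k / 2 ^ m < of_int (2 ^ (m - J)) / (2 ^ m :: real)"
        using elim(5) grid_point_refine[OF elim(6), of 1] unfolding diff by simp
      then have "real_of_int k < of_int (2 ^ (m - J))" by (simp add: divide_less_cancel)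
      then have "k < 2 ^ (m - J)" by (simp only: of_int_less_iff)
      ultimately have k: "k \<in> {1..2 ^ (m - J)}" by simp
      have "q + of_int (i + k) / 2 ^ m = ?c (y + h) m" "q + of_int i / 2 ^ m = ?c y m"
        by (simp_all add: ceil_grid_def i_def k_def)
      then have "rises (\<beta> / 2 ^ m) (2 ^ (m - J)) (grid F q (1 / 2 ^ m)) i"
        unfolding grid_rises_iff using elim(3) k by (intro bexI[OF _ k]) simp
      then show ?case using elim(1,2) by (auto simp: i_def)
    qed
    then show False using J by (simp add: frequently_def)
  qed
  then show ?thesis by (intro exI[of _ "1 / 2 ^ J"]) auto
qed

text \<open>\<open>J0\<close> depends on the slope but not on the dyadic base point, because the
  base point must be chosen within \<open>1 / 2 ^ J0\<close> of a time that is not known in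
  advance.\<close>

definition tame :: "(real \<Rightarrow> real) \<Rightarrow> bool" where
  "tame F \<longleftrightarrow> (\<forall>n::nat. \<exists>J0. \<forall>(u::int) (r::nat). tame_at F 1 J0 (1 / real (Suc n)) (of_int u / 2 ^ r))"

lemma tame_local_max:
  assumes F: "cadlag F" and tame: "tame F" and "0 < b" "0 < \<delta>"
    and below: "\<And>h. \<lbrakk>0 < h; h < \<delta>\<rbrakk> \<Longrightarrow> F (y - h) \<le> usc_env F y - b * h"
  shows "left_lim F y < F y"
    and "0 < \<epsilon> \<Longrightarrow> \<exists>\<eta>>0. \<forall>h. 0 < h \<and> h < \<eta> \<longrightarrow> F (y + h) - F y \<le> \<epsilon> * h"
proof -
  have *: "\<exists>\<beta> J0 u r. \<beta> < b \<and> \<beta> < \<epsilon> \<and> tame_at F 1 J0 \<beta> (of_int (u::int) / 2 ^ (r::nat)) \<and>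
      y - \<delta> < of_int u / 2 ^ r \<and> of_int u / 2 ^ r < y \<and> y < of_int u / 2 ^ r + 1 / 2 ^ J0" if "0 < \<epsilon>" for \<epsilon> :: real
  proof -
    obtain n where n: "1 / real (Suc n) < min b \<epsilon>"
      using \<open>0 < b\<close> \<open>0 < \<epsilon>\<close> nat_approx_posE[of "min b \<epsilon>"] by auto
    obtain J0 where J0: "\<And>u r. tame_at F 1 J0 (1 / real (Suc n)) (of_int (u::int) / 2 ^ (r::nat))"
      using tame unfolding tame_def by blast
    obtain r u where "max (y - \<delta>) (y - 1 / 2 ^ J0) < of_int u / 2 ^ r" "of_int u / 2 ^ r < y"
      by (rule ex_dyadic[of "max (y - \<delta>) (y - 1 / 2 ^ J0)" y]) (use \<open>0 < \<delta>\<close> in auto)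
    then show ?thesis using n J0 by (intro exI[of _ "1 / real (Suc n)"] exI[of _ J0] exI[of _ u] exI[of _ r]) auto
  qed
  have below': "F t \<le> usc_env F y - b * (y - t)" if "y - \<delta> < q" "q \<le> t" "t < y" for t q
    using below[of "y - t"] that by simp
  show jump: "left_lim F y < F y"
  proof -
    obtain \<beta> J0 u r where "\<beta> < b" and q: "tame_at F 1 J0 \<beta> (of_int (u::int) / 2 ^ (r::nat))"
      "y - \<delta> < of_int u / 2 ^ r" "of_int u / 2 ^ r < y" "y < of_int u / 2 ^ r + 1 / 2 ^ J0"
      using *[OF zero_less_one] by blast
    show ?thesis by (rule tame_at_jump[OF F q(1,3,4) \<open>\<beta> < b\<close>]) (rule below'[OF q(2)])
  qed
  show "\<exists>\<eta>>0. \<forall>h. 0 < h \<and> h < \<eta> \<longrightarrow> F (y + h) - F y \<le> \<epsilon> * h" if \<epsilon>: "0 < \<epsilon>"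
  proof -
    obtain \<beta> J0 u r where \<beta>: "\<beta> < b" "\<beta> < \<epsilon>" and q: "tame_at F 1 J0 \<beta> (of_int (u::int) / 2 ^ (r::nat))"
      "y - \<delta> < of_int u / 2 ^ r" "of_int u / 2 ^ r < y" "y < of_int u / 2 ^ r + 1 / 2 ^ J0"
      using *[OF \<epsilon>] by blast
    have below'': "F t \<le> F y - b * (y - t)" if "of_int u / 2 ^ r \<le> t" "t < y" for t
      using below'[OF q(2) that] jump by simp
    have "\<exists>\<eta>>0. \<forall>h. 0 < h \<and> h < \<eta> \<longrightarrow> F (y + h) - F y \<le> \<beta> * h"
      by (rule tame_at_right_slope[OF F q(1,3,4) \<beta>(1) jump]) (rule below'')
    then obtain \<eta> where \<eta>: "0 < \<eta>" "\<And>h. 0 < h \<Longrightarrow> h < \<eta> \<Longrightarrow> F (y + h) - F y \<le> \<beta> * h" by blast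
    have "F (y + h) - F y \<le> \<epsilon> * h" if "0 < h" "h < \<eta>" for h
      using \<eta>(2)[OF that] mult_right_mono[of \<beta> \<epsilon> h] \<beta>(2) that by linarith
    then show ?thesis using \<eta>(1) by blast
  qed
qed

section \<open>Contact of the two parabolas in the case \<open>y = x\<close>\<close>

definition touchless :: "(real \<Rightarrow> real) \<Rightarrow> bool" where
  "touchless f \<longleftrightarrow> (\<forall>n::nat. \<exists>J0. \<forall>(u::int) (r::nat) (L::nat).
     no_touch_at f J0 (1 / real (Suc n)) (int L) (of_int u / 2 ^ r))"

text \<open>Between \<open>y\<close> and \<open>z\<close> the path stays below the parabola hanging
  from \<open>z\<close> by at least \<open>(z - w) * (w - y)\<close>. Together with
  \<open>above\<close> this squeezes the first crossing to the left of \<open>q\<close> towards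
  \<open>y\<close>, and beyond it \<open>env\<close> keeps the path below half the squared lag, up
  to errors. This happens at every fine level, which \<open>no_touch_at\<close> forbids.\<close>

lemma touchless_contra:
  assumes f: "cadlag f" and nt: "touchless f" and "y < z"
    and jump: "left_lim f z < f z"
    and env: "\<And>w. usc_env f w \<le> left_lim f y + (w - y)\<^sup>2 / 2"
    and touch: "f z = left_lim f y + (z - y)\<^sup>2 / 2"
    and above: "\<And>\<delta>. 0 < \<delta> \<Longrightarrow> \<exists>w. y - \<delta> < w \<and> w < y \<and> f z - (z - w)\<^sup>2 / 2 < f w"
  shows False
proof -
  have below: "f w \<le> left_lim f y + (w - y)\<^sup>2 / 2" for w using env[of w] by simp
  \<comment> \<open>The chord of \<open>(w - y)\<^sup>2 / 2\<close> from \<open>t\<close> to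
    \<open>z\<close> has slope at least \<open>(z - y) / 2\<close>.\<close>
  define b where "b = (z - y) / 2"
  have "0 < b" using \<open>y < z\<close> by (simp add: b_def)
  have slope: "f t \<le> f z - b * (z - t)" if "y < t" "t < z" for t
  proof -
    have "f z - f t \<ge> ((z - y)\<^sup>2 - (t - y)\<^sup>2) / 2" using below[of t] touch by argo
    also have "((z - y)\<^sup>2 - (t - y)\<^sup>2) / 2 = (z - t) * ((z - y) + (t - y)) / 2"
      by (simp add: power2_eq_square algebra_simps)
    also have "\<dots> \<ge> (z - t) * (z - y) / 2"
      using that by (intro divide_right_mono mult_left_mono) auto
    finally show ?thesis by (simp add: b_def mult.commute)
  qed
  obtain n where n: "1 / real (Suc n) < b" using \<open>0 < b\<close> nat_approx_posE by blast
  obtain J0 where J0: "\<And>u r L. no_touch_at f J0 (1 / real (Suc n)) (int L) (of_int (u::int) / 2 ^ (r::nat))"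
    using nt unfolding touchless_def by blast
  obtain r0 u0 where q0: "max y (z - 1 / 2 ^ J0) < of_int u0 / 2 ^ r0" "of_int u0 / 2 ^ r0 < z"
    by (rule ex_dyadic[of "max y (z - 1 / 2 ^ J0)" z]) (use \<open>y < z\<close> in auto)
  define q where "q = (of_int u0 / 2 ^ r0 :: real)"
  have q: "y < q" "q < z" "z < q + 1 / 2 ^ J0" using q0 by (auto simp: q_def)
  obtain L :: nat where L: "q - y + 1 < real L" using reals_Archimedean2 by blast
  define \<beta> where "\<beta> = 1 / real (Suc n)"
  have "no_touch_at f J0 \<beta> (int L) q" using J0 by (simp add: q_def \<beta>_def)
  then obtain r where r: "\<exists>\<^sub>F m in sequentially. \<not> (\<exists>i\<in>{0..2 ^ (m - J0)}. \<exists>k\<in>{0..int L * 2 ^ m}.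
     ladder (\<beta> / 2 ^ m) (grid f q (1 / 2 ^ m)) i \<and>
     first_crossing (\<lambda>i k. (of_int (i + k) / 2 ^ m)\<^sup>2 / 2) (grid f q (1 / 2 ^ m)) i k \<and>
     stays_below (\<lambda>u. (of_int u / 2 ^ m)\<^sup>2) ((\<lambda>u. u * 2 ^ (m - r)) ` {1..2 ^ r}) (grid f q (1 / 2 ^ m)) k)"
    unfolding no_touch_at_def not_eventually by blast
  \<comment> \<open>Three errors of size \<open>\<kappa>\<close> occur below. Lags are at least
    \<open>1 / 2 ^ r\<close>, so the spare half of the squared lag is at least
    \<open>4 * \<kappa>\<close>.\<close>
  define \<kappa> where "\<kappa> = ((1 / 2 ^ r)\<^sup>2 / 8 :: real)"
  have "0 < \<kappa>" by (simp add: \<kappa>_def)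
  let ?z = "ceil_grid q z"
  have z_lim: "?z \<longlonglongrightarrow> z" by (rule ceil_grid_tendsto)
  have fz_lim: "(\<lambda>m. f (?z m)) \<longlonglongrightarrow> f z"
    by (rule cadlag_right_seq[OF f ceil_grid_tendsto ceil_grid_bounds(1)])
  have "\<forall>\<^sub>F w in nhds y. (z - w)\<^sup>2 / 2 < (z - y)\<^sup>2 / 2 + \<kappa>"
  proof (rule order_tendstoD(2))
    show "((\<lambda>w. (z - w)\<^sup>2 / 2) \<longlongrightarrow> (z - y)\<^sup>2 / 2) (nhds y)"
      by (intro tendsto_intros filterlim_ident) auto
  qed (use \<open>0 < \<kappa>\<close> in simp)
  moreover have "\<forall>\<^sub>F w in nhds y. \<forall>u\<in>{1..(2::int) ^ r}.
      f (w - of_int u / 2 ^ r) < left_lim f y + (of_int u / 2 ^ r)\<^sup>2 / 2 + \<kappa>"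
  proof (rule eventually_ball_finite, simp, rule ballI)
    fix u :: int
    have "filterlim (\<lambda>w. w - of_int u / 2 ^ r) (nhds (y - of_int u / 2 ^ r)) (nhds y)"
      by (intro tendsto_intros filterlim_ident)
    moreover have "\<forall>\<^sub>F w in nhds (y - of_int u / 2 ^ r). f w < left_lim f y + (of_int u / 2 ^ r)\<^sup>2 / 2 + \<kappa>"
      using env[of "y - of_int u / 2 ^ r"] \<open>0 < \<kappa>\<close> by (intro cadlag_less_nhds[OF f]) simp
    ultimately show "\<forall>\<^sub>F w in nhds y. f (w - of_int u / 2 ^ r) < left_lim f y + (of_int u / 2 ^ r)\<^sup>2 / 2 + \<kappa>"
      by (rule eventually_compose_filterlim[rotated])
  qed
  ultimately have "\<forall>\<^sub>F w in nhds y. (z - w)\<^sup>2 / 2 < (z - y)\<^sup>2 / 2 + \<kappa> \<and>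
      (\<forall>u\<in>{1..(2::int) ^ r}. f (w - of_int u / 2 ^ r) < left_lim f y + (of_int u / 2 ^ r)\<^sup>2 / 2 + \<kappa>)"
    by (rule eventually_conj)
  then obtain e0 where e0: "0 < e0" "\<And>w. dist w y < e0 \<Longrightarrow> (z - w)\<^sup>2 / 2 < (z - y)\<^sup>2 / 2 + \<kappa>"
    "\<And>w u. \<lbrakk>dist w y < e0; u \<in> {1..(2::int) ^ r}\<rbrakk> \<Longrightarrow>
      f (w - of_int u / 2 ^ r) < left_lim f y + (of_int u / 2 ^ r)\<^sup>2 / 2 + \<kappa>"
    unfolding eventually_nhds_metric by blast
  define e where "e = min e0 (min 1 (q - y))"
  have e: "0 < e" "e \<le> e0" "e \<le> 1" using e0(1) q(1) by (auto simp: e_def)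
  obtain w0 where w0: "y - e < w0" "w0 < y" "f z - (z - w0)\<^sup>2 / 2 < f w0" using above[OF e(1)] by blast
  have "\<forall>\<^sub>F w in at_right w0. 0 < f w - (f z - (z - w)\<^sup>2 / 2)"
  proof (rule order_tendstoD(1))
    show "((\<lambda>w. f w - (f z - (z - w)\<^sup>2 / 2)) \<longlongrightarrow> f w0 - (f z - (z - w0)\<^sup>2 / 2)) (at_right w0)"
      by (intro tendsto_intros cadlag_right[OF f]) auto
  qed (use w0 in simp)
  then obtain c where c: "w0 < c" "\<And>w. \<lbrakk>w0 < w; w < c\<rbrakk> \<Longrightarrow> f z - (z - w)\<^sup>2 / 2 < f w"
    by (auto simp: eventually_at_right_field)
  \<comment> \<open>The crossing persists to the right of \<open>w0\<close>, so it can be moved to a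
    point at dyadic distance from \<open>q\<close>, which belongs to all fine grids.\<close>
  obtain r1 k1 where k1: "q - min c y < of_int k1 / 2 ^ r1" "of_int k1 / 2 ^ r1 < q - w0"
    by (rule ex_dyadic[of "q - min c y" "q - w0"]) (use c w0 in auto)
  define w1 where "w1 = q - of_int k1 / 2 ^ r1"
  have w1: "y - e < w1" "w1 < y" "f z - (z - w1)\<^sup>2 / 2 < f w1"
    using k1 w0 c(2)[of w1] by (auto simp: w1_def)
  have crosses: "\<forall>\<^sub>F m in sequentially. f (?z m) - (?z m - w1)\<^sup>2 / 2 < f w1"
  proof (rule order_tendstoD(2))
    show "(\<lambda>m. f (?z m) - (?z m - w1)\<^sup>2 / 2) \<longlonglongrightarrow> f z - (z - w1)\<^sup>2 / 2"
      by (intro tendsto_intros fz_lim z_lim) auto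
  qed (rule w1)
  have "(\<lambda>m. \<bar>f (?z m) - f z\<bar> + (?z m - z) * (?z m + z - 2 * y) / 2) \<longlonglongrightarrow>
      \<bar>f z - f z\<bar> + (z - z) * (z + z - 2 * y) / 2"
    by (intro tendsto_intros fz_lim z_lim) auto
  then have near: "\<forall>\<^sub>F m in sequentially. \<bar>f (?z m) - f z\<bar> + (?z m - z) * (?z m + z - 2 * y) / 2 < (z - q) * e"
    by (rule order_tendstoD(2)) (use q e in simp)
  have top: "\<forall>\<^sub>F m in sequentially. \<forall>w. y \<le> w \<longrightarrow> f (?z m) - (?z m - w)\<^sup>2 / 2 > f z - (z - w)\<^sup>2 / 2 - (z - q) * e"
    using near
  proof eventually_elim
    case (elim m)
    show ?case
    proof (intro allI impI)
      fix w assume "y \<le> w"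
      have "(?z m - w)\<^sup>2 / 2 - (z - w)\<^sup>2 / 2 = (?z m - z) * (?z m + z - 2 * w) / 2"
        by (simp add: power2_eq_square field_simps)
      also have "\<dots> \<le> (?z m - z) * (?z m + z - 2 * y) / 2"
        using ceil_grid_bounds(1)[of z q m] \<open>y \<le> w\<close> by (intro divide_right_mono mult_left_mono) auto
      finally show "f (?z m) - (?z m - w)\<^sup>2 / 2 > f z - (z - w)\<^sup>2 / 2 - (z - q) * e"
        using elim by linarith
    qed
  qed
  \<comment> \<open>On \<open>{y + e..q}\<close> the gap between the parabolas is at least
    \<open>(z - q) * e\<close>, more than rounding \<open>z\<close> costs.\<close>
  have no_cross: "\<forall>\<^sub>F m in sequentially. \<forall>w. y + e \<le> w \<and> w \<le> q \<longrightarrow> f w < f (?z m) - (?z m - w)\<^sup>2 / 2"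
    using top
  proof eventually_elim
    case (elim m)
    show ?case
    proof (intro allI impI)
      fix w assume w: "y + e \<le> w \<and> w \<le> q"
      have "(z - y)\<^sup>2 / 2 - (z - w)\<^sup>2 / 2 - (w - y)\<^sup>2 / 2 = (z - w) * (w - y)"
        by (simp add: power2_eq_square field_simps)
      also have "\<dots> \<ge> (z - q) * e" using w q e by (intro mult_mono) auto
      finally have "f w \<le> f z - (z - w)\<^sup>2 / 2 - (z - q) * e" using below[of w] touch by linarith
      moreover have "y \<le> w" using w e by simp
      ultimately show "f w < f (?z m) - (?z m - w)\<^sup>2 / 2" using elim by fastforce
    qed
  qed
  have "(\<lambda>m. f (?z m) - (?z m - z) * (?z m + z - 2 * (y - e)) / 2) \<longlonglongrightarrow> f z - (z - z) * (z + z - 2 * (y - e)) / 2"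
    by (intro tendsto_intros fz_lim z_lim) auto
  then have "\<forall>\<^sub>F m in sequentially. f z - \<kappa> < f (?z m) - (?z m - z) * (?z m + z - 2 * (y - e)) / 2"
    by (rule order_tendstoD(1)) (use \<open>0 < \<kappa>\<close> in simp)
  \<comment> \<open>The height of a crossing near \<open>y\<close>: one \<open>\<kappa>\<close> is
    lost by moving from \<open>y\<close> to \<open>w\<close>, one by rounding
    \<open>z\<close>.\<close>
  then have level: "\<forall>\<^sub>F m in sequentially. \<forall>w. dist w y < e \<longrightarrow> left_lim f y - 2 * \<kappa> < f (?z m) - (?z m - w)\<^sup>2 / 2"
  proof eventually_elim
    case (elim m)
    show ?case
    proof (intro allI impI)
      fix w assume w: "dist w y < e"
      have "(?z m - w)\<^sup>2 / 2 - (z - w)\<^sup>2 / 2 = (?z m - z) * (?z m + z - 2 * w) / 2"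
        by (simp add: power2_eq_square field_simps)
      also have "\<dots> \<le> (?z m - z) * (?z m + z - 2 * (y - e)) / 2"
        using ceil_grid_bounds(1)[of z q m] w
        by (intro divide_right_mono mult_left_mono) (auto simp: dist_real_def)
      finally show "left_lim f y - 2 * \<kappa> < f (?z m) - (?z m - w)\<^sup>2 / 2"
        using elim e0(2)[of w] w e(2) touch by linarith
    qed
  qed
  have lad: "\<forall>\<^sub>F m in sequentially. ladder (\<beta> / 2 ^ m) (grid f q (1 / 2 ^ m)) \<lceil>(z - q) * 2 ^ m\<rceil>"
    by (rule eventually_ladder_at_jump[OF f q(2) jump, of \<beta> b]) (use n slope q in \<open>auto simp: \<beta>_def\<close>)
  have "\<forall>\<^sub>F m in sequentially. \<exists>i\<in>{0..2 ^ (m - J0)}. \<exists>k\<in>{0..int L * 2 ^ m}.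
     ladder (\<beta> / 2 ^ m) (grid f q (1 / 2 ^ m)) i \<and>
     first_crossing (\<lambda>i k. (of_int (i + k) / 2 ^ m)\<^sup>2 / 2) (grid f q (1 / 2 ^ m)) i k \<and>
     stays_below (\<lambda>u. (of_int u / 2 ^ m)\<^sup>2) ((\<lambda>u. u * 2 ^ (m - r)) ` {1..2 ^ r}) (grid f q (1 / 2 ^ m)) k"
    using lad eventually_ceil_grid_index[OF q(2,3)] crosses no_cross level
      eventually_ge_at_top[of r1] eventually_ge_at_top[of r]
  proof eventually_elim
    case (elim m)
    define i where "i = \<lceil>(z - q) * 2 ^ m\<rceil>"
    define w where "w k = q - of_int k / 2 ^ m" for k :: int
    have i0: "0 \<le> i" using elim(2) by (simp add: i_def)
    have zi: "?z m = q + of_int i / 2 ^ m" by (simp add: ceil_grid_def i_def)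
    let ?c = "\<lambda>i k. (of_int (i + k) / 2 ^ m)\<^sup>2 / 2 :: real"
    have cross_iff: "crosses ?c (grid f q (1 / 2 ^ m)) i k \<longleftrightarrow> f (?z m) - (?z m - w k)\<^sup>2 / 2 < f (w k)"
      if "0 \<le> k" for k
    proof -
      have 1: "walk (grid f q (1 / 2 ^ m)) (- k) 0 = f q - f (w k)"
        using that by (simp add: walk_grid w_def)
      have 2: "walk (grid f q (1 / 2 ^ m)) 0 i = f (?z m) - f q"
        using i0 by (simp add: walk_grid zi)
      have 3: "of_int (i + k) / 2 ^ m = ?z m - w k"
        by (simp add: zi w_def add_divide_distrib)
      show ?thesis unfolding crosses_def 1 2 3 by (intro iffI) linarith+
    qed
    define k1' where "k1' = k1 * 2 ^ (m - r1)"
    have wk1: "w k1' = w1" using grid_point_refine[OF elim(6), of k1] by (simp add: w_def w1_def k1'_def)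
    have "0 < of_int k1 / (2 ^ r1 :: real)" using w1(2) q(1) by (simp add: w1_def)
    then have "0 < k1" by (simp add: zero_less_divide_iff)
    then have "0 \<le> k1'" by (simp add: k1'_def)
    have "crosses ?c (grid f q (1 / 2 ^ m)) i k1'"
      using cross_iff[OF \<open>0 \<le> k1'\<close>] elim(3) by (simp add: wk1)
    \<comment> \<open>The least crossing exists since \<open>k1'\<close> is one. Its location
      \<open>w k\<close> is at \<open>w1\<close> or to the right of it, and left of
      \<open>y + e\<close>.\<close>
    define k where "k = int (LEAST k. crosses ?c (grid f q (1 / 2 ^ m)) i (int k))"
    have ex: "crosses ?c (grid f q (1 / 2 ^ m)) i (int (nat k1'))"
      using \<open>crosses ?c (grid f q (1 / 2 ^ m)) i k1'\<close> \<open>0 \<le> k1'\<close> by simp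
    have k0: "0 \<le> k" and ck: "crosses ?c (grid f q (1 / 2 ^ m)) i k"
      using LeastI[of "\<lambda>k. crosses ?c (grid f q (1 / 2 ^ m)) i (int k)", OF ex] by (simp_all add: k_def)
    have "k \<le> k1'"
      using Least_le[of "\<lambda>k. crosses ?c (grid f q (1 / 2 ^ m)) i (int k)", OF ex] \<open>0 \<le> k1'\<close> by (simp add: k_def)
    have first: "first_crossing ?c (grid f q (1 / 2 ^ m)) i k"
      unfolding first_crossing_def
    proof (intro conjI ck ballI)
      fix l assume "l \<in> {0..<k}"
      then show "\<not> crosses ?c (grid f q (1 / 2 ^ m)) i l"
        using not_less_Least[of "nat l" "\<lambda>k. crosses ?c (grid f q (1 / 2 ^ m)) i (int k)"]
        by (simp add: k_def nat_less_iff)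
    qed
    have "w1 \<le> w k" using \<open>k \<le> k1'\<close> unfolding wk1[symmetric] by (simp add: w_def divide_right_mono)
    have "w k \<le> q" using k0 by (simp add: w_def)
    have cw: "f (?z m) - (?z m - w k)\<^sup>2 / 2 < f (w k)" using ck cross_iff[OF k0] by simp
    then have "w k < y + e" using elim(4) \<open>w k \<le> q\<close> by (metis less_asym not_le)
    then have wk: "dist (w k) y < e" using \<open>w1 \<le> w k\<close> w1(1) by (simp add: dist_real_def abs_less_iff)
    have "stays_below (\<lambda>u. (of_int u / 2 ^ m)\<^sup>2) ((\<lambda>u. u * 2 ^ (m - r)) ` {1..2 ^ r}) (grid f q (1 / 2 ^ m)) k"
      unfolding stays_below_def
    proof (rule ballI, elim imageE)
      fix v u :: int assume v: "v = u * 2 ^ (m - r)" and u: "u \<in> {1..2 ^ r}"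
      have vu: "of_int v / 2 ^ m = (of_int u / 2 ^ r :: real)"
        unfolding v by (rule grid_point_refine[OF elim(7), symmetric])
      have "0 \<le> v" using u v by simp
      then have "- walk (grid f q (1 / 2 ^ m)) (- k - v) (- k) = f (w k - of_int v / 2 ^ m) - f (w k)"
        by (simp add: walk_grid w_def diff_divide_distrib algebra_simps)
      also have "\<dots> < (of_int u / 2 ^ r)\<^sup>2 / 2 + 3 * \<kappa>"
      proof -
        have "dist (w k) y < e0" using wk e(2) by linarith
        then have "f (w k - of_int v / 2 ^ m) < left_lim f y + (of_int u / 2 ^ r)\<^sup>2 / 2 + \<kappa>"
          unfolding vu by (rule e0(3)[OF _ u])
        moreover have "left_lim f y - 2 * \<kappa> < f (w k)" using elim(5) wk cw by fastforce
        ultimately show ?thesis by linarith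
      qed
      also have "\<dots> \<le> (of_int u / 2 ^ r)\<^sup>2"
      proof -
        have "1 / 2 ^ r \<le> (of_int u / 2 ^ r :: real)" using u by (intro divide_right_mono) auto
        then have "(1 / 2 ^ r)\<^sup>2 \<le> (of_int u / 2 ^ r :: real)\<^sup>2" by (rule power_mono) simp
        moreover have "(1 / 2 ^ r)\<^sup>2 = 8 * \<kappa>" by (simp add: \<kappa>_def)
        ultimately have "8 * \<kappa> \<le> (of_int u / 2 ^ r)\<^sup>2" by (simp only:)
        then show ?thesis using \<open>0 < \<kappa>\<close> by argo
      qed
      finally show "- walk (grid f q (1 / 2 ^ m)) (- k - v) (- k) \<le> (of_int v / 2 ^ m)\<^sup>2" unfolding vu by simp
    qed
    moreover have "k \<in> {0..int L * 2 ^ m}"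
    proof -
      have "of_int k / 2 ^ m = q - w k" by (simp add: w_def)
      also have "\<dots> < real L" using \<open>w1 \<le> w k\<close> w1(1) e(3) L by linarith
      finally have "real_of_int k < of_int (int L * 2 ^ m)" by (simp add: divide_less_eq)
      then have "k < int L * 2 ^ m" by (simp only: of_int_less_iff)
      then show ?thesis using k0 by simp
    qed
    ultimately show ?case using elim(1,2) first unfolding i_def by blast
  qed
  then show False using r by (simp add: frequently_def)
qed

section \<open>One-sided limits and time reversal\<close>

lemma left_lim_less:
  assumes f: "cadlag f" and "a < t" "\<And>s. \<lbrakk>a < s; s < t\<rbrakk> \<Longrightarrow> f s \<le> c"
  shows "left_lim f t \<le> c"
proof (rule tendsto_upperbound[OF cadlag_left[OF f]])
  show "\<forall>\<^sub>F s in at_left t. f s \<le> c"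
    using eventually_at_left_real[OF assms(2)] by eventually_elim (use assms(3) in auto)
qed simp

lemma left_lim_greater:
  assumes f: "cadlag f" and "a < t" "\<And>s. \<lbrakk>a < s; s < t\<rbrakk> \<Longrightarrow> c \<le> f s"
  shows "c \<le> left_lim f t"
proof (rule tendsto_lowerbound[OF cadlag_left[OF f]])
  show "\<forall>\<^sub>F s in at_left t. c \<le> f s"
    using eventually_at_left_real[OF assms(2)] by eventually_elim (use assms(3) in auto)
qed simp

text \<open>Strict bounds on the path only give weak bounds on its left limits, hence the
  intermediate levels \<open>c'\<close>.\<close>

lemma left_lim_tendsto_left:
  assumes f: "cadlag f" shows "(left_lim f \<longlongrightarrow> left_lim f y) (at_left y)"
proof (rule order_tendstoI)
  fix c assume "c < left_lim f y"
  then obtain c' where c': "c < c'" "c' < left_lim f y" using dense by blast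
  have "\<forall>\<^sub>F s in at_left y. c' < f s" by (rule order_tendstoD(1)[OF cadlag_left[OF f] c'(2)])
  then obtain a where a: "a < y" "\<And>s. \<lbrakk>a < s; s < y\<rbrakk> \<Longrightarrow> c' < f s" by (auto simp: eventually_at_left_field)
  have "c < left_lim f t" if "t \<in> {a<..<y}" for t
    using left_lim_greater[OF f, of a t c'] a(2) that c'(1) by force
  then show "\<forall>\<^sub>F t in at_left y. c < left_lim f t"
    using eventually_at_left_real[OF a(1)] by (rule eventually_mono[rotated])
next
  fix c assume "left_lim f y < c"
  then obtain c' where c': "c' < c" "left_lim f y < c'" using dense by blast
  have "\<forall>\<^sub>F s in at_left y. f s < c'" by (rule order_tendstoD(2)[OF cadlag_left[OF f] c'(2)])
  then obtain a where a: "a < y" "\<And>s. \<lbrakk>a < s; s < y\<rbrakk> \<Longrightarrow> f s < c'" by (auto simp: eventually_at_left_field)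
  have "left_lim f t < c" if "t \<in> {a<..<y}" for t
    using left_lim_less[OF f, of a t c'] a(2) that c'(1) by force
  then show "\<forall>\<^sub>F t in at_left y. left_lim f t < c"
    using eventually_at_left_real[OF a(1)] by (rule eventually_mono[rotated])
qed

lemma left_lim_tendsto_right:
  assumes f: "cadlag f" shows "(left_lim f \<longlongrightarrow> f y) (at_right y)"
proof (rule order_tendstoI)
  fix c assume "c < f y"
  then obtain c' where c': "c < c'" "c' < f y" using dense by blast
  have "\<forall>\<^sub>F s in at_right y. c' < f s" by (rule order_tendstoD(1)[OF cadlag_right[OF f] c'(2)])
  then obtain a where a: "y < a" "\<And>s. \<lbrakk>y < s; s < a\<rbrakk> \<Longrightarrow> c' < f s" by (auto simp: eventually_at_right_field)
  have "c < left_lim f t" if "t \<in> {y<..<a}" for t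
    using left_lim_greater[OF f, of y t c'] a(2) that c'(1) by force
  then show "\<forall>\<^sub>F t in at_right y. c < left_lim f t"
    using eventually_at_right_real[OF a(1)] by (rule eventually_mono[rotated])
next
  fix c assume "f y < c"
  then obtain c' where c': "c' < c" "f y < c'" using dense by blast
  have "\<forall>\<^sub>F s in at_right y. f s < c'" by (rule order_tendstoD(2)[OF cadlag_right[OF f] c'(2)])
  then obtain a where a: "y < a" "\<And>s. \<lbrakk>y < s; s < a\<rbrakk> \<Longrightarrow> f s < c'" by (auto simp: eventually_at_right_field)
  have "left_lim f t < c" if "t \<in> {y<..<a}" for t
    using left_lim_less[OF f, of y t c'] a(2) that c'(1) by force
  then show "\<forall>\<^sub>F t in at_right y. left_lim f t < c"
    using eventually_at_right_real[OF a(1)] by (rule eventually_mono[rotated])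
qed

text \<open>Plain reflection would be continuous from the left; taking left limits first restores
  the cadlag convention. Values and left limits trade places.\<close>

definition reversal :: "(real \<Rightarrow> real) \<Rightarrow> real \<Rightarrow> real" where
  "reversal f t = left_lim f (- t)"

lemma reversal_tendsto:
  assumes f: "cadlag f"
  shows "(reversal f \<longlongrightarrow> reversal f t) (at_right t)" "(reversal f \<longlongrightarrow> f (- t)) (at_left t)"
proof -
  show "(reversal f \<longlongrightarrow> reversal f t) (at_right t)"
    using left_lim_tendsto_left[OF f, of "- t"]
    by (simp add: reversal_def[abs_def] at_left_minus[of "- t"] filterlim_filtermap)
  show "(reversal f \<longlongrightarrow> f (- t)) (at_left t)"
    using left_lim_tendsto_right[OF f, of "- t"]
    by (simp add: reversal_def[abs_def] at_right_minus[of "- t"] filterlim_filtermap)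
qed

lemma cadlag_reversal: "cadlag f \<Longrightarrow> cadlag (reversal f)"
  unfolding cadlag_def[of "reversal f"] using reversal_tendsto by blast

lemma left_lim_reversal: "cadlag f \<Longrightarrow> left_lim (reversal f) t = f (- t)"
  unfolding left_lim_def by (rule tendsto_Lim) (simp_all add: reversal_tendsto)

section \<open>Semicontinuity and coercivity of the objective\<close>

lemma usc_env_less_nhds:
  assumes f: "cadlag f" and "usc_env f y < c"
  shows "\<forall>\<^sub>F w in nhds y. usc_env f w < c"
proof -
  obtain c' where c': "usc_env f y < c'" "c' < c" using assms(2) dense by blast
  obtain d where d: "0 < d" "\<And>w. dist w y < d \<Longrightarrow> f w < c'"
    using cadlag_less_nhds[OF f c'(1)] unfolding eventually_nhds_metric by blast
  have "usc_env f w < c" if "dist w y < d" for w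
  proof -
    have "left_lim f w \<le> c'"
      by (rule left_lim_less[OF f, of "y - d"]) (use that d(2) in \<open>auto simp: dist_real_def abs_less_iff intro!: less_imp_le\<close>)
    then show ?thesis using d(2)[OF that] c'(2) by simp
  qed
  then show ?thesis using d(1) unfolding eventually_nhds_metric by blast
qed

text \<open>Upper semicontinuity in \<open>y\<close> is the direction needed for limits of
  maximizers. The lower bounds \<open>c n\<close> form a sequence of their own, so that a maximizing
  sequence for one \<open>x\<close> and maximizers for varying \<open>x n\<close> are treated
  alike.\<close>

lemma envelope_obj_limit:
  assumes f: "cadlag f" and x: "x \<longlonglongrightarrow> x0" and y: "y \<longlonglongrightarrow> y0" and c: "c \<longlonglongrightarrow> c0"
    and le: "\<And>n. c n \<le> envelope_obj f (x n) (y n)"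
  shows "c0 \<le> envelope_obj f x0 y0"
proof (rule ccontr)
  assume "\<not> ?thesis"
  then have "usc_env f y0 < c0 + (y0 - x0)\<^sup>2 / 2" unfolding envelope_obj_def by linarith
  then obtain d where d: "usc_env f y0 < d" "d < c0 + (y0 - x0)\<^sup>2 / 2" using dense by blast
  have "\<forall>\<^sub>F n in sequentially. usc_env f (y n) < d"
    by (rule eventually_compose_filterlim[OF usc_env_less_nhds[OF f d(1)] y])
  moreover have "(\<lambda>n. c n + (y n - x n)\<^sup>2 / 2) \<longlonglongrightarrow> c0 + (y0 - x0)\<^sup>2 / 2"
    by (intro tendsto_intros x y c) auto
  from order_tendstoD(1)[OF this d(2)] have "\<forall>\<^sub>F n in sequentially. d < c n + (y n - x n)\<^sup>2 / 2" .
  ultimately have "\<forall>\<^sub>F n in sequentially. False"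
  proof eventually_elim
    case (elim n)
    then show ?case using le[of n] unfolding envelope_obj_def by linarith
  qed
  then show False by simp
qed

lemma cadlag_bounded_above:
  assumes f: "cadlag f" shows "\<exists>K. \<forall>w\<in>{a..b}. f w \<le> K"
proof (rule ccontr)
  assume "\<not> ?thesis"
  then have "\<forall>n::nat. \<exists>w\<in>{a..b}. real n < f w" by (force simp: not_le)
  then obtain w where w: "\<And>n. w n \<in> {a..b}" "\<And>n. real n < f (w n)" by metis
  obtain l r where r: "strict_mono r" "(w \<circ> r) \<longlonglongrightarrow> l"
    using seq_compactE[of "{a..b}" w] w(1) compact_imp_seq_compact[OF compact_Icc] by metis
  have "\<forall>\<^sub>F w in nhds l. f w < usc_env f l + 1" by (rule cadlag_less_nhds[OF f]) simp
  then have "\<forall>\<^sub>F n in sequentially. f ((w \<circ> r) n) < usc_env f l + 1"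
    using r(2) by (rule eventually_compose_filterlim)
  moreover have "\<forall>\<^sub>F n in sequentially. usc_env f l + 1 \<le> real n"
    by (rule eventually_at_top_linorderI[of "nat \<lceil>usc_env f l + 1\<rceil>"]) linarith
  ultimately have "\<forall>\<^sub>F n in sequentially. False"
  proof eventually_elim
    case (elim n)
    have "real n \<le> real (r n)" using seq_suble[OF r(1), of n] by simp
    then show ?case using w(2)[of "r n"] elim by simp
  qed
  then show False by simp
qed

text \<open>The growth constant 1/8 is small enough to be absorbed by the quadratic penalty after
  \<open>y\<^sup>2 \<le> 2 * x\<^sup>2 + 2 * (y - x)\<^sup>2\<close>. The bound in \<open>x\<close>
  confines the maximizers for a given \<open>x\<close>; the bound in \<open>y\<close> confines the
  arguments whose maximizers are bounded.\<close>

lemma envelope_obj_coercive: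
  assumes f: "cadlag f" and lim: "((\<lambda>x. f x / x\<^sup>2) \<longlongrightarrow> 0) at_infinity"
  obtains K where "\<And>x y. envelope_obj f x x \<le> envelope_obj f x y \<Longrightarrow>
    (y - x)\<^sup>2 \<le> 3 / 2 * x\<^sup>2 + K \<and> (y - x)\<^sup>2 \<le> 3 / 2 * y\<^sup>2 + K"
    "\<And>x. \<exists>B. \<forall>y. envelope_obj f x y \<le> B"
proof -
  have "\<forall>\<^sub>F x in at_infinity. dist (f x / x\<^sup>2) 0 < 1 / 8" by (rule tendstoD[OF lim]) simp
  then obtain R where R: "\<And>x. R \<le> \<bar>x\<bar> \<Longrightarrow> \<bar>f x / x\<^sup>2\<bar> < 1 / 8"
    unfolding eventually_at_infinity by auto
  have far: "\<bar>f x\<bar> \<le> x\<^sup>2 / 8" if "max R 1 \<le> \<bar>x\<bar>" for x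
  proof -
    have "0 < x\<^sup>2" using that by auto
    then show ?thesis using R[of x] that by (simp add: abs_divide field_simps)
  qed
  define R1 where "R1 = max R 1"
  obtain K1 where K1: "\<And>w. w \<in> {- R1..R1} \<Longrightarrow> f w \<le> K1" using cadlag_bounded_above[OF f] by blast
  have nf: "cadlag (\<lambda>x. - f x)"
    unfolding cadlag_def using tendsto_minus[OF cadlag_right[OF f]] tendsto_minus[OF cadlag_left[OF f]] by blast
  obtain K2 where K2: "\<And>w. w \<in> {- R1..R1} \<Longrightarrow> - f w \<le> K2" using cadlag_bounded_above[OF nf] by blast
  define K where "K = max 0 (max K1 K2)"
  have bnd: "f w \<le> w\<^sup>2 / 8 + K \<and> - (w\<^sup>2 / 8) - K \<le> f w" for w
  proof (cases "w \<in> {- R1..R1}")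
    case True
    then show ?thesis using K1[of w] K2[of w] zero_le_power2[of w] unfolding K_def by linarith
  next
    case False
    then have "\<bar>f w\<bar> \<le> w\<^sup>2 / 8" by (intro far) (auto simp: R1_def)
    then show ?thesis unfolding K_def by linarith
  qed
  have env_le: "usc_env f w \<le> w\<^sup>2 / 8 + K" for w
  proof -
    have "((\<lambda>s. s\<^sup>2 / 8 + K) \<longlongrightarrow> w\<^sup>2 / 8 + K) (at_left w)" by (intro tendsto_intros) auto
    then have "left_lim f w \<le> w\<^sup>2 / 8 + K"
      by (rule tendsto_le[OF _ _ cadlag_left[OF f], rotated]) (use bnd in auto)
    then show ?thesis using bnd[of w] by simp
  qed
  have env_ge: "- (w\<^sup>2 / 8) - K \<le> usc_env f w" for w using bnd[of w] by linarith
  have 1: "(y - x)\<^sup>2 \<le> 3 / 2 * x\<^sup>2 + 8 * K \<and> (y - x)\<^sup>2 \<le> 3 / 2 * y\<^sup>2 + 8 * K"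
    if "envelope_obj f x x \<le> envelope_obj f x y" for x y
  proof -
    have "envelope_obj f x x = usc_env f x" by (simp add: envelope_obj_def)
    with that have "(y - x)\<^sup>2 / 2 \<le> usc_env f y - usc_env f x" unfolding envelope_obj_def by linarith
    then have *: "(y - x)\<^sup>2 / 2 \<le> y\<^sup>2 / 8 + x\<^sup>2 / 8 + 2 * K" using env_le[of y] env_ge[of x] by linarith
    have "y\<^sup>2 \<le> 2 * x\<^sup>2 + 2 * (y - x)\<^sup>2" "x\<^sup>2 \<le> 2 * y\<^sup>2 + 2 * (y - x)\<^sup>2"
      using zero_le_power2[of "2 * x - y"] zero_le_power2[of "2 * y - x"]
      by (simp_all add: power2_eq_square algebra_simps)
    then show ?thesis using * by linarith
  qed
  have 2: "\<exists>B. \<forall>y. envelope_obj f x y \<le> B" for x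
  proof (intro exI allI)
    fix y
    have "y\<^sup>2 \<le> 2 * x\<^sup>2 + 2 * (y - x)\<^sup>2"
      using zero_le_power2[of "2 * x - y"] by (simp add: power2_eq_square algebra_simps)
    then show "envelope_obj f x y \<le> x\<^sup>2 + K"
      using env_le[of y] zero_le_power2[of x] zero_le_power2[of "y - x"] unfolding envelope_obj_def by linarith
  qed
  show thesis by (rule that[OF 1 2])
qed

section \<open>Maximizers\<close>

definition maximizer :: "(real \<Rightarrow> real) \<Rightarrow> real \<Rightarrow> real \<Rightarrow> bool" where
  "maximizer f x y \<longleftrightarrow> (\<forall>z. envelope_obj f x z \<le> envelope_obj f x y)"

text \<open>Adding the two optimality inequalities cancels the envelope and leaves the cross term
  \<open>(y2 - y1) * (x2 - x1)\<close>.\<close>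

lemma maximizer_mono:
  assumes "maximizer f x1 y1" "maximizer f x2 y2" "x1 < x2"
  shows "y1 \<le> y2"
proof -
  have "envelope_obj f x1 y2 \<le> envelope_obj f x1 y1" "envelope_obj f x2 y1 \<le> envelope_obj f x2 y2"
    using assms by (auto simp: maximizer_def)
  then have "(y1 - x1)\<^sup>2 + (y2 - x2)\<^sup>2 \<le> (y2 - x1)\<^sup>2 + (y1 - x2)\<^sup>2" unfolding envelope_obj_def by linarith
  then have "0 \<le> (y2 - y1) * (x2 - x1)" by (simp add: power2_eq_square algebra_simps)
  then show ?thesis using assms(3) by (simp add: zero_le_mult_iff)
qed

text \<open>\<open>GREATEST\<close> is meaningful only if a largest maximizer exists: coercivity
  bounds the set of maximizers, semicontinuity makes it nonempty and closed.\<close>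

lemma amax_maximizer:
  assumes f: "cadlag f" and lim: "((\<lambda>x. f x / x\<^sup>2) \<longlongrightarrow> 0) at_infinity"
  shows "maximizer f x (amax f x)" and "maximizer f x y \<Longrightarrow> y \<le> amax f x"
proof -
  obtain K where K: "\<And>x y. envelope_obj f x x \<le> envelope_obj f x y \<Longrightarrow>
      (y - x)\<^sup>2 \<le> 3 / 2 * x\<^sup>2 + K \<and> (y - x)\<^sup>2 \<le> 3 / 2 * y\<^sup>2 + K"
    "\<And>x. \<exists>B. \<forall>y. envelope_obj f x y \<le> B"
    by (rule envelope_obj_coercive[OF f lim]) blast
  define \<rho> where "\<rho> = sqrt (3 / 2 * x\<^sup>2 + K)"
  have bnd: "y \<in> {x - \<rho>..x + \<rho>}" if "envelope_obj f x x \<le> envelope_obj f x y" for y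
  proof -
    have "sqrt ((y - x)\<^sup>2) \<le> \<rho>" unfolding \<rho>_def using K(1)[OF that] by (intro real_sqrt_le_mono) simp
    then show ?thesis by auto
  qed
  define S where "S = (SUP y. envelope_obj f x y)"
  have bdd: "bdd_above (range (envelope_obj f x))" using K(2)[of x] by (auto simp: bdd_above_def)
  have S_ge: "envelope_obj f x y \<le> S" for y unfolding S_def by (rule cSUP_upper[OF _ bdd]) simp
  have "\<exists>y. maximizer f x y"
  proof (cases "\<exists>y. envelope_obj f x y = S")
    case True
    then show ?thesis using S_ge by (auto simp: maximizer_def)
  next
    case False
    then have lt: "envelope_obj f x y < S" for y using S_ge[of y] by (simp add: order_less_le)
    have "\<exists>y. max (envelope_obj f x x) (S - 1 / Suc n) < envelope_obj f x y" for n
    proof -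
      have "max (envelope_obj f x x) (S - 1 / Suc n) < S" using lt by simp
      then show ?thesis
        using less_cSUP_iff[OF UNIV_not_empty bdd, of "max (envelope_obj f x x) (S - 1 / Suc n)", folded S_def]
        by (simp only:) blast
    qed
    then have "\<forall>n. \<exists>y. max (envelope_obj f x x) (S - 1 / Suc n) < envelope_obj f x y" by blast
    from choice[OF this]
    obtain y where y: "\<And>n. max (envelope_obj f x x) (S - 1 / Suc n) < envelope_obj f x (y n)" by blast
    have "y n \<in> {x - \<rho>..x + \<rho>}" for n using y[of n] by (intro bnd) simp
    then obtain l r where r: "strict_mono r" "(y \<circ> r) \<longlonglongrightarrow> l"
      using seq_compactE[of "{x - \<rho>..x + \<rho>}" y] compact_imp_seq_compact[OF compact_Icc] by metis
    have "S \<le> envelope_obj f x l"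
    proof (rule envelope_obj_limit[OF f, of "\<lambda>_. x" x "y \<circ> r" l "\<lambda>n. S - 1 / Suc (r n)"])
      have "(\<lambda>n. 1 / real (Suc n)) \<longlonglongrightarrow> 0" using LIMSEQ_inverse_real_of_nat by (simp add: inverse_eq_divide)
      from LIMSEQ_subseq_LIMSEQ[OF this r(1)]
      have "(\<lambda>n. 1 / real (Suc (r n))) \<longlonglongrightarrow> 0" by (simp add: comp_def)
      from tendsto_diff[OF tendsto_const[of S] this]
      show "(\<lambda>n. S - 1 / Suc (r n)) \<longlonglongrightarrow> S" by simp
      show "S - 1 / Suc (r n) \<le> envelope_obj f x ((y \<circ> r) n)" for n using y[of "r n"] by simp
    qed (use r in auto)
    then show ?thesis using lt[of l] by simp
  qed
  then obtain y0 where y0: "maximizer f x y0" by blast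
  let ?A = "{y. maximizer f x y}"
  have bddA: "bdd_above ?A" using bnd by (intro bdd_aboveI[of _ "x + \<rho>"]) (auto simp: maximizer_def)
  have "closed ?A"
    unfolding closed_sequential_limits
  proof (intro allI impI, elim conjE)
    fix y l assume y: "\<forall>n. y n \<in> ?A" "y \<longlonglongrightarrow> l"
    have "envelope_obj f x z \<le> envelope_obj f x l" for z
      by (rule envelope_obj_limit[OF f tendsto_const y(2) tendsto_const]) (use y(1) in \<open>auto simp: maximizer_def\<close>)
    then show "l \<in> ?A" by (simp add: maximizer_def)
  qed
  then have top: "maximizer f x (Sup ?A)"
    using closed_contains_Sup[of ?A] bddA y0 by auto
  have le: "y \<le> Sup ?A" if "maximizer f x y" for y by (rule cSup_upper[OF _ bddA]) (simp add: that)
  have "amax f x = Sup ?A"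
    unfolding amax_def maximizer_def[symmetric] by (rule Greatest_equality[where P="maximizer f x", OF top le])
  then show "maximizer f x (amax f x)" "maximizer f x y \<Longrightarrow> y \<le> amax f x"
    using top le by simp_all
qed

lemma closed_range_amax:
  assumes f: "cadlag f" and lim: "((\<lambda>x. f x / x\<^sup>2) \<longlongrightarrow> 0) at_infinity"
    and tame: "tame f" "tame (reversal f)" and nt: "touchless f"
  shows "closed (range (amax f))"
  unfolding closed_sequential_limits
proof (intro allI impI, elim conjE)
  fix s y assume s: "\<forall>n. s n \<in> range (amax f)" "s \<longlonglongrightarrow> y"
  note max = amax_maximizer(1)[OF f lim] and greatest = amax_maximizer(2)[OF f lim]
  show "y \<in> range (amax f)"
  proof (rule ccontr)
    assume notin: "y \<notin> range (amax f)"
    have "\<forall>n. \<exists>u. s n = amax f u" using s(1) by blast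
    from choice[OF this] obtain x' where x': "\<And>n. s n = amax f (x' n)" by blast
    \<comment> \<open>Arguments of convergent maximizers stay bounded; along a subsequence they
      converge to some \<open>x\<close>, for which \<open>y\<close> is again a maximizer.\<close>
    obtain K where K: "\<And>x y. envelope_obj f x x \<le> envelope_obj f x y \<Longrightarrow> (y - x)\<^sup>2 \<le> 3 / 2 * y\<^sup>2 + K"
      by (rule envelope_obj_coercive[OF f lim]) blast
    obtain B where B: "\<And>n. \<bar>s n\<bar> \<le> B" using convergent_imp_Bseq[of s] s(2) by (auto simp: convergent_def Bseq_def)
    have "\<bar>x' n\<bar> \<le> B + sqrt (3 / 2 * B\<^sup>2 + K)" for n
    proof -
      have "(s n)\<^sup>2 \<le> B\<^sup>2" using B[of n] by (metis abs_ge_zero power2_abs power_mono)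
      moreover have "(s n - x' n)\<^sup>2 \<le> 3 / 2 * (s n)\<^sup>2 + K"
        using max[of "x' n"] by (intro K) (simp add: maximizer_def x')
      ultimately have "sqrt ((s n - x' n)\<^sup>2) \<le> sqrt (3 / 2 * B\<^sup>2 + K)" by (intro real_sqrt_le_mono) linarith
      then show ?thesis using B[of n] by simp
    qed
    then have "bounded (range x')" by (auto simp: bounded_iff)
    from bounded_imp_convergent_subsequence[OF this]
    obtain x r where r: "strict_mono r" "(x' \<circ> r) \<longlonglongrightarrow> x" by auto
    define X where "X = x' \<circ> r"
    define A where "A n = amax f (X n)" for n
    have X: "X \<longlonglongrightarrow> x" using r by (simp add: X_def)
    have A: "A \<longlonglongrightarrow> y"
      using LIMSEQ_subseq_LIMSEQ[OF s(2) r(1)] by (simp add: A_def[abs_def] X_def comp_def x')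
    have maxA: "maximizer f (X n) (A n)" for n by (simp add: A_def max)
    have obj_cont: "(\<lambda>n. envelope_obj f (X n) w) \<longlonglongrightarrow> envelope_obj f x w" for w
      unfolding envelope_obj_def by (intro tendsto_intros X) auto
    have max_y: "maximizer f x y"
      unfolding maximizer_def
    proof
      fix w show "envelope_obj f x w \<le> envelope_obj f x y"
        by (rule envelope_obj_limit[OF f X A obj_cont[of w]]) (use maxA in \<open>simp add: maximizer_def\<close>)
    qed
    define z where "z = amax f x"
    have "y < z" using greatest[OF max_y] notin by (auto simp: z_def order_less_le)
    have max_z: "maximizer f x z" by (simp add: z_def max)
    \<comment> \<open>For \<open>X n \<ge> x\<close> monotonicity would give
      \<open>A n \<ge> z > y\<close>, impossible for large \<open>n\<close>; the value
      \<open>y\<close> itself is excluded because it is not attained.\<close>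
    have left: "\<forall>\<^sub>F n in sequentially. A n < y"
      using order_tendstoD(2)[OF A \<open>y < z\<close>]
    proof eventually_elim
      case (elim n)
      have "X n < x"
      proof (rule ccontr)
        assume "\<not> X n < x"
        then have "X n = x \<or> x < X n" by linarith
        then show False using maximizer_mono[OF max_z maxA, of n] elim by (auto simp: A_def z_def)
      qed
      then have "A n \<le> y" by (rule maximizer_mono[OF maxA max_y])
      then show ?case using notin by (auto simp: A_def order_less_le)
    qed
    have A_ge: "usc_env f y - (y - X n)\<^sup>2 / 2 \<le> usc_env f (A n) - (A n - X n)\<^sup>2 / 2" for n
      using maxA[of n] by (auto simp: maximizer_def envelope_obj_def)
    define l where "l = left_lim f y"
    \<comment> \<open>At an upward jump, points slightly to the left have an envelope smaller by a
      fixed amount and cannot beat \<open>y\<close> for arguments near \<open>x\<close>.\<close>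
    have no_jump: "f y \<le> l"
    proof (rule ccontr)
      assume "\<not> f y \<le> l"
      then obtain c where c: "l < c" "c < f y" using dense[of l "f y"] by auto
      obtain a where a: "a < y" "\<And>t. \<lbrakk>a < t; t < y\<rbrakk> \<Longrightarrow> f t < c"
        using order_tendstoD(2)[OF cadlag_left[OF f] c(1)[unfolded l_def]] by (auto simp: eventually_at_left_field)
      have env: "usc_env f t \<le> c" if "a < t" "t < y" for t
      proof -
        have "left_lim f t \<le> c"
          by (rule left_lim_less[OF f that(1)]) (use a(2) that in \<open>auto intro!: less_imp_le\<close>)
        then show ?thesis using a(2)[OF that] by simp
      qed
      have "(\<lambda>n. (A n - X n)\<^sup>2 / 2 - (y - X n)\<^sup>2 / 2) \<longlonglongrightarrow> (y - x)\<^sup>2 / 2 - (y - x)\<^sup>2 / 2"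
        by (intro tendsto_intros X A) auto
      then have "\<forall>\<^sub>F n in sequentially. c - f y < (A n - X n)\<^sup>2 / 2 - (y - X n)\<^sup>2 / 2"
        by (rule order_tendstoD(1)) (use c(2) in simp)
      then have "\<forall>\<^sub>F n in sequentially. False"
        using left order_tendstoD(1)[OF A a(1)]
      proof eventually_elim
        case (elim n)
        have "f y \<le> usc_env f y" by simp
        then show ?case using A_ge[of n] env[of "A n"] elim by linarith
      qed
      then show False by simp
    qed
    then have env_y: "usc_env f y = l" by (simp add: l_def)
    have env: "usc_env f w \<le> l + (w - x)\<^sup>2 / 2 - (y - x)\<^sup>2 / 2" for w
      using max_y env_y by (simp add: maximizer_def envelope_obj_def algebra_simps)
    have sq: "(w - x)\<^sup>2 / 2 - (v - x)\<^sup>2 / 2 = (w - v) * ((w - v) / 2 + (v - x))" for w v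
      by (simp add: power2_eq_square field_simps)
    consider "x < y" | "y < x" | "x = y" by linarith
    then show False
    proof cases
      case 1
      have "f (y - h) \<le> usc_env f y - (y - x) / 2 * h" if "0 < h" "h < y - x" for h
      proof -
        \<comment> \<open>For \<open>h < y - x\<close> the parabola retains at least half of its
          slope at \<open>y\<close>.\<close>
        have "h * ((y - x) / 2) \<le> h * ((y - x) - h / 2)" using that by (intro mult_left_mono) auto
        then show ?thesis using env[of "y - h"] sq[of "y - h" y] env_y by (simp add: algebra_simps)
      qed
      then have "left_lim f y < f y"
        by (intro tame_local_max(1)[OF f tame(1), of "(y - x) / 2" "y - x"]) (use 1 in auto)
      then show False using no_jump by (simp add: l_def)
    next
      case 2
      \<comment> \<open>The maximizers \<open>A n\<close> to the left of \<open>y\<close> force an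
        average slope tending to \<open>x - y\<close>, which is \<open>4 * \<epsilon>\<close>, hence
        eventually above \<open>2 * \<epsilon>\<close>; the reversed path will allow only
        \<open>\<epsilon>\<close>.\<close>
      define \<epsilon> where "\<epsilon> = (x - y) / 4"
      have \<epsilon>: "0 < \<epsilon>" using 2 by (simp add: \<epsilon>_def)
      note rev = cadlag_reversal[OF f]
      have env_rev: "usc_env (reversal f) (- y) = l" using env_y by (simp add: reversal_def left_lim_reversal[OF f] max.commute)
      have "reversal f (- y - h) \<le> usc_env (reversal f) (- y) - (x - y) / 2 * h" if "0 < h" "h < x - y" for h
      proof -
        have "h * ((x - y) / 2) \<le> h * ((x - y) - h / 2)" using that by (intro mult_left_mono) auto
        then have "usc_env f (y + h) \<le> l - (x - y) / 2 * h"
          using env[of "y + h"] sq[of "y + h" y] by (simp add: algebra_simps)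
        then have "left_lim f (y + h) \<le> l - (x - y) / 2 * h" by simp
        moreover have "reversal f (- y - h) = left_lim f (y + h)" by (simp add: reversal_def add.commute)
        ultimately show ?thesis unfolding env_rev by (simp only:)
      qed
      then obtain \<eta> where \<eta>: "0 < \<eta>" "\<And>h. \<lbrakk>0 < h; h < \<eta>\<rbrakk> \<Longrightarrow> reversal f (- y + h) - reversal f (- y) \<le> \<epsilon> * h"
        using tame_local_max(2)[OF rev tame(2), of "(x - y) / 2" "x - y" "- y" \<epsilon>] 2 \<epsilon> by auto
      \<comment> \<open>The slope bound for the reversal concerns left limits of \<open>f\<close>;
        the values of \<open>f\<close> are left limits of the reversal and inherit it.\<close>
      have up: "usc_env f (y - h) \<le> l + \<epsilon> * h" if "0 < h" "h < \<eta>" for h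
      proof -
        have "left_lim f (y - h) \<le> l + \<epsilon> * h" using \<eta>(2)[OF that] by (simp add: reversal_def l_def)
        moreover have "left_lim (reversal f) (- y + h) \<le> l + \<epsilon> * h"
        proof (rule left_lim_less[OF rev, of "- y"])
          fix s assume "- y < s" "s < - y + h"
          then have "reversal f s \<le> l + \<epsilon> * (s + y)" "\<epsilon> * (s + y) \<le> \<epsilon> * h"
            using \<eta>(2)[of "s + y"] that \<epsilon> by (simp_all add: reversal_def l_def)
          then show "reversal f s \<le> l + \<epsilon> * h" by linarith
        qed (use that in simp)
        then have "f (y - h) \<le> l + \<epsilon> * h" by (simp add: left_lim_reversal[OF f])
        ultimately show ?thesis by simp
      qed
      have "(\<lambda>n. X n - (A n + y) / 2) \<longlonglongrightarrow> x - (y + y) / 2" by (intro tendsto_intros X A) auto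
      then have "\<forall>\<^sub>F n in sequentially. 2 * \<epsilon> < X n - (A n + y) / 2"
        by (rule order_tendstoD(1)) (use 2 in \<open>simp add: \<epsilon>_def field_simps\<close>)
      moreover have "\<forall>\<^sub>F n in sequentially. y - \<eta> < A n"
        by (rule order_tendstoD(1)[OF A]) (use \<eta>(1) in simp)
      ultimately have "\<forall>\<^sub>F n in sequentially. False" using left
      proof eventually_elim
        case (elim n)
        define h where "h = y - A n"
        have h: "0 < h" "h < \<eta>" using elim by (auto simp: h_def)
        have "h * (2 * \<epsilon>) < h * (X n - (A n + y) / 2)" using elim(1) h(1) by (rule mult_strict_left_mono)
        also have "\<dots> = (A n - X n)\<^sup>2 / 2 - (y - X n)\<^sup>2 / 2"
          by (simp add: h_def power2_eq_square field_simps)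
        also have "\<dots> \<le> usc_env f (A n) - l" using A_ge[of n] env_y by simp
        also have "\<dots> \<le> \<epsilon> * h"
        proof -
          have "y - h = A n" by (simp add: h_def)
          then show ?thesis using up[OF h] by (simp only:)
        qed
        finally have "\<epsilon> * h < 0" by (simp add: algebra_simps)
        then show ?case using mult_pos_pos[OF \<epsilon> h(1)] by linarith
      qed
      then show False by simp
    next
      case 3
      have env: "usc_env f w \<le> l + (w - y)\<^sup>2 / 2" for w using env[of w] 3 by simp
      have "envelope_obj f x y = envelope_obj f x z"
        using max_y max_z by (intro antisym) (auto simp: maximizer_def)
      then have env_z: "usc_env f z = l + (z - y)\<^sup>2 / 2" using env_y 3 by (simp add: envelope_obj_def)
      have "f (z - h) \<le> usc_env f z - (z - y) / 2 * h" if "0 < h" "h < z - y" for h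
      proof -
        have "h * ((z - y) / 2) \<le> h * ((z - y) - h / 2)" using that by (intro mult_left_mono) auto
        then show ?thesis using env[of "z - h"] sq[of "z - h" z] env_z 3 by (simp add: algebra_simps)
      qed
      then have jump: "left_lim f z < f z"
        by (intro tame_local_max(1)[OF f tame(1), of "(z - y) / 2" "z - y"]) (use \<open>y < z\<close> in auto)
      show False
      proof (rule touchless_contra[OF f nt \<open>y < z\<close> jump])
        show touch: "f z = left_lim f y + (z - y)\<^sup>2 / 2" using env_z jump by (simp add: l_def)
        show "usc_env f w \<le> left_lim f y + (w - y)\<^sup>2 / 2" for w using env[of w] by (simp add: l_def)
        show "\<exists>w. y - \<delta> < w \<and> w < y \<and> f z - (z - w)\<^sup>2 / 2 < f w" if \<delta>: "0 < \<delta>" for \<delta>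
        proof (rule ccontr)
          \<comment> \<open>Otherwise the path lies below the parabola of \<open>z\<close> to the
            left of \<open>y\<close>, hence below a line of slope \<open>z - y\<close> through the
            left limit, which forces an upward jump at \<open>y\<close>.\<close>
          assume *: "\<not> ?thesis"
          have "f (y - h) \<le> usc_env f y - (z - y) * h" if "0 < h" "h < \<delta>" for h
          proof -
            have "f (y - h) \<le> f z - (z - (y - h))\<^sup>2 / 2" using *[unfolded not_ex, rule_format, of "y - h"] that by simp
            also have "\<dots> = l - (z - y) * h - h\<^sup>2 / 2"
              unfolding touch by (simp add: l_def power2_eq_square field_simps)
            also have "\<dots> \<le> l - (z - y) * h" by simp
            finally show ?thesis using env_y by simp
          qed
          then have "left_lim f y < f y"
            by (intro tame_local_max(1)[OF f tame(1), of "z - y" \<delta>]) (use \<open>y < z\<close> \<delta> in auto)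
          then show False using no_jump by (simp add: l_def)
        qed
      qed
    qed
  qed
qed

section \<open>Almost sure properties and conclusion\<close>

text \<open>Reversal replaces values by left limits, which changes nothing at dyadic points where
  the path is continuous; so a forward grid of the reversal is a backward grid of
  \<open>f\<close>.\<close>

lemma tame_reversal:
  assumes cont: "\<And>(u::int) (r::nat). left_lim f (of_int u / 2 ^ r) = f (of_int u / 2 ^ r)"
    and tame: "\<And>n. \<exists>J0. \<forall>(u::int) (r::nat). tame_at f (- 1) J0 (1 / real (Suc n)) (of_int u / 2 ^ r)"
  shows "tame (reversal f)"
  unfolding tame_def
proof
  fix n :: nat
  obtain J0 where J0: "\<And>u r. tame_at f (- 1) J0 (1 / real (Suc n)) (of_int (u::int) / 2 ^ (r::nat))"
    using tame[of n] by blast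
  have "grid (reversal f) (of_int u / 2 ^ r) (1 / 2 ^ m) = grid f (of_int (- u) / 2 ^ r) (- 1 / 2 ^ m)"
    for u :: int and r m :: nat
  proof -
    have "reversal f (of_int u / 2 ^ r + of_int j * (1 / 2 ^ m)) = f (of_int (- u) / 2 ^ r + of_int j * (- 1 / 2 ^ m))"
      for j :: int
    proof -
      have "- (of_int u / 2 ^ r + of_int j * (1 / 2 ^ m)) = (of_int (- (u * 2 ^ m + j * 2 ^ r)) / 2 ^ (r + m) :: real)"
        by (simp add: power_add field_simps)
      moreover have "of_int (- u) / 2 ^ r + of_int j * (- 1 / 2 ^ m) = - (of_int u / 2 ^ r + of_int j * (1 / 2 ^ m) :: real)"
        by simp
      ultimately show ?thesis unfolding reversal_def by (simp only: cont)
    qed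
    then show ?thesis unfolding grid_def by (intro ext) (simp only:)
  qed
  then have "tame_at (reversal f) 1 J0 (1 / real (Suc n)) (of_int u / 2 ^ r)" for u :: int and r :: nat
    using J0[of "- u" r] unfolding tame_at_def by (simp only:)
  then show "\<exists>J0. \<forall>(u::int) (r::nat). tame_at (reversal f) 1 J0 (1 / real (Suc n)) (of_int u / 2 ^ r)" by blast
qed

context zero_drift_levy
begin

lemma AE_cadlag: "AE \<omega> in M. cadlag (\<lambda>t. X t \<omega>)"
  using levy by (simp add: two_sided_levy_def)

text \<open>A single backward step is the shortest window of \<open>oscillates\<close>. For
  infinitely many \<open>m\<close> the step \<open>1 / 2 ^ m\<close> moves the path by at most its
  own length, so the left limit, which exists, equals the value.\<close>

lemma AE_continuous_at: "AE \<omega> in M. left_lim (\<lambda>t. X t \<omega>) d = X d \<omega>"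
proof -
  have [measurable]: "X t \<in> borel_measurable M" for t using levy by (simp add: two_sided_levy_def)
  have "AE \<omega> in M. \<exists>J::nat. \<not> (\<forall>\<^sub>F m in sequentially. 1 / 2 ^ m < \<bar>X (d - 1 / 2 ^ m) \<omega> - X d \<omega>\<bar>)"
  proof (rule AE_not_eventually)
    fix \<epsilon> :: real assume "0 < \<epsilon>"
    then obtain J where J: "\<And>m q. J \<le> m \<Longrightarrow> prob {\<omega>\<in>space M.
        oscillates (1 / 2 ^ m) (2 ^ (m - J)) (\<lambda>j. grid (\<lambda>t. X t \<omega>) q (- 1 / 2 ^ m) j) 0} \<le> \<epsilon>"
      using prob_oscillates_small[OF levy drift zero_less_one, of \<epsilon> "- 1"] by auto
    have "prob {\<omega>\<in>space M. 1 / 2 ^ m < \<bar>X (d - 1 / 2 ^ m) \<omega> - X d \<omega>\<bar>} \<le> \<epsilon>" if "J \<le> m" for m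
    proof -
      let ?O = "{\<omega>\<in>space M. oscillates (1 / 2 ^ m) (2 ^ (m - J)) (\<lambda>j. grid (\<lambda>t. X t \<omega>) d (- 1 / 2 ^ m) j) 0}"
      have "?O \<in> events"
        using iid_family_measurable_pred[OF iid_grid, of "- 1" "\<lambda>x. oscillates (1 / 2 ^ m) (2 ^ (m - J)) x 0" d m]
        by (simp add: pred_def)
      moreover have "{\<omega>\<in>space M. 1 / 2 ^ m < \<bar>X (d - 1 / 2 ^ m) \<omega> - X d \<omega>\<bar>} \<subseteq> ?O"
      proof safe
        fix \<omega> assume "1 / 2 ^ m < \<bar>X (d - 1 / 2 ^ m) \<omega> - X d \<omega>\<bar>"
        then have "1 / 2 ^ m * of_int 1 < \<bar>walk (grid (\<lambda>t. X t \<omega>) d (- 1 / 2 ^ m)) 0 (0 + 1)\<bar>"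
          by (subst walk_grid) auto
        moreover have "(1::int) \<in> {1..2 ^ (m - J)}" by simp
        ultimately show "oscillates (1 / 2 ^ m) (2 ^ (m - J)) (\<lambda>j. grid (\<lambda>t. X t \<omega>) d (- 1 / 2 ^ m) j) 0"
          unfolding oscillates_def by blast
      qed
      ultimately have "prob {\<omega>\<in>space M. 1 / 2 ^ m < \<bar>X (d - 1 / 2 ^ m) \<omega> - X d \<omega>\<bar>} \<le> prob ?O"
        by (intro finite_measure_mono)
      then show ?thesis using J[OF that, of d] by linarith
    qed
    then show "\<exists>(J::nat) m0. \<forall>m\<ge>m0. prob {\<omega>\<in>space M. 1 / 2 ^ m < \<bar>X (d - 1 / 2 ^ m) \<omega> - X d \<omega>\<bar>} \<le> \<epsilon>" by blast
  qed measurable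
  then show ?thesis using AE_cadlag
  proof eventually_elim
    case (elim \<omega>)
    define l where "l = left_lim (\<lambda>t. X t \<omega>) d"
    have pow: "(\<lambda>m. 1 / 2 ^ m :: real) \<longlonglongrightarrow> 0"
      using LIMSEQ_power_zero[of "1 / 2 :: real"] by (simp add: power_divide)
    have "filterlim (\<lambda>m. d - 1 / 2 ^ m) (at_left d) sequentially"
      unfolding filterlim_at using tendsto_diff[OF tendsto_const[of d] pow] by auto
    with cadlag_left[OF elim(2), of d]
    have "(\<lambda>m. X (d - 1 / 2 ^ m) \<omega>) \<longlonglongrightarrow> l" unfolding l_def by (rule filterlim_compose)
    then have "(\<lambda>m. \<bar>X (d - 1 / 2 ^ m) \<omega> - X d \<omega>\<bar> - 1 / 2 ^ m) \<longlonglongrightarrow> \<bar>l - X d \<omega>\<bar> - 0"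
      by (intro tendsto_intros pow)
    then have lim: "(\<lambda>m. \<bar>X (d - 1 / 2 ^ m) \<omega> - X d \<omega>\<bar> - 1 / 2 ^ m) \<longlonglongrightarrow> \<bar>l - X d \<omega>\<bar>" by simp
    have "\<not> 0 < \<bar>l - X d \<omega>\<bar>"
    proof
      assume "0 < \<bar>l - X d \<omega>\<bar>"
      from order_tendstoD(1)[OF lim this] show False using elim(1) by simp
    qed
    then show ?case by (simp add: l_def)
  qed
qed

lemma AE_tame_at:
  assumes "\<sigma> \<in> {1, - 1}"
  shows "AE \<omega> in M. \<forall>n. \<exists>J0. \<forall>(u::int) (r::nat). tame_at (\<lambda>t. X t \<omega>) \<sigma> J0 (1 / real (Suc n)) (of_int u / 2 ^ r)"
  unfolding AE_all_countable
proof
  fix n :: nat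
  have "0 < 1 / real (Suc n)" by simp
  from AE_grid_tame[OF this assms]
  obtain J0 where "\<And>q. AE \<omega> in M. tame_at (\<lambda>t. X t \<omega>) \<sigma> J0 (1 / real (Suc n)) q" by blast
  then have "AE \<omega> in M. \<forall>(u::int) (r::nat). tame_at (\<lambda>t. X t \<omega>) \<sigma> J0 (1 / real (Suc n)) (of_int u / 2 ^ r)"
    unfolding AE_all_countable by blast
  then show "AE \<omega> in M. \<exists>J0. \<forall>(u::int) (r::nat). tame_at (\<lambda>t. X t \<omega>) \<sigma> J0 (1 / real (Suc n)) (of_int u / 2 ^ r)"
    by eventually_elim blast
qed

lemma AE_touchless:
  assumes "hypB M X"
  shows "AE \<omega> in M. touchless (\<lambda>t. X t \<omega>)"
  unfolding touchless_def AE_all_countable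
proof
  fix n :: nat
  have "0 < 1 / real (Suc n)" "1 \<in> {1, - 1 :: real}" by simp_all
  from AE_grid_tame[OF this]
  obtain J0 where J0: "\<And>m q. J0 \<le> m \<Longrightarrow> prob {\<omega>\<in>space M. \<not> rises (1 / real (Suc n) / 2 ^ m) (2 ^ (m - J0))
      (\<lambda>j. grid (\<lambda>t. X t \<omega>) q (1 / 2 ^ m) j) 0} \<ge> 1 / 2"
    by blast
  have "AE \<omega> in M. no_touch_at (\<lambda>t. X t \<omega>) J0 (1 / real (Suc n)) L q" for L q
    by (rule AE_no_touch[OF assms J0])
  then have "AE \<omega> in M. \<forall>(u::int) (r::nat) (L::nat).
      no_touch_at (\<lambda>t. X t \<omega>) J0 (1 / real (Suc n)) (int L) (of_int u / 2 ^ r)"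
    unfolding AE_all_countable by blast
  then show "AE \<omega> in M. \<exists>J0. \<forall>(u::int) (r::nat) (L::nat).
      no_touch_at (\<lambda>t. X t \<omega>) J0 (1 / real (Suc n)) (int L) (of_int u / 2 ^ r)"
    by eventually_elim blast
qed

end

theorem theorem4p14:
  fixes M :: "'a measure" and X :: "real \<Rightarrow> 'a \<Rightarrow> real"
  assumes "two_sided_levy M X"
    and "AE \<omega> in M. locally_bv (\<lambda>t. X t \<omega>) \<and> zero_drift (\<lambda>t. X t \<omega>)"
    and "hypA M X" and "hypB M X" and "assumptionBI M X"
  shows "AE \<omega> in M. closed (range (amax (\<lambda>t. X t \<omega>))) \<and>
           range (amax (\<lambda>t. X t \<omega>)) = closure (range (amax (\<lambda>t. X t \<omega>)))"
proof -
  interpret zero_drift_levy M X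
    using assms(1,2) by unfold_locales auto
  have "AE \<omega> in M. \<forall>(u::int) (r::nat). left_lim (\<lambda>t. X t \<omega>) (of_int u / 2 ^ r) = X (of_int u / 2 ^ r) \<omega>"
    unfolding AE_all_countable using AE_continuous_at by blast
  moreover have "AE \<omega> in M. \<forall>n. \<exists>J0. \<forall>(u::int) (r::nat). tame_at (\<lambda>t. X t \<omega>) 1 J0 (1 / real (Suc n)) (of_int u / 2 ^ r)"
    by (rule AE_tame_at) simp
  moreover have "AE \<omega> in M. \<forall>n. \<exists>J0. \<forall>(u::int) (r::nat). tame_at (\<lambda>t. X t \<omega>) (- 1) J0 (1 / real (Suc n)) (of_int u / 2 ^ r)"
    by (rule AE_tame_at) simp
  ultimately show ?thesis
    using AE_touchless[OF assms(4)] AE_cadlag assms(3)[unfolded hypA_def]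
  proof eventually_elim
    case (elim \<omega>)
    have "tame (\<lambda>t. X t \<omega>)" unfolding tame_def by (rule elim(2))
    moreover have "tame (reversal (\<lambda>t. X t \<omega>))"
      by (rule tame_reversal) (use elim(1,3) in blast)+
    ultimately have "closed (range (amax (\<lambda>t. X t \<omega>)))"
      by (intro closed_range_amax elim)
    then show ?case by (simp add: closure_closed)
  qed
qed

end
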